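(* Let $\Xi=(\Xi_t)_{t\in[0,1]}$ be a centered Gauss-Markov process with $\Xi_0=0$, non-degenerate on $(0,1)$, with covariance kernel $K_\Xi(s,t)=u(s)v(t)$ for $0\le s\le t\le1$, and let $q=u/v$. Let $1/2<\alpha\le1$, $0<L<\infty$, $0<M\le\infty$, and suppose that a) $q\in C^1([0,1])$ and $0<\inf_{t\in[0,1]}q'(t)\le\sup_{t\in[0,1]}q'(t)\le C<\infty$ for some constant $C$, b) $\inf_{t\in[0,1]}v(t)>0$, and c) $v'$ and $q'$ are Hölder continuous on $[0,1]$ with index $\gamma>1/2$. Let $\mathcal F(\alpha,L,M)$ be the Hölder class and $\mathfrak E_{1,n},\mathfrak E_{2,n}$ the experiments defined in the context. Then, if $M<\infty$, $$\Delta\bigl(\mathfrak E_{1,n}(\mathcal F(\alpha,L,M)),\mathfrak E_{2,n}(\mathcal F(\alpha,L,M))\bigr)\to0\quad\text{as } n\to\infty,$$ i.e. the two sequences of experiments are asymptotically equivalent. Moreover, if the function $v\cdot q'$ is constant on $[0,1]$, this asymptotic equivalence also holds in the case $M=\infty$.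
   Context: Process. A Gauss-Markov process is a process that is both Gaussian and Markov; non-degenerate on $(0,1)$ means $\operatorname{Var}(\Xi_t)>0$ for $t\in(0,1)$. $K_\Xi(s,t)=\operatorname{Cov}(\Xi_s,\Xi_t)$. $\Xi$ is taken with continuous sample paths. Hölder class. For $0<\alpha\le1$, $0<L<\infty$, $0<M\le\infty$, $$\mathcal F(\alpha,L,M)=\Bigl\{f:[0,1]\to\mathbb R:\ \sup_{0\le x<y\le1}\frac{|f(x)-f(y)|}{|x-y|^\alpha}\le L\ \text{ and }\ \|f\|_\infty\le M\Bigr\},$$ where for $M=\infty$ the condition $\|f\|_\infty\le M$ is omitted. Experiments. Let $t_{i,n}=i/n$. For a class $\Theta$ of functions, $\mathfrak E_{1,n}(\Theta)=(\mathbb R^n,\mathcal B(\mathbb R^n),(\mathbf P^f_{1,n})_{f\in\Theta})$, where $\mathbf P^f_{1,n}$ is the law of $(Y_{1,n},\dots,Y_{n,n})$ with $Y_{i,n}=f(t_{i,n})+\sqrt n\,(\Xi_{t_{i,n}}-\Xi_{t_{i-1,n}})$, $i=1,\dots,n$. $\mathfrak E_{2,n}(\Theta)=(C([0,1],\mathbb R),\mathcal B(C([0,1],\mathbb R)),(\mathbf P^f_{2,n})_{f\in\Theta})$, where $\mathbf P^f_{2,n}$ is the law of the process $Y_t=\int_0^t f(s)\,\mathrm ds+\frac1{\sqrt n}\Xi_t$, $t\in[0,1]$. Le Cam distance. For two experiments $\mathfrak E_i=(\mathcal X_i,\mathscr X_i,(\mathbf P_{i,\theta})_{\theta\in\Theta})$,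 $i=1,2$, with the same parameter set, $\delta(\mathfrak E_1,\mathfrak E_2)=\inf_K\sup_{\theta\in\Theta}\|K\mathbf P_{1,\theta}-\mathbf P_{2,\theta}\|_{\mathrm{TV}}$, the infimum being over all Markov kernels $K:\mathcal X_1\times\mathscr X_2\to[0,1]$, where $K\mathbf P(A)=\int K(x,A)\,\mathbf P(\mathrm dx)$ and $\|\mathbf P-\mathbf Q\|_{\mathrm{TV}}=\sup_A|\mathbf P(A)-\mathbf Q(A)|$; and $\Delta(\mathfrak E_1,\mathfrak E_2)=\max\{\delta(\mathfrak E_1,\mathfrak E_2),\delta(\mathfrak E_2,\mathfrak E_1)\}$. *)

theory Defs
  imports "HOL-Probability.Probability"
begin

subsection \<open>Gauss-Markov processes\<close>

text \<open>Constants count as (degenerate) normal variables, as usual for Gaussian processes.\<close>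

definition gaussian_var :: "'w measure \<Rightarrow> ('w \<Rightarrow> real) \<Rightarrow> bool" where
  "gaussian_var P X \<longleftrightarrow> X \<in> borel_measurable P \<and>
     ((\<exists>\<mu>. AE \<omega> in P. X \<omega> = \<mu>) \<or>
      (\<exists>\<mu> \<sigma>. \<sigma> > 0 \<and> distributed P lborel X (normal_density \<mu> \<sigma>)))"

definition gaussian_process :: "'w measure \<Rightarrow> real set \<Rightarrow> (real \<Rightarrow> 'w \<Rightarrow> real) \<Rightarrow> bool" where
  "gaussian_process P T X \<longleftrightarrow>
     (\<forall>I c. finite I \<and> I \<subseteq> T \<longrightarrow> gaussian_var P (\<lambda>\<omega>. \<Sum>t\<in>I. c t * X t \<omega>))"

text \<open>The \<open>\<sigma>\<close>-algebra generated by the variables \<open>X r\<close>, \<open>r \<in> T\<close>, \<open>r \<le> s\<close>.\<close>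

definition past :: "'w measure \<Rightarrow> real set \<Rightarrow> (real \<Rightarrow> 'w \<Rightarrow> real) \<Rightarrow> real \<Rightarrow> 'w measure" where
  "past P T X s =
     sigma (space P) {X r -` A \<inter> space P |r A. r \<in> T \<and> r \<le> s \<and> A \<in> sets borel}"

definition markov_process :: "'w measure \<Rightarrow> real set \<Rightarrow> (real \<Rightarrow> 'w \<Rightarrow> real) \<Rightarrow> bool" where
  "markov_process P T X \<longleftrightarrow>
     (\<forall>t\<in>T. X t \<in> borel_measurable P) \<and>
     (\<forall>s\<in>T. \<forall>t\<in>T. s \<le> t \<longrightarrow> (\<forall>A\<in>sets borel. AE \<omega> in P.
        real_cond_exp P (past P T X s) (\<lambda>\<omega>'. indicator A (X t \<omega>')) \<omega> =
        real_cond_exp P (vimage_algebra (space P) (X s) borel) (\<lambda>\<omega>'. indicator A (X t \<omega>')) \<omega>))"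

definition gauss_markov_process :: "'w measure \<Rightarrow> real set \<Rightarrow> (real \<Rightarrow> 'w \<Rightarrow> real) \<Rightarrow> bool" where
  "gauss_markov_process P T X \<longleftrightarrow> gaussian_process P T X \<and> markov_process P T X"

definition covariance :: "'w measure \<Rightarrow> ('w \<Rightarrow> real) \<Rightarrow> ('w \<Rightarrow> real) \<Rightarrow> real" where
  "covariance P X Y =
     (\<integral>\<omega>. (X \<omega> - (\<integral>\<omega>'. X \<omega>' \<partial>P)) * (Y \<omega> - (\<integral>\<omega>'. Y \<omega>' \<partial>P)) \<partial>P)"

subsection \<open>Hoelder conditions\<close>

definition hoelder_on :: "real set \<Rightarrow> real \<Rightarrow> (real \<Rightarrow> real) \<Rightarrow> bool" where
  "hoelder_on S \<gamma> g \<longleftrightarrow>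
     (\<exists>H. \<forall>x\<in>S. \<forall>y\<in>S. \<bar>g x - g y\<bar> \<le> H * \<bar>x - y\<bar> powr \<gamma>)"

text \<open>Functions on \<open>[0,1]\<close> are represented by functions that are \<open>undefined\<close> outside
  \<open>[0,1]\<close>. For \<open>M = \<infinity>\<close> the second bound is vacuous.\<close>

definition hoelder_class :: "real \<Rightarrow> real \<Rightarrow> ereal \<Rightarrow> (real \<Rightarrow> real) set" where
  "hoelder_class \<alpha> L M = {f \<in> extensional {0..1}.
     (\<forall>x y. 0 \<le> x \<and> x < y \<and> y \<le> 1 \<longrightarrow> \<bar>f x - f y\<bar> / \<bar>x - y\<bar> powr \<alpha> \<le> L) \<and>
     (\<forall>x\<in>{0..1}. ereal \<bar>f x\<bar> \<le> M)}"

subsection \<open>Statistical experiments and the Le Cam distance\<close>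

record ('p, 'x) stat_experiment =
  sample_space :: "'x measure"
  params :: "'p set"
  law :: "'p \<Rightarrow> 'x measure"

text \<open>\<open>sample_space\<close> only contributes its measurable space; for \<open>\<theta> \<in> params\<close>, \<open>law \<theta>\<close>
  is meant to be a probability measure on that space.\<close>

definition tv_dist :: "'x measure \<Rightarrow> 'x measure \<Rightarrow> ennreal" where
  "tv_dist P Q = (SUP A\<in>sets Q. ennreal \<bar>measure P A - measure Q A\<bar>)"

text \<open>A Markov kernel from \<open>X\<close> to \<open>Y\<close> is a measurable map from \<open>X\<close> into the probability
  measures on \<open>Y\<close>, and \<open>P \<bind> K\<close> is \<open>A \<mapsto> \<integral> K(x, A) P(dx)\<close>. Both experiments are
  assumed to have the same parameter set.\<close>

definition deficiency ::
    "('p, 'x) stat_experiment \<Rightarrow> ('p, 'y) stat_experiment \<Rightarrow> ennreal" where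
  "deficiency E F =
     (INF K \<in> sample_space E \<rightarrow>\<^sub>M prob_algebra (sample_space F).
        SUP \<theta>\<in>params E. tv_dist (law E \<theta> \<bind> K) (law F \<theta>))"

definition le_cam_dist ::
    "('p, 'x) stat_experiment \<Rightarrow> ('p, 'y) stat_experiment \<Rightarrow> ennreal" where
  "le_cam_dist E F = max (deficiency E F) (deficiency F E)"

subsection \<open>The two experiments\<close>

text \<open>\<open>\<real>\<^sup>n\<close> is the set of extensional functions on \<open>{1..n}\<close> with the product
  \<open>\<sigma>\<close>-algebra, which is the Borel \<open>\<sigma>\<close>-algebra.\<close>

definition grid :: "nat \<Rightarrow> nat \<Rightarrow> real" where
  "grid n i = real i / real n"

definition experiment1 ::
    "'w measure \<Rightarrow> (real \<Rightarrow> 'w \<Rightarrow> real) \<Rightarrow> nat \<Rightarrow> (real \<Rightarrow> real) set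
       \<Rightarrow> (real \<Rightarrow> real, nat \<Rightarrow> real) stat_experiment" where
  "experiment1 P \<Xi> n \<Theta> =
     \<lparr> sample_space = (\<Pi>\<^sub>M i\<in>{1..n}. borel),
       params = \<Theta>,
       law = (\<lambda>f. distr P (\<Pi>\<^sub>M i\<in>{1..n}. borel)
         (\<lambda>\<omega>. \<lambda>i\<in>{1..n}. f (grid n i) + sqrt (real n) * (\<Xi> (grid n i) \<omega> - \<Xi> (grid n (i - 1)) \<omega>))) \<rparr>"

text \<open>\<open>C([0,1])\<close> with the topology of the supremum metric; its elements are
  extensional on \<open>[0,1]\<close>.\<close>

definition C01 :: "(real \<Rightarrow> real) topology" where
  "C01 = mtopology_of (cfunspace (top_of_set {0..1}) euclidean_metric)"

definition borel_C01 :: "(real \<Rightarrow> real) measure" where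
  "borel_C01 = sigma (topspace C01) {U. openin C01 U}"

definition experiment2 ::
    "'w measure \<Rightarrow> (real \<Rightarrow> 'w \<Rightarrow> real) \<Rightarrow> nat \<Rightarrow> (real \<Rightarrow> real) set
       \<Rightarrow> (real \<Rightarrow> real, real \<Rightarrow> real) stat_experiment" where
  "experiment2 P \<Xi> n \<Theta> =
     \<lparr> sample_space = borel_C01,
       params = \<Theta>,
       law = (\<lambda>f. distr P borel_C01
         (\<lambda>\<omega>. \<lambda>t\<in>{0..1}. integral {0..t} f + 1 / sqrt (real n) * \<Xi> t \<omega>)) \<rparr>"

end

theory Submission
  imports Defs
begin

text \<open>
  Write \<open>X = \<Xi> / v\<close>. This is in law a Brownian motion run with the clock \<open>q\<close>, so its increments over
  any grid are independent normal variables, and a change of drift costs at most twice the weighted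
  Euclidean norm of the shift of the increments in total variation.

  From the continuous to the discrete experiment one takes scaled increments of the path; the
  remaining drift is the error of a Riemann sum. In the other direction one interpolates the
  partial sums of the observations linearly in the clock \<open>q\<close> and adds an independent copy of the bridge
  \<open>X - IX\<close>, where \<open>IX\<close> is the interpolation of \<open>X\<close> on the grid. As \<open>IX\<close> and \<open>X - IX\<close> are
  uncorrelated, the noise has exactly the right law, and the drift error is an interpolation error,
  which is controlled by the Hoelder continuity of the derivative of \<open>F / v\<close> with respect to \<open>q\<close>.
  Both errors have norm of order \<open>n powr (1 / 2 - \<beta>)\<close> with \<open>\<beta> = min \<alpha> \<gamma> > 1 / 2\<close>.

  These bounds are uniform only for bounded \<open>f\<close>. Hence \<open>f\<close> is split into \<open>f 0\<close> and \<open>f - f 0\<close>, which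
  is bounded by \<open>L\<close>, and the kernel is corrected by the last partial sum times the interpolation
  error of the function \<open>t / v t\<close>, which makes it exact on constant functions. Total variation on
  \<open>C01\<close> is computed on the algebra of cylinder sets over refinements of the grid.
\<close>

subsection \<open>Joint characteristic functions that factorise\<close>

text \<open>Drift errors are measured relative to \<open>dq\<close>, the variance of a noise
  increment. If the error on cell \<open>j\<close> is at most \<open>\<rho> * dq N j\<close>, its
  weighted squared norm is at most \<open>\<rho>^2 * q 1\<close> on every refinement of the grid, so
  bounds on cylinders are uniform and pass to the whole sigma-algebra. With \<open>\<rho>\<close> of
  order \<open>sqrt n * n powr - \<beta>\<close> this is where \<beta> > 1/2 comes from. The
  obstacle is the correction by the last partial sum: it is computed from the data and carries the
  noise \<open>\<Xi> 1\<close>, which is correlated with the interpolated noise. Given the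
  observations, however, it is a fixed shift of the fresh bridge, and since the correction vanishes
  on the observation grid, that shift is the image of a shift of the increments of the independent
  copy. This costs the mean of \<open>|\<Xi> 1|\<close> times \<open>n powr - \<beta>\<close>,
  without the factor \<open>sqrt n\<close>. Laws of vectors are identified through linear forms
  only; joint independence is deduced from the one-dimensional uniqueness theorem for characteristic
  functions.\<close>

lemma integral_weighted_indicator_char:
  fixes X w :: "'a \<Rightarrow> real"
  assumes \<mu>: "real_distribution \<mu>"
    and [measurable]: "X \<in> borel_measurable Q" "w \<in> borel_measurable Q" "A \<in> sets borel"
    and w: "\<And>\<omega>. 0 \<le> w \<omega>" "integrable Q w"
    and char: "\<And>s. (CLINT \<omega>|Q. w \<omega> *\<^sub>R iexp (s * X \<omega>)) = (LINT \<omega>|Q. w \<omega>) *\<^sub>R char \<mu> s"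
  shows "(LINT \<omega>|Q. w \<omega> * indicator A (X \<omega>)) = measure \<mu> A * (LINT \<omega>|Q. w \<omega>)"
proof (cases "(LINT \<omega>|Q. w \<omega>) = 0")
  case True
  then have "AE \<omega> in Q. w \<omega> = 0"
    using integral_nonneg_eq_0_iff_AE[OF w(2)] w(1) by auto
  then have "(LINT \<omega>|Q. w \<omega> * indicator A (X \<omega>)) = (LINT \<omega>|Q. 0)"
    by (intro integral_cong_AE) auto
  with True show ?thesis by simp
next
  case False
  define a where "a = (LINT \<omega>|Q. w \<omega>)"
  have a: "a > 0" using False w by (simp add: a_def order_less_le)
  \<comment> \<open>Normalising the weight to a density makes \<open>X\<close> a random variable
    with characteristic function \<open>char \<mu>\<close>, so uniqueness in one dimension applies.
    The division by the total weight is why the case of zero mass is treated apart.\<close>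
  define D where "D = density Q (\<lambda>\<omega>. ennreal (w \<omega> / a))"
  define \<nu> where "\<nu> = distr D borel X"
  have [measurable]: "X \<in> borel_measurable D" by (simp add: D_def)
  have "emeasure D (space D) = (\<integral>\<^sup>+\<omega>. ennreal (w \<omega> / a) \<partial>Q)"
    by (simp add: D_def emeasure_density cong: nn_integral_cong)
  also have "\<dots> = ennreal (LINT \<omega>|Q. w \<omega> / a)"
    using w a by (intro nn_integral_eq_integral) auto
  also have "\<dots> = 1" using a by (simp add: a_def[symmetric])
  finally interpret D: prob_space D by (intro prob_spaceI)
  have \<nu>: "real_distribution \<nu>"
    unfolding \<nu>_def by (rule D.real_distribution_distr) simp
  have "char \<nu> s = char \<mu> s" for s
  proof -
    have "char \<nu> s = (CLINT \<omega>|D. iexp (s * X \<omega>))"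
      unfolding char_def \<nu>_def by (subst integral_distr) auto
    also have "\<dots> = (CLINT \<omega>|Q. (w \<omega> / a) *\<^sub>R iexp (s * X \<omega>))"
      unfolding D_def using w a by (subst integral_density) auto
    also have "\<dots> = (CLINT \<omega>|Q. (1/a) *\<^sub>R (w \<omega> *\<^sub>R iexp (s * X \<omega>)))"
      by (intro Bochner_Integration.integral_cong) auto
    also have "\<dots> = (1/a) *\<^sub>R (CLINT \<omega>|Q. w \<omega> *\<^sub>R iexp (s * X \<omega>))"
      by (rule integral_scaleR_right)
    also have "\<dots> = char \<mu> s" using char[of s] a by (simp add: a_def[symmetric])
    finally show ?thesis .
  qed
  then have "\<nu> = \<mu>" by (intro Levy_uniqueness \<nu> \<mu> ext)
  then have "measure \<mu> A = measure \<nu> A" by simp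
  also have "\<dots> = measure D (X -` A \<inter> space D)" by (simp add: \<nu>_def measure_distr)
  also have "\<dots> = (LINT \<omega>|D. indicator (X -` A \<inter> space D) \<omega>)" by simp
  also have "\<dots> = (LINT \<omega>|D. indicator A (X \<omega>))"
    by (intro Bochner_Integration.integral_cong) (auto split: split_indicator)
  also have "\<dots> = (LINT \<omega>|Q. (w \<omega> / a) *\<^sub>R indicator A (X \<omega>))"
    unfolding D_def using w a by (subst integral_density) auto
  also have "\<dots> = (LINT \<omega>|Q. w \<omega> * indicator A (X \<omega>)) / a" by simp
  finally show ?thesis using a by (simp add: a_def[symmetric])
qed

text \<open>Uniqueness in several dimensions by peeling off one coordinate at a time:
  \<open>Q\<close> is replaced by its restriction to \<open>X k \<in> A k\<close>. This restriction
  is no longer a probability, hence the induction over finite measures with free mass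
  \<open>a\<close>. To see that its characteristic function still factorises, the one-dimensional
  lemma is applied to \<open>X k\<close> under the nonnegative weights \<open>1 + cos\<close> and
  \<open>1 + sin\<close> of a linear form in the remaining coordinates.\<close>

lemma measure_Inter_vimage_char_prod:
  fixes X :: "'i \<Rightarrow> 'a \<Rightarrow> real"
  assumes "finite I" "finite_measure Q"
    and "\<And>i. i \<in> I \<Longrightarrow> X i \<in> borel_measurable Q"
    and "\<And>i. i \<in> I \<Longrightarrow> real_distribution (\<mu> i)"
    and "\<And>c. (CLINT \<omega>|Q. iexp (\<Sum>i\<in>I. c i * X i \<omega>)) = a *\<^sub>R (\<Prod>i\<in>I. char (\<mu> i) (c i))"
    and "\<And>i. i \<in> I \<Longrightarrow> A i \<in> sets borel"
  shows "measure Q {\<omega>\<in>space Q. \<forall>i\<in>I. X i \<omega> \<in> A i} = a * (\<Prod>i\<in>I. measure (\<mu> i) (A i))"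
  using assms
proof (induction I arbitrary: Q a rule: finite_induct)
  case empty
  then interpret finite_measure Q by simp
  show ?case using empty(4)[of "\<lambda>_. 0"] by (simp add: complex_eq_iff scaleR_conv_of_real)
next
  case (insert k I)
  note [simp] = \<open>finite I\<close> \<open>k \<notin> I\<close>
  interpret Q: finite_measure Q by fact
  have [measurable]: "X k \<in> borel_measurable Q" "\<And>i. i \<in> I \<Longrightarrow> X i \<in> borel_measurable Q"
    "A k \<in> sets borel" using insert.prems by auto
  have \<mu>k: "real_distribution (\<mu> k)" using insert.prems by auto
  note char = insert.prems(4)
  define B where "B = X k -` A k \<inter> space Q"
  have [measurable]: "B \<in> sets Q" unfolding B_def by measurable
  define m where "m = measure (\<mu> k) (A k)"
  define \<theta> where "\<theta> c \<omega> = (\<Sum>i\<in>I. c i * X i \<omega>)" for c \<omega>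
  have [measurable]: "\<theta> c \<in> borel_measurable Q" for c unfolding \<theta>_def by measurable
  define p where "p c = (\<Prod>i\<in>I. char (\<mu> i) (c i))" for c
  have E: "(CLINT \<omega>|Q. iexp (s * X k \<omega> + \<theta> c \<omega>)) = a *\<^sub>R (char (\<mu> k) s * p c)" for s c
  proof -
    have *: "(\<Sum>i\<in>insert k I. (c(k:=s)) i * X i \<omega>) = s * X k \<omega> + \<theta> c \<omega>" for \<omega>
      by (simp add: \<theta>_def) (intro sum.cong, auto)
    have "(\<Prod>i\<in>insert k I. char (\<mu> i) ((c(k:=s)) i)) = char (\<mu> k) s * p c"
      by (simp add: p_def) (intro disjI2 prod.cong, auto)
    with char[of "c(k:=s)"] show ?thesis unfolding * by (simp only:)
  qed
  have int [simp]: "integrable Q (\<lambda>\<omega>. iexp (f \<omega>))" if [measurable]: "f \<in> borel_measurable Q" for f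
    by (rule Q.integrable_const_bound[of _ 1]) auto
  have H: "has_bochner_integral Q (\<lambda>\<omega>. iexp (s * X k \<omega> + \<theta> c \<omega>)) (a *\<^sub>R (char (\<mu> k) s * p c))" for s c
    unfolding has_bochner_integral_iff E by (intro conjI int refl) measurable
  \<comment> \<open>A weight times \<open>iexp\<close> is a combination of three exponentials, to
    which the hypothesis applies with coefficients \<open>0\<close>, \<open>c\<close> and
    \<open>-c\<close> on the remaining coordinates. The summand 1 keeps the weights
    nonnegative.\<close>
  have weight_cos: "(1 + cos t) *\<^sub>R iexp r = iexp (r + 0) + ((1/2) * iexp (r + t) + (1/2) * iexp (r + - t))" for r t
    by (simp add: complex_eq_iff cos_add sin_add cos_diff sin_diff Re_exp Im_exp) (simp add: field_simps)
  have weight_sin: "(1 + sin t) *\<^sub>R iexp r = iexp (r + 0) + ((- \<i>/2) * iexp (r + t) + (\<i>/2) * iexp (r + - t))" for r t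
    by (simp add: complex_eq_iff cos_add sin_add cos_diff sin_diff Re_exp Im_exp) (simp add: field_simps)
  have char0: "char (\<mu> i) 0 = 1" if "i \<in> insert k I" for i
    using insert.prems(3)[OF that] real_distribution.char_zero by blast
  have p0: "p (\<lambda>_. 0) = 1" unfolding p_def using char0 by (intro prod.neutral) auto
  have \<theta>0: "\<theta> (\<lambda>_. 0) \<omega> = 0" for \<omega> by (simp add: \<theta>_def)
  have neg: "\<theta> (\<lambda>i. - c i) \<omega> = - \<theta> c \<omega>" for c \<omega> by (simp add: \<theta>_def sum_negf)
  have Bint: "(LINT \<omega>|Q. f \<omega> * indicator (A k) (X k \<omega>)) = (LINT \<omega>|Q. f \<omega> * indicator B \<omega>)" for f
    by (intro Bochner_Integration.integral_cong) (auto simp: B_def split: split_indicator)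
  have key: "(LINT \<omega>|Q. w \<omega> * indicator B \<omega>) = m * (LINT \<omega>|Q. w \<omega>)"
    if w: "w \<in> borel_measurable Q" "\<And>\<omega>. 0 \<le> w \<omega>" "integrable Q w"
      "\<And>s. (CLINT \<omega>|Q. w \<omega> *\<^sub>R iexp (s * X k \<omega>)) = (LINT \<omega>|Q. w \<omega>) *\<^sub>R char (\<mu> k) s" for w
    unfolding Bint[symmetric] m_def
    using w by (intro integral_weighted_indicator_char[OF \<mu>k]) auto
  \<comment> \<open>At \<open>s = 0\<close> the unknown constant \<open>b\<close> turns out to be
    the total weight.\<close>
  have char_w: "(CLINT \<omega>|Q. w \<omega> *\<^sub>R iexp (s * X k \<omega>)) = (LINT \<omega>|Q. w \<omega>) *\<^sub>R char (\<mu> k) s"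
    if "\<And>s. (CLINT \<omega>|Q. w \<omega> *\<^sub>R iexp (s * X k \<omega>)) = b * char (\<mu> k) s" for w s b
  proof -
    have "complex_of_real (LINT \<omega>|Q. w \<omega>) = (CLINT \<omega>|Q. w \<omega> *\<^sub>R iexp (0 * X k \<omega>))"
      by (simp add: scaleR_conv_of_real)
    also have "\<dots> = b" using that[of 0] char0[of k] by simp
    finally show ?thesis using that[of s] by (simp add: scaleR_conv_of_real)
  qed
  have cosw: "(LINT \<omega>|Q. (1 + cos (\<theta> c \<omega>)) * indicator B \<omega>) = m * (LINT \<omega>|Q. 1 + cos (\<theta> c \<omega>))" for c
  proof (rule key)
    show "integrable Q (\<lambda>\<omega>. 1 + cos (\<theta> c \<omega>))"
      by (rule Q.integrable_const_bound[of _ 2]) (auto intro!: AE_I2 order_trans[OF abs_triangle_ineq] simp: abs_cos_le_one)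
    show "0 \<le> 1 + cos (\<theta> c \<omega>)" for \<omega> using cos_ge_minus_one[of "\<theta> c \<omega>"] by linarith
    have "(CLINT \<omega>|Q. (1 + cos (\<theta> c \<omega>)) *\<^sub>R iexp (s * X k \<omega>))
      = (CLINT \<omega>|Q. iexp (s * X k \<omega> + \<theta> (\<lambda>_. 0) \<omega>) + ((1/2) * iexp (s * X k \<omega> + \<theta> c \<omega>)
          + (1/2) * iexp (s * X k \<omega> + \<theta> (\<lambda>i. - c i) \<omega>)))" for s
      unfolding \<theta>0 neg by (intro Bochner_Integration.integral_cong refl weight_cos)
    also have "\<dots> s = a *\<^sub>R (char (\<mu> k) s * p (\<lambda>_. 0)) + ((1/2) * (a *\<^sub>R (char (\<mu> k) s * p c))
          + (1/2) * (a *\<^sub>R (char (\<mu> k) s * p (\<lambda>i. - c i))))" for s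
      by (intro has_bochner_integral_integral_eq has_bochner_integral_add has_bochner_integral_mult_right H)
    also have "\<dots> s = (a * (1 + p c / 2 + p (\<lambda>i. - c i) / 2)) * char (\<mu> k) s" for s
      unfolding p0 scaleR_conv_of_real by (simp add: field_simps)
    finally show "(CLINT \<omega>|Q. (1 + cos (\<theta> c \<omega>)) *\<^sub>R iexp (s * X k \<omega>)) =
      (LINT \<omega>|Q. 1 + cos (\<theta> c \<omega>)) *\<^sub>R char (\<mu> k) s" for s
      by (rule char_w)
  qed simp
  have sinw: "(LINT \<omega>|Q. (1 + sin (\<theta> c \<omega>)) * indicator B \<omega>) = m * (LINT \<omega>|Q. 1 + sin (\<theta> c \<omega>))" for c
  proof (rule key)
    show "integrable Q (\<lambda>\<omega>. 1 + sin (\<theta> c \<omega>))"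
      by (rule Q.integrable_const_bound[of _ 2]) (auto intro!: AE_I2 order_trans[OF abs_triangle_ineq] simp: abs_sin_le_one)
    show "0 \<le> 1 + sin (\<theta> c \<omega>)" for \<omega> using sin_ge_minus_one[of "\<theta> c \<omega>"] by linarith
    have "(CLINT \<omega>|Q. (1 + sin (\<theta> c \<omega>)) *\<^sub>R iexp (s * X k \<omega>))
      = (CLINT \<omega>|Q. iexp (s * X k \<omega> + \<theta> (\<lambda>_. 0) \<omega>) + ((- \<i>/2) * iexp (s * X k \<omega> + \<theta> c \<omega>)
          + (\<i>/2) * iexp (s * X k \<omega> + \<theta> (\<lambda>i. - c i) \<omega>)))" for s
      unfolding \<theta>0 neg by (intro Bochner_Integration.integral_cong refl weight_sin)
    also have "\<dots> s = a *\<^sub>R (char (\<mu> k) s * p (\<lambda>_. 0)) + ((- \<i>/2) * (a *\<^sub>R (char (\<mu> k) s * p c))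
          + (\<i>/2) * (a *\<^sub>R (char (\<mu> k) s * p (\<lambda>i. - c i))))" for s
      by (intro has_bochner_integral_integral_eq has_bochner_integral_add has_bochner_integral_mult_right H)
    also have "\<dots> s = (a * (1 - \<i> * p c / 2 + \<i> * p (\<lambda>i. - c i) / 2)) * char (\<mu> k) s" for s
      unfolding p0 scaleR_conv_of_real by (simp add: field_simps)
    finally show "(CLINT \<omega>|Q. (1 + sin (\<theta> c \<omega>)) *\<^sub>R iexp (s * X k \<omega>)) =
      (LINT \<omega>|Q. 1 + sin (\<theta> c \<omega>)) *\<^sub>R char (\<mu> k) s" for s
      by (rule char_w)
  qed simp
  \<comment> \<open>For \<open>c = 0\<close> the weight \<open>1 + cos\<close> is the constant 2;
    subtracting this case leaves the identities for cosine and sine alone.\<close>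
  have one: "(LINT \<omega>|Q. indicator B \<omega>) = m * (LINT \<omega>|Q. 1)"
    using cosw[of "\<lambda>_. 0"] by (simp add: \<theta>0)
  have bint: "integrable Q (\<lambda>\<omega>. f \<omega> * indicator B \<omega>)" "integrable Q f"
    if [measurable]: "f \<in> borel_measurable Q" and "\<And>\<omega>. \<bar>f \<omega>\<bar> \<le> 1" for f :: "_ \<Rightarrow> real"
    using that by (auto intro!: Q.integrable_const_bound[of _ 1] split: split_indicator)
  have ind: "integrable Q (indicator B :: _ \<Rightarrow> real)"
    by (intro integrable_real_indicator) (auto simp: Q.emeasure_eq_measure)
  have cosB: "(LINT \<omega>|Q. cos (\<theta> c \<omega>) * indicator B \<omega>) = m * (LINT \<omega>|Q. cos (\<theta> c \<omega>))" for c
  proof -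
    have "(LINT \<omega>|Q. (1 + cos (\<theta> c \<omega>)) * indicator B \<omega>)
      = (LINT \<omega>|Q. indicator B \<omega>) + (LINT \<omega>|Q. cos (\<theta> c \<omega>) * indicator B \<omega>)"
      unfolding distrib_right mult_1 by (intro Bochner_Integration.integral_add ind bint) auto
    moreover have "(LINT \<omega>|Q. 1 + cos (\<theta> c \<omega>)) = (LINT \<omega>|Q. 1) + (LINT \<omega>|Q. cos (\<theta> c \<omega>))"
      by (intro Bochner_Integration.integral_add bint) auto
    ultimately show ?thesis using cosw[of c] one by (simp only: distrib_left)
  qed
  have sinB: "(LINT \<omega>|Q. sin (\<theta> c \<omega>) * indicator B \<omega>) = m * (LINT \<omega>|Q. sin (\<theta> c \<omega>))" for c
  proof -
    have "(LINT \<omega>|Q. (1 + sin (\<theta> c \<omega>)) * indicator B \<omega>)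
      = (LINT \<omega>|Q. indicator B \<omega>) + (LINT \<omega>|Q. sin (\<theta> c \<omega>) * indicator B \<omega>)"
      unfolding distrib_right mult_1 by (intro Bochner_Integration.integral_add ind bint) auto
    moreover have "(LINT \<omega>|Q. 1 + sin (\<theta> c \<omega>)) = (LINT \<omega>|Q. 1) + (LINT \<omega>|Q. sin (\<theta> c \<omega>))"
      by (intro Bochner_Integration.integral_add bint) auto
    ultimately show ?thesis using sinw[of c] one by (simp only: distrib_left)
  qed
  define D where "D = density Q (indicator B)"
  have D: "finite_measure D"
    by (rule finite_measureI) (simp add: D_def emeasure_density Q.emeasure_eq_measure)
  have HB: "has_bochner_integral Q (\<lambda>\<omega>. complex_of_real (f \<omega>)) (LINT \<omega>|Q. f \<omega>)"
    if "integrable Q f" for f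
    using that by (intro has_bochner_integral_of_real has_bochner_integral_integrable)
  have charD: "(CLINT \<omega>|D. iexp (\<Sum>i\<in>I. c i * X i \<omega>)) = (a * m) *\<^sub>R (\<Prod>i\<in>I. char (\<mu> i) (c i))" for c
  proof -
    have "(CLINT \<omega>|D. iexp (\<theta> c \<omega>)) = (CLINT \<omega>|Q. indicator B \<omega> *\<^sub>R iexp (\<theta> c \<omega>))"
      unfolding D_def by (subst integral_density[symmetric]) (auto simp: ennreal_indicator)
    also have "\<dots> = (CLINT \<omega>|Q. complex_of_real (cos (\<theta> c \<omega>) * indicator B \<omega>) + \<i> * complex_of_real (sin (\<theta> c \<omega>) * indicator B \<omega>))"
      by (intro Bochner_Integration.integral_cong refl)
         (simp add: complex_eq_iff Re_exp Im_exp split: split_indicator)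
    also have "\<dots> = complex_of_real (LINT \<omega>|Q. cos (\<theta> c \<omega>) * indicator B \<omega>) + \<i> * complex_of_real (LINT \<omega>|Q. sin (\<theta> c \<omega>) * indicator B \<omega>)"
      by (intro has_bochner_integral_integral_eq has_bochner_integral_add has_bochner_integral_mult_right HB bint) auto
    also have "\<dots> = m * (complex_of_real (LINT \<omega>|Q. cos (\<theta> c \<omega>)) + \<i> * complex_of_real (LINT \<omega>|Q. sin (\<theta> c \<omega>)))"
      unfolding cosB sinB by (simp add: algebra_simps)
    also have "\<dots> = m * (CLINT \<omega>|Q. complex_of_real (cos (\<theta> c \<omega>)) + \<i> * complex_of_real (sin (\<theta> c \<omega>)))"
      by (intro arg_cong[of _ _ "(*) (complex_of_real m)"] has_bochner_integral_integral_eq[symmetric] has_bochner_integral_add has_bochner_integral_mult_right HB bint) auto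
    also have "(CLINT \<omega>|Q. complex_of_real (cos (\<theta> c \<omega>)) + \<i> * complex_of_real (sin (\<theta> c \<omega>))) = (CLINT \<omega>|Q. iexp (0 * X k \<omega> + \<theta> c \<omega>))"
      by (intro Bochner_Integration.integral_cong) (auto simp: complex_eq_iff Re_exp Im_exp)
    also have "\<dots> = a *\<^sub>R p c" using E[of 0 c] char0[of k] by simp
    finally show ?thesis by (simp add: \<theta>_def p_def scaleR_conv_of_real mult_ac)
  qed
  have "measure Q {\<omega>\<in>space Q. \<forall>i\<in>insert k I. X i \<omega> \<in> A i}
    = measure D {\<omega>\<in>space D. \<forall>i\<in>I. X i \<omega> \<in> A i}"
  proof -
    have S: "{\<omega>\<in>space Q. \<forall>i\<in>I. X i \<omega> \<in> A i} \<in> sets Q"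
      using insert.prems by (intro sets.sets_Collect_finite_All) (auto intro!: measurable_sets_Collect[of _ _ borel])
    let ?S = "{\<omega>\<in>space Q. \<forall>i\<in>I. X i \<omega> \<in> A i}"
    have "emeasure D ?S = (\<integral>\<^sup>+\<omega>. indicator B \<omega> * indicator ?S \<omega> \<partial>Q)"
      unfolding D_def using S by (intro emeasure_density) simp_all
    also have "\<dots> = (\<integral>\<^sup>+\<omega>. indicator (B \<inter> ?S) \<omega> \<partial>Q)"
      by (simp only: indicator_inter_arith)
    also have "\<dots> = emeasure Q (B \<inter> ?S)"
      using S by (intro nn_integral_indicator sets.Int) simp_all
    also have "B \<inter> {\<omega>\<in>space Q. \<forall>i\<in>I. X i \<omega> \<in> A i} = {\<omega>\<in>space Q. \<forall>i\<in>insert k I. X i \<omega> \<in> A i}"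
      by (auto simp: B_def)
    finally show ?thesis by (simp add: measure_def D_def)
  qed
  also have "\<dots> = (a * m) * (\<Prod>i\<in>I. measure (\<mu> i) (A i))"
    using insert.prems charD by (intro insert.IH D) (auto simp: D_def)
  finally show ?case by (simp add: m_def)
qed

lemma distr_eq_PiM_char:
  fixes X :: "'i \<Rightarrow> 'a \<Rightarrow> real"
  assumes I: "finite I" and Q: "prob_space Q"
    and X [measurable]: "\<And>i. i \<in> I \<Longrightarrow> X i \<in> borel_measurable Q"
    and \<mu>: "\<And>i. real_distribution (\<mu> i)"
    and char: "\<And>c. (CLINT \<omega>|Q. iexp (\<Sum>i\<in>I. c i * X i \<omega>)) = (\<Prod>i\<in>I. char (\<mu> i) (c i))"
  shows "distr Q (\<Pi>\<^sub>M i\<in>I. borel) (\<lambda>\<omega>. \<lambda>i\<in>I. X i \<omega>) = (\<Pi>\<^sub>M i\<in>I. \<mu> i)"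
proof -
  interpret Q: prob_space Q by fact
  interpret \<mu>: real_distribution "\<mu> i" for i by (rule \<mu>)
  interpret product_sigma_finite \<mu> ..
  have sb: "sets (\<mu> i) = sets borel" for i by simp
  show ?thesis
  proof (rule PiM_eqI)
    fix A assume A: "\<And>i. i \<in> I \<Longrightarrow> A i \<in> sets (\<mu> i)"
    have "emeasure (distr Q (\<Pi>\<^sub>M i\<in>I. borel) (\<lambda>\<omega>. \<lambda>i\<in>I. X i \<omega>)) (Pi\<^sub>E I A)
      = emeasure Q {\<omega>\<in>space Q. \<forall>i\<in>I. X i \<omega> \<in> A i}"
      using I A by (subst emeasure_distr) (auto intro!: sets_PiM_I_finite arg_cong[where f="emeasure Q"] simp: PiE_iff)
    also have "\<dots> = ennreal (1 * (\<Prod>i\<in>I. measure (\<mu> i) (A i)))"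
      unfolding Q.emeasure_eq_measure using A char
      by (intro arg_cong[where f=ennreal] measure_Inter_vimage_char_prod[OF I] Q.finite_measure_axioms \<mu>) auto
    also have "\<dots> = (\<Prod>i\<in>I. emeasure (\<mu> i) (A i))"
      by (simp add: \<mu>.emeasure_eq_measure prod_ennreal)
    finally show "emeasure (distr Q (\<Pi>\<^sub>M i\<in>I. borel) (\<lambda>\<omega>. \<lambda>i\<in>I. X i \<omega>)) (Pi\<^sub>E I A) = (\<Prod>i\<in>I. emeasure (\<mu> i) (A i))" .
  qed (use I in \<open>auto cong: sets_PiM_cong\<close>)
qed

subsection \<open>Shifts of independent normal variables\<close>

text \<open>The likelihood ratio of the normal law with mean \<open>h\<close> against the centered
  one of the same variance.\<close>

definition gauss_ratio :: "real \<Rightarrow> real \<Rightarrow> real \<Rightarrow> real" where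
  "gauss_ratio h \<sigma> x = exp (x * h / \<sigma>\<^sup>2 - h\<^sup>2 / (2 * \<sigma>\<^sup>2))"

lemma gauss_ratio_measurable [measurable]: "gauss_ratio h \<sigma> \<in> borel_measurable borel"
  unfolding gauss_ratio_def by measurable

lemma gauss_ratio_pos: "0 < gauss_ratio h \<sigma> x"
  by (simp add: gauss_ratio_def)

lemma normal_density_gauss_ratio:
  "\<sigma> > 0 \<Longrightarrow> normal_density 0 \<sigma> x * gauss_ratio h \<sigma> x = normal_density h \<sigma> x"
  unfolding normal_density_def gauss_ratio_def
  by (simp add: mult_exp_exp) (simp add: field_simps power2_eq_square)

text \<open>Completing the square. Integrated over \<open>x\<close>, it yields the second moment
  \<open>exp (h^2 / \<sigma>^2)\<close> of the likelihood ratio, which controls its distance from 1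
  in mean square.\<close>

lemma normal_density_gauss_ratio_sq:
  assumes "\<sigma> > 0"
  shows "normal_density 0 \<sigma> x * (gauss_ratio h \<sigma> x)\<^sup>2 = exp (h\<^sup>2 / \<sigma>\<^sup>2) * normal_density (2 * h) \<sigma> x"
proof -
  have "- x\<^sup>2 / (2 * \<sigma>\<^sup>2) + 2 * (x * h / \<sigma>\<^sup>2 - h\<^sup>2 / (2 * \<sigma>\<^sup>2)) = h\<^sup>2 / \<sigma>\<^sup>2 + - (x - 2 * h)\<^sup>2 / (2 * \<sigma>\<^sup>2)"
    using assms by (simp add: field_simps power2_eq_square)
  then have "exp (- x\<^sup>2 / (2 * \<sigma>\<^sup>2)) * (exp (x * h / \<sigma>\<^sup>2 - h\<^sup>2 / (2 * \<sigma>\<^sup>2)))\<^sup>2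
      = exp (h\<^sup>2 / \<sigma>\<^sup>2) * exp (- (x - 2 * h)\<^sup>2 / (2 * \<sigma>\<^sup>2))"
    unfolding exp_double[symmetric] by (simp only: mult_exp_exp)
  then show ?thesis
    unfolding normal_density_def gauss_ratio_def diff_0_right by (simp add: mult.left_commute)
qed

lemma (in prob_space) expectation_abs_le_sqrt:
  fixes Z :: "'a \<Rightarrow> real"
  assumes [measurable]: "integrable M Z" and Z2: "integrable M (\<lambda>x. (Z x)\<^sup>2)"
  shows "expectation (\<lambda>x. \<bar>Z x\<bar>) \<le> sqrt (expectation (\<lambda>x. (Z x)\<^sup>2))"
proof -
  have "variance (\<lambda>x. \<bar>Z x\<bar>) = expectation (\<lambda>x. \<bar>Z x\<bar>\<^sup>2) - (expectation (\<lambda>x. \<bar>Z x\<bar>))\<^sup>2"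
    by (rule variance_eq) (use assms in auto)
  moreover have "0 \<le> variance (\<lambda>x. \<bar>Z x\<bar>)" by (rule variance_positive)
  ultimately show ?thesis by (intro real_le_rsqrt) simp
qed

text \<open>The difference is at most the mean of \<open>|R - 1|\<close> for the likelihood ratio
  \<open>R\<close>, hence at most the root of the mean of \<open>(R - 1)^2\<close>. That mean is
  \<open>exp S - 1\<close>, where \<open>S\<close> is the weighted squared norm of the shift,
  because the second moments of the coordinates multiply.\<close>

lemma normal_shift_tv:
  fixes \<sigma> h :: "'i \<Rightarrow> real"
  assumes I: "finite I" and \<sigma>: "\<And>i. \<sigma> i > 0" and B: "B \<in> sets (\<Pi>\<^sub>M i\<in>I. borel)"
  defines "\<mu> \<equiv> \<Pi>\<^sub>M i\<in>I. density lborel (normal_density 0 (\<sigma> i))"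
  shows "\<bar>measure \<mu> {x\<in>space \<mu>. (\<lambda>i\<in>I. x i + h i) \<in> B} - measure \<mu> B\<bar>
    \<le> 2 * sqrt (\<Sum>i\<in>I. (h i)\<^sup>2 / (\<sigma> i)\<^sup>2)"
proof -
  define N where "N a i = density lborel (\<lambda>x. ennreal (normal_density (a i) (\<sigma> i) x))" for a i
  have N0: "\<mu> = PiM I (N (\<lambda>_. 0))" unfolding \<mu>_def by (intro PiM_cong refl) (simp add: N_def)
  interpret N: prob_space "N a i" for a i
    unfolding N_def by (rule prob_space_normal_density[OF \<sigma>])
  interpret P: product_prob_space "N a" for a by unfold_locales
  interpret F: finite_product_prob_space "N a" I for a by unfold_locales (rule I)
  have [measurable_cong, simp]: "sets (N a i) = sets borel" for a i by (simp add: N_def)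
  have [simp]: "space (N a i) = UNIV" for a i by (simp add: N_def)
  have sets_P [measurable_cong, simp]: "sets (PiM I (N a)) = sets (\<Pi>\<^sub>M i\<in>I. borel)" for a
    by (intro sets_PiM_cong) auto
  have meas_N: "measurable (N a i) = measurable borel" for a i
    by (intro ext measurable_cong_sets) auto
  have vimage_S: "(\<lambda>x. x + c) -` U \<in> sets borel" if "U \<in> sets borel" for c :: real and U
    using measurable_sets[of "\<lambda>x. x + c" borel borel U] that by simp
  have meas_P: "measurable (PiM I (N a)) = measurable (\<Pi>\<^sub>M i\<in>I. borel)" for a
    by (intro ext measurable_cong_sets) auto
  define R where "R x = (\<Prod>i\<in>I. gauss_ratio (h i) (\<sigma> i) (x i))" for x
  have R_meas [measurable]: "R \<in> borel_measurable (\<Pi>\<^sub>M i\<in>I. borel)"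
    unfolding R_def by measurable
  have Rpos: "0 \<le> R x" for x unfolding R_def by (intro prod_nonneg) (auto intro: less_imp_le gauss_ratio_pos)
  have shift_meas [measurable]: "(\<lambda>x. \<lambda>i\<in>I. x i + h i) \<in> (\<Pi>\<^sub>M i\<in>I. borel) \<rightarrow>\<^sub>M (\<Pi>\<^sub>M i\<in>I. borel)"
    by measurable
  have emN: "emeasure (N a i) A = (\<integral>\<^sup>+x. ennreal (normal_density (a i) (\<sigma> i) x) * indicator A x \<partial>lborel)"
    if "A \<in> sets borel" for a i A
    unfolding N_def using that by (subst emeasure_density) auto
  \<comment> \<open>The shifted law is reached in two ways, in \<open>D1\<close> as a density and in
    \<open>D2\<close> as the image under translation. Both are the product of the normal laws with
    means \<open>h i\<close>, so they agree.\<close>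
  have D1: "density (PiM I (N (\<lambda>_. 0))) R = PiM I (N h)"
  proof (rule P.PiM_eqI[OF I])
    fix A assume "\<And>i. i \<in> I \<Longrightarrow> A i \<in> sets (N h i)"
    then have A [measurable]: "\<And>i. i \<in> I \<Longrightarrow> A i \<in> sets borel" by simp
    have "emeasure (density (PiM I (N (\<lambda>_. 0))) R) (Pi\<^sub>E I A)
       = (\<integral>\<^sup>+x. ennreal (R x) * indicator (Pi\<^sub>E I A) x \<partial>PiM I (N (\<lambda>_. 0)))"
      using I A by (intro emeasure_density) (auto simp: meas_P intro!: sets_PiM_I_finite)
    also have "\<dots> = (\<integral>\<^sup>+x. (\<Prod>i\<in>I. ennreal (gauss_ratio (h i) (\<sigma> i) (x i)) * indicator (A i) (x i)) \<partial>PiM I (N (\<lambda>_. 0)))"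
    proof (intro nn_integral_cong)
      fix x assume "x \<in> space (PiM I (N (\<lambda>_. 0)))"
      then have "indicator (Pi\<^sub>E I A) x = (\<Prod>i\<in>I. indicator (A i) (x i) :: ennreal)"
        using I by (auto simp: prod_ennreal indicator_def space_PiM PiE_iff)
      then show "ennreal (R x) * indicator (Pi\<^sub>E I A) x =
         (\<Prod>i\<in>I. ennreal (gauss_ratio (h i) (\<sigma> i) (x i)) * indicator (A i) (x i))"
        by (simp add: R_def prod.distrib prod_ennreal gauss_ratio_pos less_imp_le)
    qed
    also have "\<dots> = (\<Prod>i\<in>I. \<integral>\<^sup>+x. ennreal (gauss_ratio (h i) (\<sigma> i) x) * indicator (A i) x \<partial>N (\<lambda>_. 0) i)"
      by (intro P.product_nn_integral_prod I) (unfold meas_N, measurable)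
    also have "\<dots> = (\<Prod>i\<in>I. emeasure (N h i) (A i))"
    proof (rule prod.cong[OF refl])
      fix i assume "i \<in> I"
      note A[OF this, measurable]
      have "(\<integral>\<^sup>+x. ennreal (gauss_ratio (h i) (\<sigma> i) x) * indicator (A i) x \<partial>N (\<lambda>_. 0) i)
        = (\<integral>\<^sup>+x. ennreal (normal_density 0 (\<sigma> i) x) * (ennreal (gauss_ratio (h i) (\<sigma> i) x) * indicator (A i) x) \<partial>lborel)"
        unfolding N_def by (rule nn_integral_density) measurable
      also have "\<dots> = (\<integral>\<^sup>+x. ennreal (normal_density (h i) (\<sigma> i) x) * indicator (A i) x \<partial>lborel)"
        by (intro nn_integral_cong)
           (simp add: mult.assoc[symmetric] ennreal_mult[symmetric] gauss_ratio_pos less_imp_le normal_density_gauss_ratio \<sigma>)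
      finally show "(\<integral>\<^sup>+x. ennreal (gauss_ratio (h i) (\<sigma> i) x) * indicator (A i) x \<partial>N (\<lambda>_. 0) i) = emeasure (N h i) (A i)"
        by (simp add: emN)
    qed
    finally show "emeasure (density (PiM I (N (\<lambda>_. 0))) R) (Pi\<^sub>E I A) = (\<Prod>i\<in>I. emeasure (N h i) (A i))" .
  qed (simp add: sets_P[symmetric])
  have D2: "distr (PiM I (N (\<lambda>_. 0))) (\<Pi>\<^sub>M i\<in>I. borel) (\<lambda>x. \<lambda>i\<in>I. x i + h i) = PiM I (N h)"
  proof (rule P.PiM_eqI[OF I])
    fix A assume "\<And>i. i \<in> I \<Longrightarrow> A i \<in> sets (N h i)"
    then have A [measurable]: "\<And>i. i \<in> I \<Longrightarrow> A i \<in> sets borel" by simp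
    have "emeasure (distr (PiM I (N (\<lambda>_. 0))) (\<Pi>\<^sub>M i\<in>I. borel) (\<lambda>x. \<lambda>i\<in>I. x i + h i)) (Pi\<^sub>E I A)
      = emeasure (PiM I (N (\<lambda>_. 0))) ((\<lambda>x. \<lambda>i\<in>I. x i + h i) -` Pi\<^sub>E I A \<inter> space (PiM I (N (\<lambda>_. 0))))"
      using I A by (intro emeasure_distr) (auto simp: meas_P intro!: sets_PiM_I_finite)
    also have "(\<lambda>x. \<lambda>i\<in>I. x i + h i) -` Pi\<^sub>E I A \<inter> space (PiM I (N (\<lambda>_. 0))) = (\<Pi>\<^sub>E i\<in>I. (\<lambda>x. x + h i) -` A i)"
      by (auto simp: space_PiM PiE_iff)
    also have "emeasure (PiM I (N (\<lambda>_. 0))) \<dots> = (\<Prod>i\<in>I. emeasure (N (\<lambda>_. 0) i) ((\<lambda>x. x + h i) -` A i))"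
      using A by (intro P.emeasure_PiM I) (auto intro!: vimage_S)
    also have "\<dots> = (\<Prod>i\<in>I. emeasure (N h i) (A i))"
    proof (rule prod.cong[OF refl])
      fix i assume i: "i \<in> I"
      note A[OF this, measurable]
      have S: "(\<lambda>x. x + h i) -` A i \<in> sets borel"
        using A[OF i] by (rule vimage_S)
      have "emeasure (N h i) (A i) = (\<integral>\<^sup>+x. ennreal (normal_density (h i) (\<sigma> i) (h i + 1 * x)) * indicator (A i) (h i + 1 * x) \<partial>lborel)"
        unfolding emN[OF A[OF i]]
        by (subst nn_integral_real_affine[where c=1 and t="h i"]) auto
      also have "\<dots> = emeasure (N (\<lambda>_. 0) i) ((\<lambda>x. x + h i) -` A i)"
        unfolding emN[OF S]
        by (intro nn_integral_cong) (auto simp: normal_density_def add.commute split: split_indicator)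
      finally show "emeasure (N (\<lambda>_. 0) i) ((\<lambda>x. x + h i) -` A i) = emeasure (N h i) (A i)" ..
    qed
    finally show "emeasure (distr (PiM I (N (\<lambda>_. 0))) (\<Pi>\<^sub>M i\<in>I. borel) (\<lambda>x. \<lambda>i\<in>I. x i + h i)) (Pi\<^sub>E I A)
      = (\<Prod>i\<in>I. emeasure (N h i) (A i))" .
  qed (simp add: sets_P[symmetric])
  interpret M: prob_space \<mu> unfolding N0 by (rule prob_space_PiM) (rule N.prob_space_axioms)
  have sets_mu [measurable_cong, simp]: "sets \<mu> = sets (\<Pi>\<^sub>M i\<in>I. borel)" by (simp add: N0)
  have R\<mu> [measurable]: "R \<in> borel_measurable \<mu>" using R_meas by (simp add: N0 meas_P)
  have ratio1: "has_bochner_integral (N (\<lambda>_. 0) i) (gauss_ratio (h i) (\<sigma> i)) 1" for i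
  proof -
    have "has_bochner_integral lborel (normal_density (h i) (\<sigma> i)) 1"
      using \<sigma>[of i] by (simp add: has_bochner_integral_iff)
    then have "has_bochner_integral lborel (\<lambda>x. normal_density 0 (\<sigma> i) x *\<^sub>R gauss_ratio (h i) (\<sigma> i) x) 1"
      by (simp add: normal_density_gauss_ratio \<sigma>)
    then show ?thesis unfolding N_def by (intro has_bochner_integral_density) auto
  qed
  have ratio2: "has_bochner_integral (N (\<lambda>_. 0) i) (\<lambda>x. (gauss_ratio (h i) (\<sigma> i) x)\<^sup>2) (exp ((h i)\<^sup>2 / (\<sigma> i)\<^sup>2))" for i
  proof -
    have "has_bochner_integral lborel (normal_density (2 * h i) (\<sigma> i)) 1"
      using \<sigma>[of i] by (simp add: has_bochner_integral_iff)
    then have "has_bochner_integral lborel (\<lambda>x. exp ((h i)\<^sup>2 / (\<sigma> i)\<^sup>2) * normal_density (2 * h i) (\<sigma> i) x) (exp ((h i)\<^sup>2 / (\<sigma> i)\<^sup>2) * 1)"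
      by (intro has_bochner_integral_mult_right) auto
    then have "has_bochner_integral lborel (\<lambda>x. normal_density 0 (\<sigma> i) x *\<^sub>R (gauss_ratio (h i) (\<sigma> i) x)\<^sup>2) (exp ((h i)\<^sup>2 / (\<sigma> i)\<^sup>2))"
      by (simp add: normal_density_gauss_ratio_sq \<sigma>)
    then show ?thesis unfolding N_def by (intro has_bochner_integral_density) auto
  qed
  define S where "S = (\<Sum>i\<in>I. (h i)\<^sup>2 / (\<sigma> i)\<^sup>2)"
  have S0: "0 \<le> S" unfolding S_def by (intro sum_nonneg) simp
  have intR: "integrable \<mu> R"
    unfolding N0 R_def using ratio1
    by (intro P.product_integrable_prod I) (simp add: has_bochner_integral_iff)
  have "(LINT x|\<mu>. R x) = (\<Prod>i\<in>I. LINT x|N (\<lambda>_. 0) i. gauss_ratio (h i) (\<sigma> i) x)"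
    unfolding N0 R_def using ratio1
    by (intro P.product_integral_prod I) (simp add: has_bochner_integral_iff)
  then have R1: "(LINT x|\<mu>. R x) = 1" using ratio1 by (simp add: has_bochner_integral_iff)
  have intR2: "integrable \<mu> (\<lambda>x. (R x)\<^sup>2)"
    unfolding N0 R_def prod_power_distrib using ratio2
    by (intro P.product_integrable_prod I) (simp add: has_bochner_integral_iff)
  have "(LINT x|\<mu>. (R x)\<^sup>2) = (\<Prod>i\<in>I. LINT x|N (\<lambda>_. 0) i. (gauss_ratio (h i) (\<sigma> i) x)\<^sup>2)"
    unfolding N0 R_def prod_power_distrib using ratio2
    by (intro P.product_integral_prod I) (simp add: has_bochner_integral_iff)
  then have R2: "(LINT x|\<mu>. (R x)\<^sup>2) = exp S"
    using ratio2 by (simp add: has_bochner_integral_iff S_def exp_sum I)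
  have "\<bar>measure \<mu> {x\<in>space \<mu>. (\<lambda>i\<in>I. x i + h i) \<in> B} - measure \<mu> B\<bar> \<le> sqrt (exp S - 1)"
  proof -
    have "measure \<mu> {x\<in>space \<mu>. (\<lambda>i\<in>I. x i + h i) \<in> B}
      = measure (distr \<mu> (\<Pi>\<^sub>M i\<in>I. borel) (\<lambda>x. \<lambda>i\<in>I. x i + h i)) B"
      using B by (subst measure_distr) (auto simp: N0 meas_P intro!: arg_cong[where f="measure _"])
    also have "\<dots> = measure (density \<mu> R) B" using D1 D2 by (simp add: N0)
    also have "\<dots> = (LINT x|density \<mu> R. indicator B x)"
      using B sets.sets_into_space[of B \<mu>] by (simp add: Int_absorb2)
    also have "\<dots> = (LINT x|\<mu>. R x * indicator B x)"
      using B by (subst integral_density) (auto simp: Rpos)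
    finally have e1: "measure \<mu> {x\<in>space \<mu>. (\<lambda>i\<in>I. x i + h i) \<in> B} = (LINT x|\<mu>. R x * indicator B x)" .
    have e2: "measure \<mu> B = (LINT x|\<mu>. indicator B x)"
      using B sets.sets_into_space[of B \<mu>] by (simp add: Int_absorb2)
    have i1: "integrable \<mu> (\<lambda>x. R x * indicator B x)"
      using B by (intro integrable_real_mult_indicator intR) simp
    have i2: "integrable \<mu> (indicator B :: _ \<Rightarrow> real)"
      using B by (intro integrable_real_indicator) (auto simp: M.emeasure_eq_measure)
    have i3: "integrable \<mu> (\<lambda>x. R x - 1)" using intR by simp
    have sq: "(R x - 1)\<^sup>2 = (R x)\<^sup>2 - 2 * R x + 1" for x by (simp add: power2_diff)
    have i4: "integrable \<mu> (\<lambda>x. (R x - 1)\<^sup>2)" unfolding sq using intR intR2 by simp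
    have e4: "(LINT x|\<mu>. (R x - 1)\<^sup>2) = exp S - 1"
      unfolding sq using intR intR2 by (simp add: R1 R2 M.prob_space)
    have "\<bar>measure \<mu> {x\<in>space \<mu>. (\<lambda>i\<in>I. x i + h i) \<in> B} - measure \<mu> B\<bar>
      = \<bar>LINT x|\<mu>. R x * indicator B x - indicator B x\<bar>"
      unfolding e1 e2 using i1 i2 by (subst Bochner_Integration.integral_diff) simp_all
    also have "\<dots> \<le> (LINT x|\<mu>. \<bar>R x * indicator B x - indicator B x\<bar>)"
      by (rule integral_abs_bound)
    also have "\<dots> \<le> (LINT x|\<mu>. \<bar>R x - 1\<bar>)"
    proof (rule integral_mono)
      show "integrable \<mu> (\<lambda>x. \<bar>R x * indicator B x - indicator B x\<bar>)"
        using i1 i2 by (intro integrable_abs Bochner_Integration.integrable_diff)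
      show "integrable \<mu> (\<lambda>x. \<bar>R x - 1\<bar>)" using i3 by (rule integrable_abs)
    qed (simp split: split_indicator)
    also have "\<dots> \<le> sqrt (LINT x|\<mu>. (R x - 1)\<^sup>2)"
      by (rule M.expectation_abs_le_sqrt[OF i3 i4])
    finally show ?thesis unfolding e4 .
  qed
  \<comment> \<open>For \<open>S \<le> 1\<close> one has
    \<open>exp S - 1 \<le> S + S^2 \<le> 2 * S\<close>; enlarging 2 to 4 makes the root a clean
    \<open>2 * sqrt S\<close>.\<close>
  also have "sqrt (exp S - 1) \<le> 2 * sqrt S" if "S \<le> 1"
  proof -
    have "exp S \<le> 1 + S + S\<^sup>2" using S0 that by (intro exp_bound) auto
    also have "S\<^sup>2 \<le> S" using S0 that by (simp add: power2_eq_square mult_left_le)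
    finally have "sqrt (exp S - 1) \<le> sqrt (4 * S)" using S0 by (intro real_sqrt_le_mono) linarith
    then show ?thesis by (simp add: real_sqrt_mult)
  qed
  finally have le1: "\<bar>measure \<mu> {x\<in>space \<mu>. (\<lambda>i\<in>I. x i + h i) \<in> B} - measure \<mu> B\<bar> \<le> 2 * sqrt S" if "S \<le> 1"
    using that by simp
  \<comment> \<open>Two probabilities differ by at most 1, and \<open>2 * sqrt S\<close> exceeds 1
    here.\<close>
  have le2: "\<bar>measure \<mu> {x\<in>space \<mu>. (\<lambda>i\<in>I. x i + h i) \<in> B} - measure \<mu> B\<bar> \<le> 2 * sqrt S" if "\<not> S \<le> 1"
  proof -
    have "1 \<le> sqrt S" using that by simp
    moreover
    have "\<bar>measure \<mu> U - measure \<mu> V\<bar> \<le> 1" for U V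
      using M.prob_le_1[of U] M.prob_le_1[of V] measure_nonneg[of \<mu> U] measure_nonneg[of \<mu> V] by linarith
    note this[of "{x\<in>space \<mu>. (\<lambda>i\<in>I. x i + h i) \<in> B}" B]
    ultimately show ?thesis by linarith
  qed
  show ?thesis using le1 le2 unfolding S_def by blast
qed

lemma normal_vector_shift_tv:
  fixes \<sigma> a b :: "'i \<Rightarrow> real" and \<zeta> :: "'i \<Rightarrow> 'w \<Rightarrow> real"
  assumes I: "finite I" and \<sigma>: "\<And>i. \<sigma> i > 0" and B: "B \<in> sets (\<Pi>\<^sub>M i\<in>I. borel)"
    and [measurable]: "\<And>i. i \<in> I \<Longrightarrow> \<zeta> i \<in> borel_measurable Q"
    and law: "distr Q (\<Pi>\<^sub>M i\<in>I. borel) (\<lambda>\<omega>. \<lambda>i\<in>I. \<zeta> i \<omega>)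
      = (\<Pi>\<^sub>M i\<in>I. density lborel (normal_density 0 (\<sigma> i)))"
  shows "\<bar>measure Q {\<omega>\<in>space Q. (\<lambda>i\<in>I. \<zeta> i \<omega> + a i) \<in> B} - measure Q {\<omega>\<in>space Q. (\<lambda>i\<in>I. \<zeta> i \<omega> + b i) \<in> B}\<bar>
    \<le> 2 * sqrt (\<Sum>i\<in>I. (a i - b i)\<^sup>2 / (\<sigma> i)\<^sup>2)"
proof -
  let ?\<mu> = "\<Pi>\<^sub>M i\<in>I. density lborel (normal_density 0 (\<sigma> i))"
  have sp: "space ?\<mu> = space (\<Pi>\<^sub>M i\<in>I. borel)" by (simp add: space_PiM)
  have [measurable]: "(\<lambda>x. \<lambda>i\<in>I. x i + c i) \<in> (\<Pi>\<^sub>M i\<in>I. borel) \<rightarrow>\<^sub>M (\<Pi>\<^sub>M i\<in>I. borel)" for c :: "'i \<Rightarrow> real"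
    by measurable
  have S: "{x\<in>space (\<Pi>\<^sub>M i\<in>I. borel). (\<lambda>i\<in>I. x i + c i) \<in> B} \<in> sets (\<Pi>\<^sub>M i\<in>I. borel)" for c :: "'i \<Rightarrow> real"
    using B by measurable
  have tr: "measure Q {\<omega>\<in>space Q. (\<lambda>i\<in>I. \<zeta> i \<omega> + c i) \<in> B}
    = measure ?\<mu> {x\<in>space ?\<mu>. (\<lambda>i\<in>I. x i + c i) \<in> B}" for c
    unfolding law[symmetric] using S[of c]
    by (subst measure_distr) (auto intro!: arg_cong[where f="measure Q"] simp: space_PiM PiE_iff cong: restrict_cong)
  \<comment> \<open>The shift by \<open>b\<close> is absorbed into the test set, which leaves a
    single shift by \<open>a - b\<close> of the centered vector.\<close>
  let ?B = "{x\<in>space ?\<mu>. (\<lambda>i\<in>I. x i + b i) \<in> B}"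
  have "{x\<in>space ?\<mu>. (\<lambda>i\<in>I. x i + a i) \<in> B} = {x\<in>space ?\<mu>. (\<lambda>i\<in>I. x i + (a i - b i)) \<in> ?B}"
    by (auto simp: space_PiM cong: restrict_cong)
  moreover have "\<bar>measure ?\<mu> {x\<in>space ?\<mu>. (\<lambda>i\<in>I. x i + (a i - b i)) \<in> ?B} - measure ?\<mu> ?B\<bar>
    \<le> 2 * sqrt (\<Sum>i\<in>I. (a i - b i)\<^sup>2 / (\<sigma> i)\<^sup>2)"
    using S[of b] by (intro normal_shift_tv I \<sigma>) (simp add: sp)
  ultimately show ?thesis unfolding tr by simp
qed

section \<open>Total variation on a generating algebra\<close>

text \<open>The approximating set is common to both measures; this lets a bound on their difference
  over the algebra pass to the generated sigma-algebra with the same constant. For a countable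
  union, the part outside finitely many sets is discarded, and each remaining set is approximated
  within its share of the error.\<close>

lemma algebra_approximates_sigma_sets:
  assumes G: "algebra \<Omega> G"
    and P: "finite_measure P" "sets P = sigma_sets \<Omega> G"
    and Q: "finite_measure Q" "sets Q = sigma_sets \<Omega> G"
    and A: "A \<in> sigma_sets \<Omega> G" and e: "(e::real) > 0"
  shows "\<exists>B\<in>G. measure P (sym_diff A B) < e \<and> measure Q (sym_diff A B) < e"
  using A e
proof (induction A arbitrary: e)
  case (Basic A)
  then show ?case by (intro bexI[of _ A]) auto
next
  case Empty
  interpret algebra \<Omega> G by (rule G)
  show ?case using Empty by (intro bexI[of _ "{}"]) auto
next
  case (Compl A)
  from Compl.IH[OF Compl.prems] obtain B where B: "B \<in> G" "measure P (sym_diff A B) < e" "measure Q (sym_diff A B) < e"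
    by blast
  interpret algebra \<Omega> G by (rule G)
  have "A \<subseteq> \<Omega>" using Compl.hyps by (metis sigma_sets_into_sp space_closed)
  moreover have "B \<subseteq> \<Omega>" using B(1) sets_into_space by auto
  ultimately have "sym_diff (\<Omega> - A) (\<Omega> - B) = sym_diff A B" by auto
  with B show ?case by (intro bexI[of _ "\<Omega> - B"]) auto
next
  case (Union A)
  interpret algebra \<Omega> G by (rule G)
  interpret P: finite_measure P by (rule P)
  interpret Q: finite_measure Q by (rule Q)
  define T where "T k = (\<Union>i. A i) - (\<Union>i<k. A i)" for k :: nat
  have AS: "A i \<in> sigma_sets \<Omega> G" for i by (rule Union.hyps)
  have UA: "(\<Union>i. A i) \<in> sigma_sets \<Omega> G" by (intro sigma_sets.Union AS)
  have lim: "(\<lambda>k. measure R (T k)) \<longlonglongrightarrow> 0" if R: "finite_measure R" "sets R = sigma_sets \<Omega> G" for R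
  proof -
    interpret R: finite_measure R by (rule R)
    have "(\<lambda>k. measure R (T k)) \<longlonglongrightarrow> measure R (\<Inter>k. T k)"
    proof (rule R.finite_Lim_measure_decseq)
      have "T k \<in> sets R" for k
        unfolding T_def using AS UA R(2) by (intro sets.Diff sets.finite_UN[OF finite_lessThan]) auto
      then show "range T \<subseteq> sets R" by auto
      show "decseq T" unfolding T_def decseq_def by (auto intro: less_le_trans)
    qed
    moreover have "(\<Inter>k. T k) = {}" unfolding T_def by (auto intro: lessI)
    ultimately show ?thesis by simp
  qed
  have "eventually (\<lambda>k. measure P (T k) < e / 2 \<and> measure Q (T k) < e / 2) sequentially"
    using lim[OF P] lim[OF Q] Union.prems by (intro eventually_conj order_tendstoD) auto
  then obtain k where k: "measure P (T k) < e / 2" "measure Q (T k) < e / 2"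
    by (auto simp: eventually_sequentially)
  \<comment> \<open>The \<open>k\<close> shares add up to at most \<open>e / 2\<close>; the summand
    1 keeps the share well defined for \<open>k = 0\<close>.\<close>
  define d where "d = e / (2 * (real k + 1))"
  have d: "d > 0" using Union.prems by (simp add: d_def)
  have "\<forall>i. \<exists>B\<in>G. measure P (sym_diff (A i) B) < d \<and> measure Q (sym_diff (A i) B) < d"
    using Union.IH d by blast
  then obtain B where B: "\<And>i. B i \<in> G" "\<And>i. measure P (sym_diff (A i) (B i)) < d"
    "\<And>i. measure Q (sym_diff (A i) (B i)) < d" by metis
  have BU: "(\<Union>i<k. B i) \<in> G" using B by (intro finite_UN) auto
  have bound: "measure R (sym_diff (\<Union>i. A i) (\<Union>i<k. B i)) < e"
    if R: "finite_measure R" "sets R = sigma_sets \<Omega> G" and T: "measure R (T k) < e / 2"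
      and le: "\<And>i. measure R (sym_diff (A i) (B i)) < d" for R
  proof -
    interpret R: finite_measure R by (rule R)
    have BR: "B i \<in> sets R" for i using B(1) R(2) by (auto intro: sigma_sets.Basic)
    have AR: "A i \<in> sets R" "(\<Union>i. A i) \<in> sets R" for i using AS UA R(2) by auto
    have TR: "T k \<in> sets R" unfolding T_def by (intro sets.Diff sets.finite_UN[OF finite_lessThan] AR)
    have SR: "(\<Union>i<k. sym_diff (A i) (B i)) \<in> sets R"
      using AR BR by (intro sets.finite_UN) auto
    have "measure R (sym_diff (\<Union>i. A i) (\<Union>i<k. B i)) \<le> measure R (T k \<union> (\<Union>i<k. sym_diff (A i) (B i)))"
      by (rule R.finite_measure_mono) (use TR SR in \<open>auto simp: T_def\<close>)
    also have "\<dots> \<le> measure R (T k) + measure R (\<Union>i<k. sym_diff (A i) (B i))"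
      using TR SR by (intro measure_Un_le)
    also have "measure R (\<Union>i<k. sym_diff (A i) (B i)) \<le> (\<Sum>i<k. measure R (sym_diff (A i) (B i)))"
      using AR BR by (intro measure_UNION_le) auto
    also have "\<dots> \<le> (\<Sum>i<k. d)" using le by (intro sum_mono less_imp_le)
    also have "\<dots> = real k * d" by simp
    also have "\<dots> \<le> e / 2" using Union.prems by (simp add: d_def field_simps)
    finally show ?thesis using T by simp
  qed
  show ?case using bound[OF P k(1) B(2)] bound[OF Q k(2) B(3)] BU by blast
qed

lemma tv_bound_from_algebra:
  assumes G: "algebra \<Omega> G"
    and P: "finite_measure P" "sets P = sigma_sets \<Omega> G"
    and Q: "finite_measure Q" "sets Q = sigma_sets \<Omega> G"
    and bound: "\<And>B. B \<in> G \<Longrightarrow> \<bar>measure P B - measure Q B\<bar> \<le> c"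
    and A: "A \<in> sigma_sets \<Omega> G"
  shows "\<bar>measure P A - measure Q A\<bar> \<le> c"
proof (rule field_le_epsilon)
  fix e :: real assume "e > 0"
  then have "e / 2 > 0" by simp
  from algebra_approximates_sigma_sets[OF G P Q A this] obtain B where B: "B \<in> G"
    "measure P (sym_diff A B) < e / 2" "measure Q (sym_diff A B) < e / 2" by blast
  have diff: "\<bar>measure R A - measure R B\<bar> \<le> measure R (sym_diff A B)"
    if R: "finite_measure R" "sets R = sigma_sets \<Omega> G" for R
  proof -
    interpret finite_measure R by (rule R)
    have [measurable]: "A \<in> sets R" "B \<in> sets R" using A B(1) R(2) by (auto intro: sigma_sets.Basic)
    have "measure R A \<le> measure R (B \<union> sym_diff A B)" by (intro finite_measure_mono) auto
    also have "\<dots> \<le> measure R B + measure R (sym_diff A B)" by (intro measure_Un_le) auto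
    finally have 1: "measure R A \<le> measure R B + measure R (sym_diff A B)" .
    have "measure R B \<le> measure R (A \<union> sym_diff A B)" by (intro finite_measure_mono) auto
    also have "\<dots> \<le> measure R A + measure R (sym_diff A B)" by (intro measure_Un_le) auto
    finally show ?thesis using 1 by simp
  qed
  show "\<bar>measure P A - measure Q A\<bar> \<le> c + e"
    using diff[OF P] diff[OF Q] bound[OF B(1)] B(2,3) by linarith
qed

subsection \<open>Cylinder sets in the space of continuous functions\<close>

lemma topspace_C01: "topspace C01 = {y \<in> extensional {0..1}. continuous_on {0..1} y}"
proof -
  have "compactin (top_of_set {0..1::real}) (topspace (top_of_set {0..1}))"
    by (simp add: compactin_subtopology)
  then show ?thesis
    unfolding C01_def
    by (auto simp: compactin_mspace_cfunspace intro!: compact_imp_bounded[OF compact_continuous_image])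
qed

lemma space_borel_C01: "space borel_C01 = {y \<in> extensional {0..1}. continuous_on {0..1} y}"
  unfolding borel_C01_def topspace_C01[symmetric]
  by (intro space_measure_of) (auto dest: openin_subset)

lemma sets_borel_C01: "sets borel_C01 = sigma_sets (space borel_C01) {U. openin C01 U}"
  unfolding space_borel_C01 topspace_C01[symmetric] unfolding borel_C01_def
  by (intro sets_measure_of) (auto dest: openin_subset)

text \<open>Closed balls are chosen because membership is then a non-strict pointwise inequality,
  which for continuous functions need only be tested on a dense set of grid points.\<close>

lemma openin_C01_iff:
  "openin C01 U \<longleftrightarrow> U \<subseteq> space borel_C01 \<and>
    (\<forall>y\<in>U. \<exists>r>0. \<forall>z\<in>space borel_C01. (\<forall>t\<in>{0..1}. \<bar>z t - y t\<bar> \<le> r) \<longrightarrow> z \<in> U)"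
proof -
  let ?m = "cfunspace (top_of_set {0..1::real}) (euclidean_metric :: real metric)"
  interpret Metric_space "mspace ?m" "mdist ?m" by (rule Metric_space_mspace_mdist)
  have sp: "mspace ?m = space borel_C01"
    using topspace_C01 space_borel_C01 unfolding C01_def by simp
  have *: "mdist ?m y z \<le> r \<longleftrightarrow> (\<forall>t\<in>{0..1}. \<bar>z t - y t\<bar> \<le> r)"
    if "y \<in> mspace ?m" "z \<in> mspace ?m" for y z r
    using that by (subst cfunspace_mdist_le) (auto simp: dist_real_def abs_minus_commute)
  have "openin C01 U \<longleftrightarrow> openin mtopology U" unfolding C01_def mtopology_of_def ..
  also have "\<dots> \<longleftrightarrow> U \<subseteq> mspace ?m \<and> (\<forall>y. y \<in> U \<longrightarrow> (\<exists>r. 0 < r \<and> mcball y r \<subseteq> U))"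
    by (rule openin_mtopology_mcball)
  also have "\<dots> \<longleftrightarrow> U \<subseteq> mspace ?m \<and> (\<forall>y\<in>U. \<exists>r>0. \<forall>z\<in>mspace ?m. (\<forall>t\<in>{0..1}. \<bar>z t - y t\<bar> \<le> r) \<longrightarrow> z \<in> U)"
  proof -
    have mc: "mcball y r \<subseteq> U \<longleftrightarrow> (\<forall>z\<in>mspace ?m. (\<forall>t\<in>{0..1}. \<bar>z t - y t\<bar> \<le> r) \<longrightarrow> z \<in> U)"
      if y: "y \<in> mspace ?m" for y r
      unfolding subset_iff Ball_def in_mcball using y *[OF y] by blast
    have "(\<exists>r>0. mcball y r \<subseteq> U) \<longleftrightarrow> (\<exists>r>0. \<forall>z\<in>mspace ?m. (\<forall>t\<in>{0..1}. \<bar>z t - y t\<bar> \<le> r) \<longrightarrow> z \<in> U)"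
      if "U \<subseteq> mspace ?m" "y \<in> U" for y
      by (simp only: mc[OF subsetD[OF that]])
    then show ?thesis by blast
  qed
  finally show ?thesis unfolding sp .
qed

lemma measurable_eval_C01 [measurable]:
  assumes "t \<in> {0..1}"
  shows "(\<lambda>y. y t) \<in> borel_measurable borel_C01"
proof (rule borel_measurableI)
  fix S :: "real set" assume S: "open S"
  have "openin C01 ((\<lambda>y. y t) -` S \<inter> space borel_C01)"
    unfolding openin_C01_iff
  proof (intro conjI ballI)
    fix y assume y: "y \<in> (\<lambda>y. y t) -` S \<inter> space borel_C01"
    then obtain e where e: "e > 0" "\<And>x. dist x (y t) < e \<Longrightarrow> x \<in> S"
      using S by (auto simp: open_dist)
    show "\<exists>r>0. \<forall>z\<in>space borel_C01. (\<forall>t\<in>{0..1}. \<bar>z t - y t\<bar> \<le> r) \<longrightarrow> z \<in> (\<lambda>y. y t) -` S \<inter> space borel_C01"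
    proof (intro exI[of _ "e/2"] conjI ballI impI)
      fix z assume "z \<in> space borel_C01" "\<forall>t\<in>{0..1}. \<bar>z t - y t\<bar> \<le> e / 2"
      then have "\<bar>z t - y t\<bar> \<le> e / 2" using assms by blast
      then have "dist (z t) (y t) < e" using e(1) by (simp add: dist_real_def)
      with e(2) show "z \<in> (\<lambda>y. y t) -` S \<inter> space borel_C01" using \<open>z \<in> space borel_C01\<close> by auto
    qed (use e in auto)
  qed auto
  then show "(\<lambda>y. y t) -` S \<inter> space borel_C01 \<in> sets borel_C01"
    unfolding sets_borel_C01 by (intro sigma_sets.Basic) simp
qed

text \<open>Cylinder sets are indexed by the grids \<open>j / N\<close>, \<open>1 \<le> j \<le> N\<close>; the value at \<open>0\<close> is
  left out because it is almost surely \<open>0\<close> in the application.\<close>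

definition cylinder :: "nat \<Rightarrow> (nat \<Rightarrow> real) set \<Rightarrow> (real \<Rightarrow> real) set" where
  "cylinder N B = {y \<in> space borel_C01. (\<lambda>j\<in>{1..N}. y (real j / real N)) \<in> B}"

definition cylinders :: "nat \<Rightarrow> (real \<Rightarrow> real) set set" where
  "cylinders n = {cylinder (n * m) B | m B. m \<ge> 1 \<and> B \<in> sets (\<Pi>\<^sub>M j\<in>{1..n * m}. borel)}"

lemma eval_grid_measurable: "(\<lambda>y. \<lambda>j\<in>{1..N}. y (real j / real N)) \<in> borel_C01 \<rightarrow>\<^sub>M (\<Pi>\<^sub>M j\<in>{1..N}. borel)"
  by (intro measurable_restrict measurable_eval_C01) (auto simp: divide_simps)

lemma cylinder_in_sets: "B \<in> sets (\<Pi>\<^sub>M j\<in>{1..N}. borel) \<Longrightarrow> cylinder N B \<in> sets borel_C01"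
  unfolding cylinder_def using measurable_sets[OF eval_grid_measurable[of N], of B]
  by (simp add: vimage_def Int_def conj_commute)

lemma cylinder_refine:
  assumes N: "N \<ge> 1" and k: "k \<ge> 1" and B: "B \<in> sets (\<Pi>\<^sub>M j\<in>{1..N}. borel)"
  shows "\<exists>B'\<in>sets (\<Pi>\<^sub>M j\<in>{1..N * k}. borel). cylinder N B = cylinder (N * k) B'"
proof -
  let ?r = "\<lambda>x. \<lambda>j\<in>{1..N}. x (j * k) :: real"
  have r: "?r \<in> (\<Pi>\<^sub>M j\<in>{1..N * k}. borel) \<rightarrow>\<^sub>M (\<Pi>\<^sub>M j\<in>{1..N}. borel)"
    using k by (intro measurable_restrict measurable_component_singleton) auto
  define B' where "B' = ?r -` B \<inter> space (\<Pi>\<^sub>M j\<in>{1..N * k}. borel)"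
  have "(\<lambda>j\<in>{1..N}. (\<lambda>j\<in>{1..N*k}. y (real j / real (N * k))) (j * k)) = (\<lambda>j\<in>{1..N}. y (real j / real N))" for y :: "real \<Rightarrow> real"
    using k by (intro restrict_ext) (auto simp: field_simps)
  then have "cylinder N B = cylinder (N * k) B'"
    unfolding cylinder_def B'_def by (auto simp: space_PiM)
  moreover have "B' \<in> sets (\<Pi>\<^sub>M j\<in>{1..N * k}. borel)"
    unfolding B'_def using r B by (rule measurable_sets)
  ultimately show ?thesis by blast
qed

lemma algebra_cylinders:
  assumes n: "n \<ge> 1"
  shows "algebra (space borel_C01) (cylinders n)"
  unfolding algebra_iff_Un
proof (intro conjI ballI)
  show "cylinders n \<subseteq> Pow (space borel_C01)" by (auto simp: cylinders_def cylinder_def)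
  have "cylinder (n * 1) {} = {}" by (simp add: cylinder_def)
  then show "{} \<in> cylinders n" unfolding cylinders_def by (smt (verit) mem_Collect_eq le_refl sets.empty_sets)
  fix U assume U: "U \<in> cylinders n"
  then obtain m B where mB: "m \<ge> 1" "B \<in> sets (\<Pi>\<^sub>M j\<in>{1..n * m}. borel)" "U = cylinder (n * m) B"
    by (auto simp: cylinders_def)
  have "space borel_C01 - U = cylinder (n * m) (space (\<Pi>\<^sub>M j\<in>{1..n * m}. borel) - B)"
    unfolding mB cylinder_def by (auto simp: space_PiM)
  moreover have "space (\<Pi>\<^sub>M j\<in>{1..n * m}. borel) - B \<in> sets (\<Pi>\<^sub>M j\<in>{1..n * m}. borel)" using mB(2) by auto
  ultimately show "space borel_C01 - U \<in> cylinders n" unfolding cylinders_def using mB(1) by blast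
  fix V assume V: "V \<in> cylinders n"
  then obtain k C where kC: "k \<ge> 1" "C \<in> sets (\<Pi>\<^sub>M j\<in>{1..n * k}. borel)" "V = cylinder (n * k) C"
    by (auto simp: cylinders_def)
  \<comment> \<open>The grid with \<open>n * m * k\<close> cells refines both given grids and is
    again a multiple of \<open>n\<close>.\<close>
  obtain B' where B': "B' \<in> sets (\<Pi>\<^sub>M j\<in>{1..n * m * k}. borel)" "U = cylinder (n * m * k) B'"
    using cylinder_refine[of "n * m" k B] n mB kC by auto
  obtain C' where C': "C' \<in> sets (\<Pi>\<^sub>M j\<in>{1..n * k * m}. borel)" "V = cylinder (n * k * m) C'"
    using cylinder_refine[of "n * k" m C] n mB kC by auto
  have eq: "n * k * m = n * m * k" by simp
  have "U \<union> V = cylinder (n * (m * k)) (B' \<union> C')"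
    unfolding B' C' cylinder_def eq by (auto simp: mult.assoc)
  moreover have "B' \<union> C' \<in> sets (\<Pi>\<^sub>M j\<in>{1..n * (m * k)}. borel)"
    using B'(1) C'(1) unfolding eq by (auto simp: mult.assoc)
  moreover have "m * k \<ge> 1" using mB kC by simp
  ultimately show "U \<union> V \<in> cylinders n" unfolding cylinders_def by blast
qed

section \<open>Separability of the path space and its Borel sets\<close>

text \<open>Separability in the supremum norm, with lists of rationals as a countable index set; the
  list is one longer than the degree. Bernstein weights are nonnegative and sum to 1, so rounding
  each coefficient by less than \<open>e / 2\<close> moves the polynomial by at most
  \<open>e / 2\<close>.\<close>

lemma dense_rational_Bernstein:
  assumes y: "continuous_on {0..1} y" and e: "(e::real) > 0"
  shows "\<exists>rs::rat list. \<forall>t\<in>{0..1}. \<bar>y t - (\<Sum>k<length rs. of_rat (rs ! k) * Bernstein (length rs - 1) k t)\<bar> \<le> e"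
proof -
  obtain N where N: "\<And>n x. N \<le> n \<Longrightarrow> x \<in> {0..1} \<Longrightarrow>
      \<bar>y x - (\<Sum>k\<le>n. y (k/n) * Bernstein n k x)\<bar> < e / 2"
    using Bernstein_Weierstrass[OF y, of "e/2"] e by auto
  have "\<exists>r::rat. \<bar>y (real k / real N) - of_rat r\<bar> < e / 2" for k
  proof -
    obtain r where "y (real k / real N) - e / 2 < of_rat r" "of_rat r < y (real k / real N) + e / 2"
      using of_rat_dense[of "y (real k / real N) - e / 2" "y (real k / real N) + e / 2"] e by auto
    then show ?thesis by (intro exI[of _ r]) linarith
  qed
  then obtain r :: "nat \<Rightarrow> rat" where r: "\<And>k. \<bar>y (real k / real N) - of_rat (r k)\<bar> < e / 2" by metis
  show ?thesis
  proof (intro exI[of _ "map r [0..<Suc N]"] ballI)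
    fix t :: real assume t: "t \<in> {0..1}"
    let ?b = "\<lambda>k. Bernstein N k t"
    have b: "0 \<le> ?b k" for k using t by (simp add: Bernstein_nonneg)
    have "\<bar>(\<Sum>k\<le>N. y (k/N) * ?b k) - (\<Sum>k\<le>N. of_rat (r k) * ?b k)\<bar> = \<bar>\<Sum>k\<le>N. (y (k/N) - of_rat (r k)) * ?b k\<bar>"
      by (simp add: sum_subtractf left_diff_distrib)
    also have "\<dots> \<le> (\<Sum>k\<le>N. \<bar>(y (k/N) - of_rat (r k)) * ?b k\<bar>)" by (rule sum_abs)
    also have "\<dots> \<le> (\<Sum>k\<le>N. e / 2 * ?b k)"
      by (intro sum_mono) (simp only: abs_mult abs_of_nonneg[OF b] mult_right_mono[OF less_imp_le[OF r] b])
    also have "\<dots> = e / 2" by (simp only: sum_distrib_left[symmetric] sum_Bernstein)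
    finally have "\<bar>y t - (\<Sum>k\<le>N. of_rat (r k) * ?b k)\<bar> \<le> e" using N[of N t] t by linarith
    moreover have "(\<Sum>k<length (map r [0..<Suc N]). of_rat (map r [0..<Suc N] ! k) * Bernstein (length (map r [0..<Suc N]) - 1) k t)
       = (\<Sum>k\<le>N. of_rat (r k) * ?b k)"
      by (intro sum.cong) (auto simp: lessThan_Suc_atMost simp del: upt_Suc)
    ultimately show "\<bar>y t - (\<Sum>k<length (map r [0..<Suc N]). of_rat (map r [0..<Suc N] ! k) * Bernstein (length (map r [0..<Suc N]) - 1) k t)\<bar> \<le> e"
      by simp
  qed
qed

lemma rational_grid_dense:
  fixes f :: "real \<Rightarrow> real"
  assumes n: "n \<ge> 1" and f: "continuous_on {0..1} f"
    and le: "\<And>m j. m \<ge> 1 \<Longrightarrow> j \<in> {1..n * m} \<Longrightarrow> f (real j / real (n * m)) \<le> r" and t: "t \<in> {0..1}"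
  shows "f t \<le> r"
proof -
  \<comment> \<open>The successor in the numerator avoids the excluded grid index 0, and the
    denominator \<open>m + 1\<close> keeps the fraction at most 1.\<close>
  have lim: "(\<lambda>m. real (Suc (nat \<lfloor>t * real m\<rfloor>)) / real (Suc m)) \<longlonglongrightarrow> t"
  proof (rule real_tendsto_sandwich)
    have "t * real m \<le> real (Suc (nat \<lfloor>t * real m\<rfloor>))" for m using t by linarith
    then show "eventually (\<lambda>m. t * real m / real (Suc m) \<le> real (Suc (nat \<lfloor>t * real m\<rfloor>)) / real (Suc m)) sequentially"
      by (intro always_eventually allI divide_right_mono) auto
    have "real (Suc (nat \<lfloor>t * real m\<rfloor>)) \<le> t * real m + 1" for m using t by simp
    then show "eventually (\<lambda>m. real (Suc (nat \<lfloor>t * real m\<rfloor>)) / real (Suc m) \<le> (t * real m + 1) / real (Suc m)) sequentially"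
      by (intro always_eventually allI divide_right_mono) auto
    show "(\<lambda>m. t * real m / real (Suc m)) \<longlonglongrightarrow> t"
    proof -
      have "(\<lambda>m. t * (real m / real (Suc m))) \<longlonglongrightarrow> t * 1" by (intro tendsto_intros LIMSEQ_n_over_Suc_n)
      then show ?thesis by simp
    qed
    show "(\<lambda>m. (t * real m + 1) / real (Suc m)) \<longlonglongrightarrow> t"
    proof -
      have "(\<lambda>m. t * (real m / real (Suc m)) + 1 / real (Suc m)) \<longlonglongrightarrow> t * 1 + 0"
        using LIMSEQ_inverse_real_of_nat
        by (intro tendsto_intros LIMSEQ_n_over_Suc_n) (simp add: inverse_eq_divide)
      then show ?thesis by (simp add: add_divide_distrib)
    qed
  qed
  have in01: "real (Suc (nat \<lfloor>t * real m\<rfloor>)) / real (Suc m) \<in> {0..1}" for m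
  proof -
    have "t * real m \<le> real m" using t by (simp add: mult_left_le_one_le)
    then have "nat \<lfloor>t * real m\<rfloor> \<le> m" by linarith
    then show ?thesis by simp
  qed
  have "(\<lambda>m. f (real (Suc (nat \<lfloor>t * real m\<rfloor>)) / real (Suc m))) \<longlonglongrightarrow> f t"
    by (rule continuous_on_tendsto_compose[OF f lim t always_eventually]) (rule allI, rule in01)
  moreover have "f (real (Suc (nat \<lfloor>t * real m\<rfloor>)) / real (Suc m)) \<le> r" for m
  proof -
    let ?j = "n * Suc (nat \<lfloor>t * real m\<rfloor>)"
    have "real (Suc (nat \<lfloor>t * real m\<rfloor>)) \<le> real (Suc m)"
      using in01[of m] by (simp add: divide_le_eq_1)
    then have "?j \<in> {1..n * Suc m}" using n by auto
    from le[OF _ this] have "f (real ?j / real (n * Suc m)) \<le> r" by simp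
    moreover have "real ?j / real (n * Suc m) = real (Suc (nat \<lfloor>t * real m\<rfloor>)) / real (Suc m)"
      unfolding of_nat_mult using n by (intro mult_divide_mult_cancel_left) simp
    ultimately show ?thesis by simp
  qed
  ultimately show ?thesis by (intro LIMSEQ_le_const2[where a=r]) auto
qed

text \<open>By continuity of its members, a closed ball around a polynomial is a countable
  intersection of cylinders. An open set is the union of those balls with rational coefficients and
  rational radius that it contains, and there are only countably many of them.\<close>

lemma sets_borel_C01_cylinders:
  assumes n: "n \<ge> 1"
  shows "sets borel_C01 = sigma_sets (space borel_C01) (cylinders n)"
proof
  let ?\<Sigma> = "sigma_sets (space borel_C01) (cylinders n)"
  show "?\<Sigma> \<subseteq> sets borel_C01"
    by (intro sets.sigma_sets_subset) (auto simp: cylinders_def cylinder_in_sets)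
  interpret S: sigma_algebra "space borel_C01" ?\<Sigma>
    by (rule sigma_algebra_sigma_sets) (auto simp: cylinders_def cylinder_def)
  define d where "d rs t = (\<Sum>k<length rs. real_of_rat (rs ! k) * Bernstein (length rs - 1) k t)" for rs t
  have d_cont: "continuous_on {0..1} (d rs)" for rs
    unfolding d_def Bernstein_def by (intro continuous_intros)
  define ball where "ball rs r = {y\<in>space borel_C01. \<forall>t\<in>{0..1}. \<bar>y t - d rs t\<bar> \<le> r}" for rs r
  have ball: "ball rs r \<in> ?\<Sigma>" for rs r
  proof -
    define b where "b m j = {y\<in>space borel_C01. \<bar>y (real j / real (n * m)) - d rs (real j / real (n * m))\<bar> \<le> r}" for m j
    have b: "b m j \<in> ?\<Sigma>" if m: "m \<ge> 1" and j: "j \<in> {1..n * m}" for m j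
    proof (rule sigma_sets.Basic)
      let ?B = "{x\<in>space (\<Pi>\<^sub>M j\<in>{1..n * m}. borel). \<bar>x j - d rs (real j / real (n * m))\<bar> \<le> r}"
      have "b m j = cylinder (n * m) ?B"
        unfolding b_def cylinder_def using j by (auto simp: space_PiM)
      moreover have "?B \<in> sets (\<Pi>\<^sub>M j\<in>{1..n * m}. borel)"
        using j by measurable
      ultimately show "b m j \<in> cylinders n" unfolding cylinders_def using m by blast
    qed
    have grid_in: "real j / real N \<in> {0..1}" if "j \<in> {1..N}" for j N
      using that by (auto simp: divide_simps)
    have "ball rs r = (\<Inter>m\<in>{1..}. \<Inter>j\<in>{1..n * m}. b m j)"
    proof (intro equalityI subsetI)
      fix y assume y: "y \<in> ball rs r"
      show "y \<in> (\<Inter>m\<in>{1..}. \<Inter>j\<in>{1..n * m}. b m j)"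
      proof (intro INT_I)
        fix m j assume "j \<in> {1..n * m}"
        from grid_in[OF this] show "y \<in> b m j" using y unfolding ball_def b_def by blast
      qed
    next
      fix y assume y: "y \<in> (\<Inter>m\<in>{1..}. \<Inter>j\<in>{1..n * m}. b m j)"
      then have "y \<in> b 1 1" using n by auto
      then have ysp: "y \<in> space borel_C01" by (simp add: b_def)
      have "\<bar>y t - d rs t\<bar> \<le> r" if "t \<in> {0..1}" for t
      proof (rule rational_grid_dense[OF n _ _ that])
        show "continuous_on {0..1} (\<lambda>t. \<bar>y t - d rs t\<bar>)"
          using ysp d_cont by (intro continuous_intros) (auto simp: space_borel_C01)
        show "\<bar>y (real j / real (n * m)) - d rs (real j / real (n * m))\<bar> \<le> r" if "m \<ge> 1" "j \<in> {1..n * m}" for m j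
          using y that unfolding b_def by auto
      qed
      with ysp show "y \<in> ball rs r" by (simp add: ball_def)
    qed
    moreover have "(\<Inter>m\<in>{1..}. \<Inter>j\<in>{1..n * m}. b m j) \<in> ?\<Sigma>"
    proof (rule S.countable_INT')
      show "(\<lambda>m. \<Inter>j\<in>{1..n * m}. b m j) ` {1..} \<subseteq> ?\<Sigma>"
      proof (rule image_subsetI)
        fix m :: nat assume "m \<in> {1..}"
        then show "(\<Inter>j\<in>{1..n * m}. b m j) \<in> ?\<Sigma>"
          using n by (intro S.finite_INT b) auto
      qed
    qed auto
    ultimately show ?thesis by simp
  qed
  have "U \<in> ?\<Sigma>" if U: "openin C01 U" for U
  proof -
    define D where "D = {(rs, r :: rat). ball rs (real_of_rat r) \<subseteq> U}"
    have "U = (\<Union>(rs, r)\<in>D. ball rs (real_of_rat r))"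
    proof (intro equalityI subsetI)
      fix y assume y: "y \<in> U"
      then have ysp: "y \<in> space borel_C01" using U by (auto simp: openin_C01_iff)
      obtain e where e: "e > 0" "\<And>z. z \<in> space borel_C01 \<Longrightarrow> (\<forall>t\<in>{0..1}. \<bar>z t - y t\<bar> \<le> e) \<Longrightarrow> z \<in> U"
        using U y unfolding openin_C01_iff by blast
      \<comment> \<open>Half the radius: the centre is within \<open>r\<close> of \<open>y\<close>,
        so the ball of radius \<open>r\<close> around it stays within \<open>e\<close> of
        \<open>y\<close>.\<close>
      obtain r where r: "0 < real_of_rat r" "real_of_rat r < e / 2" using of_rat_dense[of 0 "e/2"] e by auto
      obtain rs where rs: "\<forall>t\<in>{0..1}. \<bar>y t - d rs t\<bar> \<le> real_of_rat r"
        using dense_rational_Bernstein[OF _ r(1), of y] ysp unfolding d_def space_borel_C01 by auto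
      have "ball rs (real_of_rat r) \<subseteq> U"
      proof
        fix z assume z: "z \<in> ball rs (real_of_rat r)"
        have "\<bar>z t - y t\<bar> \<le> e" if "t \<in> {0..1}" for t
        proof -
          have "\<bar>z t - d rs t\<bar> \<le> real_of_rat r" "\<bar>y t - d rs t\<bar> \<le> real_of_rat r"
            using z rs that by (auto simp: ball_def)
          with r(2) show ?thesis by linarith
        qed
        with z show "z \<in> U" by (intro e(2)) (auto simp: ball_def)
      qed
      moreover have "y \<in> ball rs (real_of_rat r)" using rs ysp by (simp add: ball_def)
      ultimately show "y \<in> (\<Union>(rs, r)\<in>D. ball rs (real_of_rat r))" by (auto simp: D_def)
    qed (auto simp: D_def)
    also have "\<dots> \<in> ?\<Sigma>"
      using ball by (intro S.countable_UN') auto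
    finally show ?thesis .
  qed
  then show "sets borel_C01 \<subseteq> ?\<Sigma>"
    unfolding sets_borel_C01 by (intro sigma_sets_mono) auto
qed

lemma measurable_borel_C01I:
  assumes sp: "\<And>\<omega>. \<omega> \<in> space M \<Longrightarrow> X \<omega> \<in> space borel_C01"
    and X: "\<And>t. t \<in> {0..1} \<Longrightarrow> (\<lambda>\<omega>. X \<omega> t) \<in> borel_measurable M"
  shows "X \<in> M \<rightarrow>\<^sub>M borel_C01"
proof (rule measurable_sigma_sets[where A="cylinders 1"])
  show "sets borel_C01 = sigma_sets (space borel_C01) (cylinders 1)"
    by (rule sets_borel_C01_cylinders) simp
  show "cylinders 1 \<subseteq> Pow (space borel_C01)" by (auto simp: cylinders_def cylinder_def)
  show "X \<in> space M \<rightarrow> space borel_C01" using sp by auto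
  fix U assume "U \<in> cylinders 1"
  then obtain N B where B: "B \<in> sets (\<Pi>\<^sub>M j\<in>{1..N}. borel)" and U: "U = cylinder N B"
    by (auto simp: cylinders_def)
  have "(\<lambda>\<omega>. \<lambda>j\<in>{1..N}. X \<omega> (real j / real N)) \<in> M \<rightarrow>\<^sub>M (\<Pi>\<^sub>M j\<in>{1..N}. borel)"
    by (intro measurable_restrict X) (auto simp: divide_simps)
  from measurable_sets[OF this B] show "X -` U \<inter> space M \<in> sets M"
    unfolding U cylinder_def using sp by (auto simp: vimage_def Int_def conj_commute cong: conj_cong)
qed

subsection \<open>Linear functionals of a centered Gaussian process\<close>

lemma char_normal:
  assumes "\<sigma> > 0"
  shows "real_distribution (density lborel (normal_density 0 \<sigma>))"
    and "char (density lborel (normal_density 0 \<sigma>)) s = exp (- (s\<^sup>2 * \<sigma>\<^sup>2) / 2)"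
proof -
  let ?N = "density lborel (\<lambda>x. ennreal (normal_density 0 \<sigma> x))"
  interpret N: prob_space ?N by (rule prob_space_normal_density[OF assms])
  show "real_distribution ?N"
    by (intro real_distribution.intro real_distribution_axioms.intro N.prob_space_axioms) simp_all
  have "distributed ?N lborel (\<lambda>x. x) (normal_density 0 \<sigma>)"
    unfolding distributed_def by (simp add: distr_id2 cong: distr_cong)
  then have D: "distributed ?N lborel (\<lambda>x. (x - 0) / \<sigma>) std_normal_density"
    using N.normal_standard_normal_convert[OF assms, of "\<lambda>x. x" 0] by blast
  have std: "distr ?N lborel (\<lambda>x. x / \<sigma>) = std_normal_distribution"
    using distributed_distr_eq_density[OF D] by simp
  have "char ?N s = (CLINT x|?N. iexp ((s * \<sigma>) * (x / \<sigma>)))"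
    unfolding char_def using assms by simp
  also have "\<dots> = (CLINT x|distr ?N lborel (\<lambda>x. x / \<sigma>). iexp ((s * \<sigma>) * x))"
    by (subst integral_distr) auto
  also have "\<dots> = char std_normal_distribution (s * \<sigma>)"
    unfolding std char_def ..
  also have "\<dots> = exp (- (s\<^sup>2 * \<sigma>\<^sup>2) / 2)"
    by (simp add: char_std_normal_distribution power_mult_distrib)
  finally show "char ?N s = exp (- (s\<^sup>2 * \<sigma>\<^sup>2) / 2)" .
qed

lemma distr_eq_PiM_normal:
  fixes \<zeta> :: "'i \<Rightarrow> 'a \<Rightarrow> real"
  assumes I: "finite I" and Q: "prob_space Q"
    and \<zeta>: "\<And>i. i \<in> I \<Longrightarrow> \<zeta> i \<in> borel_measurable Q"
    and \<sigma>: "\<And>i. \<sigma> i > 0"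
    and char: "\<And>c. (CLINT \<omega>|Q. iexp (\<Sum>i\<in>I. c i * \<zeta> i \<omega>)) = exp (- (\<Sum>i\<in>I. (c i)\<^sup>2 * (\<sigma> i)\<^sup>2) / 2)"
  shows "distr Q (\<Pi>\<^sub>M i\<in>I. borel) (\<lambda>\<omega>. \<lambda>i\<in>I. \<zeta> i \<omega>) = (\<Pi>\<^sub>M i\<in>I. density lborel (normal_density 0 (\<sigma> i)))"
proof (rule distr_eq_PiM_char[OF I Q \<zeta>])
  show "(CLINT \<omega>|Q. iexp (\<Sum>i\<in>I. c i * \<zeta> i \<omega>)) = (\<Prod>i\<in>I. char (density lborel (normal_density 0 (\<sigma> i))) (c i))" for c
    unfolding char char_normal(2)[OF \<sigma>] of_real_prod[symmetric] exp_sum[OF I, symmetric]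
    by (simp add: sum_negf sum_divide_distrib)
qed (assumption | rule char_normal(1)[OF \<sigma>])+

locale centered_gaussian = prob_space P for P :: "'w measure" +
  fixes \<Xi> :: "real \<Rightarrow> 'w \<Rightarrow> real"
  assumes gauss: "gaussian_process P {0..1} \<Xi>"
    and mean_zero: "\<forall>t\<in>{0..1}. expectation (\<Xi> t) = 0"
begin

text \<open>The linear span of the values of the process. Each member is a centered, possibly
  degenerate normal variable, so its characteristic function is determined by its second moment; the
  laws below are computed from covariances in this way.\<close>

definition lin :: "('w \<Rightarrow> real) \<Rightarrow> bool" where
  "lin Z \<longleftrightarrow> (\<exists>I c. finite I \<and> I \<subseteq> {0..1} \<and> Z = (\<lambda>\<omega>. \<Sum>t\<in>I. c t * \<Xi> t \<omega>))"

lemma lin_Xi: "t \<in> {0..1} \<Longrightarrow> lin (\<Xi> t)"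
  unfolding lin_def by (intro exI[of _ "{t}"] exI[of _ "\<lambda>_. 1"]) auto

lemma lin_add:
  assumes "lin Z" "lin W"
  shows "lin (\<lambda>\<omega>. Z \<omega> + W \<omega>)"
proof -
  obtain I c where I: "finite I" "I \<subseteq> {0..1}" "Z = (\<lambda>\<omega>. \<Sum>t\<in>I. c t * \<Xi> t \<omega>)"
    using assms(1) by (auto simp: lin_def)
  obtain K d where K: "finite K" "K \<subseteq> {0..1}" "W = (\<lambda>\<omega>. \<Sum>t\<in>K. d t * \<Xi> t \<omega>)"
    using assms(2) by (auto simp: lin_def)
  have "(\<Sum>t\<in>I. c t * \<Xi> t \<omega>) = (\<Sum>t\<in>I \<union> K. (if t \<in> I then c t else 0) * \<Xi> t \<omega>)" for \<omega>
    using I K by (intro sum.mono_neutral_cong_left) auto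
  moreover have "(\<Sum>t\<in>K. d t * \<Xi> t \<omega>) = (\<Sum>t\<in>I \<union> K. (if t \<in> K then d t else 0) * \<Xi> t \<omega>)" for \<omega>
    using I K by (intro sum.mono_neutral_cong_left) auto
  ultimately show ?thesis
    unfolding lin_def using I K
    by (intro exI[of _ "I \<union> K"] exI[of _ "\<lambda>t. (if t \<in> I then c t else 0) + (if t \<in> K then d t else 0)"])
       (simp add: distrib_right sum.distrib)
qed

lemma lin_cmult: "lin Z \<Longrightarrow> lin (\<lambda>\<omega>. a * Z \<omega>)"
  unfolding lin_def
proof (elim exE conjE)
  fix I c assume "finite I" "I \<subseteq> {0..1}" "Z = (\<lambda>\<omega>. \<Sum>t\<in>I. c t * \<Xi> t \<omega>)"
  then show "\<exists>I c. finite I \<and> I \<subseteq> {0..1} \<and> (\<lambda>\<omega>. a * Z \<omega>) = (\<lambda>\<omega>. \<Sum>t\<in>I. c t * \<Xi> t \<omega>)"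
    by (intro exI[of _ I] exI[of _ "\<lambda>t. a * c t"]) (simp add: sum_distrib_left mult.assoc)
qed

lemma lin_mult_right: "lin Z \<Longrightarrow> lin (\<lambda>\<omega>. Z \<omega> * a)"
  using lin_cmult[of Z a] by (simp add: mult.commute)

lemma lin_divide: "lin Z \<Longrightarrow> lin (\<lambda>\<omega>. Z \<omega> / a)"
  using lin_cmult[of Z "1 / a"] by simp

lemma lin_diff: "lin Z \<Longrightarrow> lin W \<Longrightarrow> lin (\<lambda>\<omega>. Z \<omega> - W \<omega>)"
  using lin_add[OF _ lin_cmult[of W "-1"]] by simp

lemma lin_sum:
  assumes "\<And>i. i \<in> I \<Longrightarrow> lin (Z i)"
  shows "lin (\<lambda>\<omega>. \<Sum>i\<in>I. Z i \<omega>)"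
proof -
  have 0: "lin (\<lambda>\<omega>. 0)" unfolding lin_def by (intro exI[of _ "{}"]) auto
  show ?thesis using assms by (induction I rule: infinite_finite_induct) (auto intro: lin_add 0)
qed

lemma lin_gaussian_var: "lin Z \<Longrightarrow> gaussian_var P Z"
  using gauss unfolding lin_def gaussian_process_def by blast

lemma lin_measurable: "lin Z \<Longrightarrow> Z \<in> borel_measurable P"
  using lin_gaussian_var unfolding gaussian_var_def by blast

lemma gaussian_var_integrable:
  assumes "gaussian_var P Z"
  shows "integrable P Z" "integrable P (\<lambda>\<omega>. (Z \<omega>)\<^sup>2)"
proof -
  have [measurable]: "Z \<in> borel_measurable P" using assms by (simp add: gaussian_var_def)
  have "integrable P Z \<and> integrable P (\<lambda>\<omega>. (Z \<omega>)\<^sup>2)"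
    using assms unfolding gaussian_var_def
  proof (elim conjE disjE exE)
    fix \<mu> assume "AE \<omega> in P. Z \<omega> = \<mu>"
    then have "integrable P Z \<longleftrightarrow> integrable P (\<lambda>\<omega>. \<mu>)" "integrable P (\<lambda>\<omega>. (Z \<omega>)\<^sup>2) \<longleftrightarrow> integrable P (\<lambda>\<omega>. \<mu>\<^sup>2)"
      by (intro integrable_cong_AE; auto)+
    then show ?thesis by simp
  next
    fix \<mu> \<sigma> :: real assume \<sigma>: "\<sigma> > 0" and D: "distributed P lborel Z (normal_density \<mu> \<sigma>)"
    have i1: "integrable P Z"
      using distributed_integrable[OF D, of "\<lambda>x. x"] integrable_normal_moment_nz_1[OF \<sigma>, of \<mu>] by simp
    have "integrable P (\<lambda>\<omega>. (Z \<omega> - \<mu>)\<^sup>2)"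
      using distributed_integrable[OF D, of "\<lambda>x. (x - \<mu>)\<^sup>2"] integrable_normal_moment[OF \<sigma>, of \<mu> 2] by simp
    then have "integrable P (\<lambda>\<omega>. (Z \<omega> - \<mu>)\<^sup>2 + 2 * \<mu> * Z \<omega> - \<mu>\<^sup>2)" using i1 by simp
    moreover have "(z - \<mu>)\<^sup>2 + 2 * \<mu> * z - \<mu>\<^sup>2 = z\<^sup>2" for z by (simp add: power2_diff)
    ultimately show ?thesis using i1 by simp
  qed
  then show "integrable P Z" "integrable P (\<lambda>\<omega>. (Z \<omega>)\<^sup>2)" by auto
qed

lemmas lin_integrable = gaussian_var_integrable[OF lin_gaussian_var]

lemma lin_mult_integrable:
  assumes "lin Z" "lin W"
  shows "integrable P (\<lambda>\<omega>. Z \<omega> * W \<omega>)"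
proof -
  have "integrable P (\<lambda>\<omega>. ((Z \<omega> + W \<omega>)\<^sup>2 - (Z \<omega>)\<^sup>2 - (W \<omega>)\<^sup>2) / 2)"
    using lin_integrable(2)[OF lin_add[OF assms]] assms[THEN lin_integrable(2)] by simp
  moreover have "((z + w)\<^sup>2 - z\<^sup>2 - w\<^sup>2) / 2 = z * w" for z w :: real
    by (simp add: power2_sum)
  ultimately show ?thesis by simp
qed

lemma lin_mean: "lin Z \<Longrightarrow> expectation Z = 0"
  unfolding lin_def
proof (elim exE conjE)
  fix I c assume I: "finite I" "I \<subseteq> {0..1}" "Z = (\<lambda>\<omega>. \<Sum>t\<in>I. c t * \<Xi> t \<omega>)"
  have "integrable P (\<Xi> t)" if "t \<in> I" for t
    using that I lin_integrable(1)[OF lin_Xi] by blast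
  then have "expectation Z = (\<Sum>t\<in>I. c t * expectation (\<Xi> t))"
    unfolding I(3) by (subst Bochner_Integration.integral_sum) auto
  also have "\<dots> = 0" using I(2) mean_zero by (intro sum.neutral) auto
  finally show "expectation Z = 0" .
qed

lemma lin_char:
  assumes Z: "lin Z"
  shows "(CLINT \<omega>|P. iexp (Z \<omega>)) = exp (- expectation (\<lambda>\<omega>. (Z \<omega>)\<^sup>2) / 2)"
proof -
  have [measurable]: "Z \<in> borel_measurable P" by (rule lin_measurable[OF Z])
  note mean = lin_mean[OF Z]
  from lin_gaussian_var[OF Z] show ?thesis
    unfolding gaussian_var_def
  proof (elim conjE disjE exE)
    \<comment> \<open>A degenerate member must be 0 because its mean is 0, and then it satisfies the
      same formula with variance 0.\<close>
    fix \<mu> assume AE: "AE \<omega> in P. Z \<omega> = \<mu>"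
    then have "expectation Z = expectation (\<lambda>_. \<mu>)" by (intro integral_cong_AE) auto
    then have "\<mu> = 0" using mean by (simp add: prob_space)
    with AE have AE: "AE \<omega> in P. Z \<omega> = 0" by simp
    then have "expectation (\<lambda>\<omega>. (Z \<omega>)\<^sup>2) = expectation (\<lambda>_. 0)" by (intro integral_cong_AE) auto
    moreover have "(CLINT \<omega>|P. iexp (Z \<omega>)) = (CLINT \<omega>|P. 1)"
      using AE by (intro integral_cong_AE) auto
    ultimately show ?thesis by (simp add: prob_space)
  next
    fix \<mu> \<sigma> :: real assume \<sigma>: "\<sigma> > 0" and D: "distributed P lborel Z (normal_density \<mu> \<sigma>)"
    have "\<mu> = 0" using normal_distributed_expectation[OF \<sigma> D] mean by simp
    then have D: "distributed P lborel Z (normal_density 0 \<sigma>)" using D by simp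
    have var: "expectation (\<lambda>\<omega>. (Z \<omega>)\<^sup>2) = \<sigma>\<^sup>2"
      using normal_distributed_variance[OF \<sigma> D] mean by simp
    have "(CLINT \<omega>|P. iexp (Z \<omega>)) = (CLINT x|distr P lborel Z. iexp x)"
      by (subst integral_distr) auto
    also have "\<dots> = char (density lborel (normal_density 0 \<sigma>)) 1"
      unfolding distributed_distr_eq_density[OF D] char_def by simp
    also have "\<dots> = exp (- \<sigma>\<^sup>2 / 2)" unfolding char_normal(2)[OF \<sigma>] by simp
    finally show ?thesis unfolding var .
  qed
qed

text \<open>The remainder \<open>B - A\<close> is taken from an independent copy. Since
  \<open>A\<close> and \<open>B - A\<close> are uncorrelated, their second moments add up to that of
  \<open>B\<close>, so the replacement does not change the law of the sum. This is what gives the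
  randomised path exactly the right noise.\<close>

lemma lin_char_pair:
  assumes A: "lin A" and B: "lin B" and orth: "expectation (\<lambda>\<omega>. A \<omega> * (B \<omega> - A \<omega>)) = 0"
  shows "(CLINT \<omega>|P \<Otimes>\<^sub>M P. iexp (A (fst \<omega>) + (B (snd \<omega>) - A (snd \<omega>)))) = exp (- expectation (\<lambda>\<omega>. (B \<omega>)\<^sup>2) / 2)"
proof -
  interpret PP: pair_prob_space P P ..
  note [measurable] = lin_measurable[OF A] lin_measurable[OF B]
  have BA: "lin (\<lambda>\<omega>. B \<omega> - A \<omega>)" by (rule lin_diff[OF B A])
  have int: "integrable (P \<Otimes>\<^sub>M P) (\<lambda>(x, y). iexp (A x + (B y - A y)))"
    by (rule PP.integrable_const_bound[of _ 1]) auto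
  have "(CLINT \<omega>|P \<Otimes>\<^sub>M P. iexp (A (fst \<omega>) + (B (snd \<omega>) - A (snd \<omega>))))
    = (CLINT x|P. CLINT y|P. iexp (A x + (B y - A y)))"
    using PP.integral_fst'[OF int] by (simp only: prod.case case_prod_beta' fst_conv snd_conv)
  also have "\<dots> = (CLINT x|P. CLINT y|P. iexp (A x) * iexp (B y - A y))"
    by (intro Bochner_Integration.integral_cong refl) (simp add: exp_add[symmetric] distrib_left)
  also have "\<dots> = (CLINT x|P. iexp (A x)) * (CLINT y|P. iexp (B y - A y))"
    by (simp only: integral_mult_right_zero integral_mult_left_zero)
  also have "\<dots> = complex_of_real (exp (- expectation (\<lambda>\<omega>. (A \<omega>)\<^sup>2) / 2) * exp (- expectation (\<lambda>\<omega>. (B \<omega> - A \<omega>)\<^sup>2) / 2))"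
    unfolding lin_char[OF A] lin_char[OF BA] by simp
  also have "exp (- expectation (\<lambda>\<omega>. (A \<omega>)\<^sup>2) / 2) * exp (- expectation (\<lambda>\<omega>. (B \<omega> - A \<omega>)\<^sup>2) / 2)
    = exp (- (expectation (\<lambda>\<omega>. (A \<omega>)\<^sup>2) + expectation (\<lambda>\<omega>. (B \<omega> - A \<omega>)\<^sup>2)) / 2)"
    by (simp add: mult_exp_exp add_divide_distrib)
  also have "expectation (\<lambda>\<omega>. (A \<omega>)\<^sup>2) + expectation (\<lambda>\<omega>. (B \<omega> - A \<omega>)\<^sup>2) = expectation (\<lambda>\<omega>. (B \<omega>)\<^sup>2)"
  proof -
    have "(b::real)\<^sup>2 = a\<^sup>2 + (b - a)\<^sup>2 + 2 * (a * (b - a))" for a b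
      by (simp add: power2_eq_square algebra_simps)
    then have "expectation (\<lambda>\<omega>. (B \<omega>)\<^sup>2) = expectation (\<lambda>\<omega>. (A \<omega>)\<^sup>2 + (B \<omega> - A \<omega>)\<^sup>2 + 2 * (A \<omega> * (B \<omega> - A \<omega>)))"
      by (intro Bochner_Integration.integral_cong refl)
    also have "\<dots> = expectation (\<lambda>\<omega>. (A \<omega>)\<^sup>2) + expectation (\<lambda>\<omega>. (B \<omega> - A \<omega>)\<^sup>2) + 2 * expectation (\<lambda>\<omega>. A \<omega> * (B \<omega> - A \<omega>))"
      using lin_integrable(2)[OF A] lin_integrable(2)[OF BA] lin_mult_integrable[OF A BA] by simp
    finally show ?thesis using orth by simp
  qed
  finally show ?thesis .
qed

lemma expectation_mult_sum:
  assumes "lin A" "\<And>i. i \<in> I \<Longrightarrow> lin (Z i)"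
  shows "expectation (\<lambda>\<omega>. A \<omega> * (\<Sum>i\<in>I. Z i \<omega> * c i)) = (\<Sum>i\<in>I. expectation (\<lambda>\<omega>. A \<omega> * Z i \<omega>) * c i)"
proof -
  have "expectation (\<lambda>\<omega>. A \<omega> * (\<Sum>i\<in>I. Z i \<omega> * c i)) = expectation (\<lambda>\<omega>. \<Sum>i\<in>I. A \<omega> * Z i \<omega> * c i)"
    by (intro Bochner_Integration.integral_cong refl) (simp add: sum_distrib_left mult.assoc)
  also have "\<dots> = (\<Sum>i\<in>I. expectation (\<lambda>\<omega>. A \<omega> * Z i \<omega> * c i))"
    using assms by (intro Bochner_Integration.integral_sum integrable_mult_left lin_mult_integrable)
  finally show ?thesis by simp
qed

end

subsection \<open>Interpolation in the clock\<close>

lemma grid_in: "i \<le> n \<Longrightarrow> grid n i \<in> {0..1}"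
  unfolding grid_def by (cases "n = 0") (auto simp: divide_simps)

lemma grid_nonneg [simp]: "0 \<le> grid n i" by (simp add: grid_def)

lemma grid_mono: "i \<le> j \<Longrightarrow> grid n i \<le> grid n j"
  unfolding grid_def by (intro divide_right_mono) auto

lemma grid_less: "i < j \<Longrightarrow> 0 < n \<Longrightarrow> grid n i < grid n j"
  unfolding grid_def by (intro divide_strict_right_mono) auto

lemma grid_0 [simp]: "grid n 0 = 0" by (simp add: grid_def)

lemma grid_self [simp]: "0 < n \<Longrightarrow> grid n n = 1" by (simp add: grid_def)

lemma sum_increments: "(\<Sum>i\<in>{1..k}. f i - f (i - 1)) = f k - f (0::nat)" for f :: "nat \<Rightarrow> real"
  by (induction k) auto

locale time_change =
  fixes q :: "real \<Rightarrow> real"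
  assumes q_less: "\<And>s t. 0 \<le> s \<Longrightarrow> s < t \<Longrightarrow> t \<le> 1 \<Longrightarrow> q s < q t"
    and q0: "q 0 = 0"
begin

lemma q_le: "0 \<le> s \<Longrightarrow> s \<le> t \<Longrightarrow> t \<le> 1 \<Longrightarrow> q s \<le> q t"
  using q_less[of s t] by (cases "s = t") auto

lemma q_nonneg: "t \<in> {0..1} \<Longrightarrow> 0 \<le> q t"
  using q_le[of 0 t] q0 by simp

lemma q_grid_le: "i \<le> j \<Longrightarrow> j \<le> n \<Longrightarrow> q (grid n i) \<le> q (grid n j)"
  using grid_in[of i n] grid_in[of j n] by (intro q_le grid_mono) auto

definition dq :: "nat \<Rightarrow> nat \<Rightarrow> real" where
  "dq N j = q (grid N j) - q (grid N (j - 1))"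

lemma dq_pos: "j \<in> {1..N} \<Longrightarrow> 0 < dq N j"
  unfolding dq_def using grid_in[of j N] grid_in[of "j - 1" N]
  by (auto intro!: q_less grid_less)

text \<open>The default 1 outside the index range makes the deviation positive for every index, as
  the lemmas on products of normal laws require.\<close>

definition sd :: "nat \<Rightarrow> nat \<Rightarrow> real" where
  "sd N j = (if j \<in> {1..N} then sqrt (dq N j) else 1)"

lemma sd_pos: "0 < sd N j"
  using dq_pos[of j N] by (simp add: sd_def)

lemma sd_sq: "j \<in> {1..N} \<Longrightarrow> (sd N j)\<^sup>2 = dq N j"
  using dq_pos[of j N] by (simp add: sd_def)

lemma sum_dq: "N > 0 \<Longrightarrow> (\<Sum>j\<in>{1..N}. dq N j) = q 1"
  unfolding dq_def using sum_increments[of "\<lambda>j. q (grid N j)" N] by (simp add: q0)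

text \<open>The regression coefficient of the process \<open>X\<close> at \<open>t\<close> on its
  \<open>i\<close>-th grid increment: the numerator is their covariance, the denominator the
  variance. As a function of \<open>t\<close> it is 0 before the cell, 1 after it and affine in
  \<open>q\<close> on it, so linear interpolation in the clock is at the same time the orthogonal
  projection on the grid increments.\<close>

definition wt :: "nat \<Rightarrow> nat \<Rightarrow> real \<Rightarrow> real" where
  "wt n i t = (min (q t) (q (grid n i)) - min (q t) (q (grid n (i - 1)))) / dq n i"

text \<open>\<open>interp n d\<close> is the function that is piecewise affine in \<open>q\<close>, vanishes at \<open>0\<close> and has
  the increments \<open>d i\<close> over the grid with mesh \<open>1 / n\<close>.\<close>

definition interp :: "nat \<Rightarrow> (nat \<Rightarrow> real) \<Rightarrow> real \<Rightarrow> real" where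
  "interp n d t = (\<Sum>i\<in>{1..n}. d i * wt n i t)"

lemma wt_below: "i \<in> {1..n} \<Longrightarrow> grid n i \<le> t \<Longrightarrow> t \<le> 1 \<Longrightarrow> wt n i t = 1"
  using dq_pos[of i n] q_le[of "grid n i" t] q_grid_le[of "i - 1" i n] grid_in[of i n]
  unfolding wt_def dq_def by (auto simp: min_def divide_simps)

lemma wt_above: "i \<in> {1..n} \<Longrightarrow> 0 \<le> t \<Longrightarrow> t \<le> grid n (i - 1) \<Longrightarrow> wt n i t = 0"
  using q_le[of t "grid n (i - 1)"] q_grid_le[of "i - 1" i n] grid_in[of "i - 1" n]
  unfolding wt_def by (auto simp: min_def divide_simps)

lemma wt_between:
  assumes "i \<in> {1..n}" "grid n (i - 1) \<le> t" "t \<le> grid n i"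
  shows "wt n i t = (q t - q (grid n (i - 1))) / dq n i"
proof -
  have "q (grid n (i - 1)) \<le> q t" "q t \<le> q (grid n i)"
    using assms grid_in[of i n] order_trans[OF grid_nonneg assms(2)] by (auto intro!: q_le)
  then show ?thesis unfolding wt_def by (simp add: min_def)
qed

lemma interp_add: "interp n (\<lambda>i. d i + e i) t = interp n d t + interp n e t"
  unfolding interp_def by (simp add: distrib_right sum.distrib)

lemma interp_diff: "interp n (\<lambda>i. d i - e i) t = interp n d t - interp n e t"
  unfolding interp_def by (simp add: left_diff_distrib sum_subtractf)

lemma interp_cmult: "interp n (\<lambda>i. c * d i) t = c * interp n d t"
  unfolding interp_def by (simp add: sum_distrib_left mult.assoc)

lemma interp_0: "interp n d 0 = 0"
  unfolding interp_def by (intro sum.neutral ballI) (simp add: wt_above grid_def)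

lemma interp_between:
  assumes k: "k \<in> {1..n}" and t: "grid n (k - 1) \<le> t" "t \<le> grid n k"
  shows "interp n d t = (\<Sum>i\<in>{1..k - 1}. d i) + d k * ((q t - q (grid n (k - 1))) / dq n k)"
proof -
  have t01: "0 \<le> t" "t \<le> 1" using order_trans[OF grid_nonneg t(1)] t(2) grid_in[of k n] k by auto
  have "interp n d t = (\<Sum>i\<in>{1..n}. if i \<le> k - 1 then d i else if i = k then d k * ((q t - q (grid n (k - 1))) / dq n k) else 0)"
    unfolding interp_def
  proof (intro sum.cong refl)
    fix i assume i: "i \<in> {1..n}"
    consider "i \<le> k - 1" | "i = k" "\<not> i \<le> k - 1" | "k \<le> i - 1" "\<not> i \<le> k - 1" "i \<noteq> k" using i by fastforce
    then show "d i * wt n i t = (if i \<le> k - 1 then d i else if i = k then d k * ((q t - q (grid n (k - 1))) / dq n k) else 0)"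
    proof cases
      case 1
      then have "grid n i \<le> t" using grid_mono[OF 1, of n] t by linarith
      then show ?thesis using 1 i t01 by (simp add: wt_below)
    next
      case 2
      then show ?thesis using wt_between[OF k t] by simp
    next
      case 3
      then have "t \<le> grid n (i - 1)" using grid_mono[OF 3(1), of n] t by linarith
      then show ?thesis using 3 i t01 by (simp add: wt_above)
    qed
  qed
  also have "\<dots> = (\<Sum>i\<in>{1..k}. if i \<le> k - 1 then d i else if i = k then d k * ((q t - q (grid n (k - 1))) / dq n k) else 0)"
    using k by (intro sum.mono_neutral_right) auto
  also have "{1..k} = insert k {1..k - 1}" using k by auto
  also have "(\<Sum>i\<in>insert k {1..k - 1}. if i \<le> k - 1 then d i else if i = k then d k * ((q t - q (grid n (k - 1))) / dq n k) else 0)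
     = (\<Sum>i\<in>{1..k - 1}. d i) + d k * ((q t - q (grid n (k - 1))) / dq n k)"
    using k by (subst sum.insert) auto
  finally show ?thesis .
qed

lemma interp_grid:
  assumes "k \<le> n"
  shows "interp n d (grid n k) = (\<Sum>i\<in>{1..k}. d i)"
proof (cases "k = 0")
  case False
  then have k: "k \<in> {1..n}" using assms by auto
  have "(\<Sum>i\<in>{1..k}. d i) = (\<Sum>i\<in>{1..k - 1}. d i) + d k" using False by (cases k) auto
  then show ?thesis
    using interp_between[OF k, of "grid n k" d] dq_pos[OF k] grid_mono[of "k - 1" k n] k
    by (simp add: dq_def)
qed (simp add: interp_0)

lemma interp_increment:
  assumes k: "k \<in> {1..n}" and "grid n (k - 1) \<le> s" "s \<le> grid n k" "grid n (k - 1) \<le> t" "t \<le> grid n k"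
  shows "interp n d t - interp n d s = d k / dq n k * (q t - q s)"
proof -
  have "interp n d t - interp n d s = d k * ((q t - q (grid n (k - 1))) / dq n k) - d k * ((q s - q (grid n (k - 1))) / dq n k)"
    using assms by (simp add: interp_between)
  also have "\<dots> = d k * ((q t - q (grid n (k - 1)) - (q s - q (grid n (k - 1)))) / dq n k)"
    by (simp only: right_diff_distrib diff_divide_distrib)
  finally show ?thesis by simp
qed

lemma continuous_on_interp:
  "continuous_on {0..1} q \<Longrightarrow> continuous_on {0..1} (interp n d)"
  unfolding interp_def wt_def
  by (intro continuous_intros ballI) (metis dq_pos less_irrefl)+

lemma refined_grid:
  assumes n: "n \<ge> 1" and m: "m \<ge> 1" and j: "j \<in> {1..n * m}"
  obtains k where "k \<in> {1..n}" "grid n (k - 1) \<le> grid (n * m) (j - 1)" "grid (n * m) j \<le> grid n k"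
proof
  \<comment> \<open>Cells are numbered from 1, hence the shift by one before and after the
    division.\<close>
  define k where "k = (j - 1) div m + 1"
  have "j - 1 < m * n" using j by (auto simp: mult.commute)
  then have "(j - 1) div m < n" using m by (simp add: less_mult_imp_div_less mult.commute)
  then show "k \<in> {1..n}" by (simp add: k_def)
  have a: "(j - 1) div m * m \<le> j - 1" by simp
  have "j - 1 < ((j - 1) div m + 1) * m" using m by (simp add: dividend_less_div_times add.commute)
  then have b: "j \<le> k * m" using j by (simp add: k_def)
  have c: "grid n i = grid (n * m) (i * m)" for i using m by (simp add: grid_def)
  show "grid n (k - 1) \<le> grid (n * m) (j - 1)" unfolding c by (rule grid_mono) (simp add: k_def a)
  show "grid (n * m) j \<le> grid n k" unfolding c by (rule grid_mono) (rule b)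
qed

end

section \<open>Orthogonality of interpolation and bridge\<close>

locale gauss_markov = centered_gaussian P \<Xi> + time_change q
  for P :: "'w measure" and \<Xi> :: "real \<Rightarrow> 'w \<Rightarrow> real" and q :: "real \<Rightarrow> real" +
  fixes v :: "real \<Rightarrow> real"
  assumes v_pos: "\<And>t. t \<in> {0..1} \<Longrightarrow> 0 < v t"
    and cov: "\<And>s t. 0 \<le> s \<Longrightarrow> s \<le> t \<Longrightarrow> t \<le> 1 \<Longrightarrow> expectation (\<lambda>\<omega>. \<Xi> s \<omega> * \<Xi> t \<omega>) = q s * v s * v t"
begin

definition X :: "real \<Rightarrow> 'w \<Rightarrow> real" where
  "X t \<omega> = \<Xi> t \<omega> / v t"

definition DX :: "nat \<Rightarrow> nat \<Rightarrow> 'w \<Rightarrow> real" where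
  "DX N j \<omega> = X (grid N j) \<omega> - X (grid N (j - 1)) \<omega>"

abbreviation IX :: "nat \<Rightarrow> real \<Rightarrow> 'w \<Rightarrow> real" where
  "IX n t \<omega> \<equiv> interp n (\<lambda>i. DX n i \<omega>) t"

definition DIX :: "nat \<Rightarrow> nat \<Rightarrow> nat \<Rightarrow> 'w \<Rightarrow> real" where
  "DIX n N j \<omega> = IX n (grid N j) \<omega> - IX n (grid N (j - 1)) \<omega>"

lemma lin_X: "t \<in> {0..1} \<Longrightarrow> lin (X t)"
  using lin_divide[OF lin_Xi, of t "v t"] unfolding X_def[abs_def] .

lemma lin_DX: "j \<le> N \<Longrightarrow> lin (DX N j)"
  unfolding DX_def[abs_def] by (intro lin_diff lin_X grid_in) auto

lemma lin_IX: "lin (IX n t)"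
  unfolding interp_def by (intro lin_sum lin_mult_right lin_DX) auto

lemma lin_DIX: "lin (DIX n N j)"
  unfolding DIX_def[abs_def] by (intro lin_diff lin_IX)

lemma expectation_XX:
  assumes "s \<in> {0..1}" "t \<in> {0..1}"
  shows "expectation (\<lambda>\<omega>. X s \<omega> * X t \<omega>) = min (q s) (q t)"
proof -
  have *: "expectation (\<lambda>\<omega>. X s \<omega> * X t \<omega>) = q s" if "0 \<le> s" "s \<le> t" "t \<le> 1" for s t
    using cov[OF that] v_pos[of s] v_pos[of t] that by (simp add: X_def)
  show ?thesis
  proof (cases "s \<le> t")
    case True
    then show ?thesis using *[of s t] assms q_le[of s t] by (simp add: min_absorb1)
  next
    case False
    then show ?thesis using *[of t s] assms q_le[of t s] by (simp add: min_absorb2 mult.commute)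
  qed
qed

lemma expectation_DX_X:
  assumes "j \<le> N" "t \<in> {0..1}"
  shows "expectation (\<lambda>\<omega>. DX N j \<omega> * X t \<omega>) = min (q t) (q (grid N j)) - min (q t) (q (grid N (j - 1)))"
proof -
  have g: "grid N j \<in> {0..1}" "grid N (j - 1) \<in> {0..1}" using assms by (auto intro!: grid_in simp del: atLeastAtMost_iff)
  have "expectation (\<lambda>\<omega>. DX N j \<omega> * X t \<omega>)
    = expectation (\<lambda>\<omega>. X (grid N j) \<omega> * X t \<omega> - X (grid N (j - 1)) \<omega> * X t \<omega>)"
    by (simp add: DX_def left_diff_distrib)
  also have "\<dots> = expectation (\<lambda>\<omega>. X (grid N j) \<omega> * X t \<omega>) - expectation (\<lambda>\<omega>. X (grid N (j - 1)) \<omega> * X t \<omega>)"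
    by (intro Bochner_Integration.integral_diff lin_mult_integrable lin_X g assms)
  finally show ?thesis using g assms by (simp add: expectation_XX min.commute)
qed

lemma expectation_DX_DX:
  assumes "j \<in> {1..N}" "k \<in> {1..N}"
  shows "expectation (\<lambda>\<omega>. DX N j \<omega> * DX N k \<omega>) = (if j = k then dq N j else 0)"
proof -
  have *: "expectation (\<lambda>\<omega>. DX N j \<omega> * DX N k \<omega>) = (if j = k then dq N j else 0)"
    if "j \<in> {1..N}" "k \<in> {1..N}" "j \<le> k" for j k
  proof -
    have g: "grid N k \<in> {0..1}" "grid N (k - 1) \<in> {0..1}" using that grid_in[of k N] grid_in[of "k - 1" N] by auto
    have "expectation (\<lambda>\<omega>. DX N j \<omega> * DX N k \<omega>)
      = expectation (\<lambda>\<omega>. DX N j \<omega> * X (grid N k) \<omega> - DX N j \<omega> * X (grid N (k - 1)) \<omega>)"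
      by (simp add: DX_def right_diff_distrib)
    also have "\<dots> = expectation (\<lambda>\<omega>. DX N j \<omega> * X (grid N k) \<omega>) - expectation (\<lambda>\<omega>. DX N j \<omega> * X (grid N (k - 1)) \<omega>)"
      using that by (intro Bochner_Integration.integral_diff lin_mult_integrable lin_X lin_DX g) auto
    also have "\<dots> = (if j = k then dq N j else 0)"
    proof (cases "j = k")
      case True
      then show ?thesis using that g q_grid_le[of "k - 1" k N]
        by (simp add: expectation_DX_X dq_def min_def)
    next
      case False
      then show ?thesis
        using that g q_grid_le[of j k N] q_grid_le[of j "k - 1" N] q_grid_le[of "j - 1" k N] q_grid_le[of "j - 1" "k - 1" N]
        by (simp add: expectation_DX_X min_absorb2)
    qed
    finally show ?thesis .
  qed
  show ?thesis using *[of j k] *[of k j] assms by (cases "j \<le> k") (auto simp: mult.commute)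
qed

text \<open>The normal equations of the regression: the increments are orthogonal, so only the term
  with index \<open>i\<close> survives and gives \<open>dq n i * wt n i t\<close>, which is the
  covariance with \<open>X t\<close> by the choice of the weights.\<close>

lemma expectation_DX_IX:
  assumes "i \<in> {1..n}" "t \<in> {0..1}"
  shows "expectation (\<lambda>\<omega>. DX n i \<omega> * IX n t \<omega>) = expectation (\<lambda>\<omega>. DX n i \<omega> * X t \<omega>)"
proof -
  have "expectation (\<lambda>\<omega>. DX n i \<omega> * IX n t \<omega>) = (\<Sum>k\<in>{1..n}. expectation (\<lambda>\<omega>. DX n i \<omega> * DX n k \<omega>) * wt n k t)"
    unfolding interp_def using assms by (intro expectation_mult_sum lin_DX) auto
  also have "\<dots> = (\<Sum>k\<in>{1..n}. (if k = i then dq n i * wt n i t else 0))"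
    using assms by (intro sum.cong refl) (auto simp: expectation_DX_DX)
  also have "\<dots> = dq n i * wt n i t" using assms by simp
  also have "\<dots> = expectation (\<lambda>\<omega>. DX n i \<omega> * X t \<omega>)"
    using assms dq_pos[of i n] by (simp add: expectation_DX_X wt_def)
  finally show ?thesis .
qed

lemma IX_orthogonal:
  assumes W: "lin W" and orth: "\<And>i. i \<in> {1..n} \<Longrightarrow> expectation (\<lambda>\<omega>. DX n i \<omega> * W \<omega>) = 0"
  shows "expectation (\<lambda>\<omega>. IX n t \<omega> * W \<omega>) = 0"
proof -
  have "expectation (\<lambda>\<omega>. W \<omega> * IX n t \<omega>) = (\<Sum>i\<in>{1..n}. expectation (\<lambda>\<omega>. W \<omega> * DX n i \<omega>) * wt n i t)"
    unfolding interp_def by (intro expectation_mult_sum W lin_DX) auto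
  also have "\<dots> = 0" using orth by (intro sum.neutral) (simp add: mult.commute)
  finally show ?thesis by (simp add: mult.commute)
qed

lemma IX_residual_orthogonal:
  assumes "t \<in> {0..1}"
  shows "expectation (\<lambda>\<omega>. IX n s \<omega> * (X t \<omega> - IX n t \<omega>)) = 0"
proof (rule IX_orthogonal)
  show "lin (\<lambda>\<omega>. X t \<omega> - IX n t \<omega>)" by (intro lin_diff lin_X lin_IX assms)
  fix i assume i: "i \<in> {1..n}"
  have "expectation (\<lambda>\<omega>. DX n i \<omega> * (X t \<omega> - IX n t \<omega>)) = expectation (\<lambda>\<omega>. DX n i \<omega> * X t \<omega> - DX n i \<omega> * IX n t \<omega>)"
    by (simp add: right_diff_distrib)
  also have "\<dots> = expectation (\<lambda>\<omega>. DX n i \<omega> * X t \<omega>) - expectation (\<lambda>\<omega>. DX n i \<omega> * IX n t \<omega>)"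
    using i by (intro Bochner_Integration.integral_diff lin_mult_integrable lin_X lin_DX lin_IX assms) auto
  finally show "expectation (\<lambda>\<omega>. DX n i \<omega> * (X t \<omega> - IX n t \<omega>)) = 0"
    using expectation_DX_IX[OF i assms] by simp
qed

lemma DIX_residual_orthogonal:
  assumes k: "k \<in> {1..N}"
  shows "expectation (\<lambda>\<omega>. DIX n N j \<omega> * (DX N k \<omega> - DIX n N k \<omega>)) = 0"
proof -
  have g: "grid N k \<in> {0..1}" "grid N (k - 1) \<in> {0..1}" using k grid_in[of k N] grid_in[of "k - 1" N] by auto
  let ?R = "\<lambda>t \<omega>. X t \<omega> - IX n t \<omega>"
  have R: "lin (?R t)" if "t \<in> {0..1}" for t by (intro lin_diff lin_X lin_IX that)
  have int: "integrable P (\<lambda>\<omega>. IX n s \<omega> * ?R t \<omega>)" if "t \<in> {0..1}" for s t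
    by (intro lin_mult_integrable lin_IX R that)
  have "expectation (\<lambda>\<omega>. DIX n N j \<omega> * (DX N k \<omega> - DIX n N k \<omega>)) =
    expectation (\<lambda>\<omega>. (IX n (grid N j) \<omega> * ?R (grid N k) \<omega> - IX n (grid N j) \<omega> * ?R (grid N (k - 1)) \<omega>)
      - (IX n (grid N (j - 1)) \<omega> * ?R (grid N k) \<omega> - IX n (grid N (j - 1)) \<omega> * ?R (grid N (k - 1)) \<omega>))"
    by (intro Bochner_Integration.integral_cong refl) (simp add: DIX_def DX_def algebra_simps)
  also have "\<dots> = 0"
    using g by (simp add: Bochner_Integration.integral_diff int Bochner_Integration.integrable_diff IX_residual_orthogonal)
  finally show ?thesis .
qed

lemma expectation_sum_DX_sq:
  "expectation (\<lambda>\<omega>. (\<Sum>j\<in>{1..N}. c j * DX N j \<omega>)\<^sup>2) = (\<Sum>j\<in>{1..N}. (c j)\<^sup>2 * (sd N j)\<^sup>2)"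
proof -
  let ?S = "\<lambda>\<omega>. \<Sum>j\<in>{1..N}. DX N j \<omega> * c j"
  have S: "lin ?S" by (intro lin_sum lin_mult_right lin_DX) auto
  have "expectation (\<lambda>\<omega>. (\<Sum>j\<in>{1..N}. c j * DX N j \<omega>)\<^sup>2) = expectation (\<lambda>\<omega>. ?S \<omega> * ?S \<omega>)"
    by (simp add: power2_eq_square mult.commute)
  also have "\<dots> = (\<Sum>j\<in>{1..N}. expectation (\<lambda>\<omega>. ?S \<omega> * DX N j \<omega>) * c j)"
    by (intro expectation_mult_sum S lin_DX) auto
  also have "\<dots> = (\<Sum>j\<in>{1..N}. (c j * dq N j) * c j)"
  proof (intro sum.cong refl)
    fix j assume j: "j \<in> {1..N}"
    have "expectation (\<lambda>\<omega>. DX N j \<omega> * ?S \<omega>) = (\<Sum>k\<in>{1..N}. expectation (\<lambda>\<omega>. DX N j \<omega> * DX N k \<omega>) * c k)"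
      using j by (intro expectation_mult_sum lin_DX) auto
    also have "\<dots> = (\<Sum>k\<in>{1..N}. if k = j then c j * dq N j else 0)"
      using j by (intro sum.cong refl) (auto simp: expectation_DX_DX)
    also have "\<dots> = c j * dq N j" using j by simp
    finally show "expectation (\<lambda>\<omega>. ?S \<omega> * DX N j \<omega>) * c j = (c j * dq N j) * c j"
      by (simp add: mult.commute)
  qed
  also have "\<dots> = (\<Sum>j\<in>{1..N}. (c j)\<^sup>2 * (sd N j)\<^sup>2)"
    by (intro sum.cong refl, subst sd_sq) (simp_all add: power2_eq_square)
  finally show ?thesis .
qed

lemma law_DX:
  "distr P (\<Pi>\<^sub>M j\<in>{1..N}. borel) (\<lambda>\<omega>. \<lambda>j\<in>{1..N}. DX N j \<omega>)
    = (\<Pi>\<^sub>M j\<in>{1..N}. density lborel (normal_density 0 (sd N j)))"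
proof (rule distr_eq_PiM_normal)
  show "(CLINT \<omega>|P. iexp (\<Sum>j\<in>{1..N}. c j * DX N j \<omega>)) = exp (- (\<Sum>j\<in>{1..N}. (c j)\<^sup>2 * (sd N j)\<^sup>2) / 2)" for c
    unfolding expectation_sum_DX_sq[symmetric]
    by (rule lin_char) (intro lin_sum lin_cmult lin_DX, auto)
qed (auto intro!: lin_measurable lin_DX sd_pos prob_space_axioms)

text \<open>The interpolation is read off the first factor and the bridge off the second. For every
  choice of coefficients the linear form in the interpolation is uncorrelated with the one in the
  bridge, so the vector has the law found in \<open>law_DX\<close>, as if both parts came from one
  path.\<close>

lemma law_DIX_residual:
  "distr (P \<Otimes>\<^sub>M P) (\<Pi>\<^sub>M j\<in>{1..N}. borel) (\<lambda>\<omega>. \<lambda>j\<in>{1..N}. DIX n N j (fst \<omega>) + (DX N j (snd \<omega>) - DIX n N j (snd \<omega>)))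
    = (\<Pi>\<^sub>M j\<in>{1..N}. density lborel (normal_density 0 (sd N j)))"
proof (rule distr_eq_PiM_normal)
  interpret PP: pair_prob_space P P ..
  show "prob_space (P \<Otimes>\<^sub>M P)" by (rule PP.prob_space_axioms)
  note [measurable] = lin_measurable[OF lin_DIX]
  have [measurable]: "DX N j \<in> borel_measurable P" if "j \<in> {1..N}" for j
    using that by (intro lin_measurable lin_DX) auto
  show "(\<lambda>\<omega>. DIX n N j (fst \<omega>) + (DX N j (snd \<omega>) - DIX n N j (snd \<omega>))) \<in> borel_measurable (P \<Otimes>\<^sub>M P)"
    if "j \<in> {1..N}" for j using that by measurable
  fix c :: "nat \<Rightarrow> real"
  let ?A = "\<lambda>\<omega>. \<Sum>j\<in>{1..N}. DIX n N j \<omega> * c j" and ?B = "\<lambda>\<omega>. \<Sum>j\<in>{1..N}. DX N j \<omega> * c j"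
  have A: "lin ?A" by (intro lin_sum lin_mult_right lin_DIX)
  have B: "lin ?B" by (intro lin_sum lin_mult_right lin_DX) auto
  have R: "lin (\<lambda>\<omega>. DX N j \<omega> - DIX n N j \<omega>)" if "j \<in> {1..N}" for j
    using that by (intro lin_diff lin_DX lin_DIX) auto
  have "expectation (\<lambda>\<omega>. ?A \<omega> * (?B \<omega> - ?A \<omega>)) = expectation (\<lambda>\<omega>. ?A \<omega> * (\<Sum>j\<in>{1..N}. (DX N j \<omega> - DIX n N j \<omega>) * c j))"
    by (simp add: left_diff_distrib sum_subtractf)
  also have "\<dots> = (\<Sum>j\<in>{1..N}. expectation (\<lambda>\<omega>. ?A \<omega> * (DX N j \<omega> - DIX n N j \<omega>)) * c j)"
    by (intro expectation_mult_sum A R)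
  also have "\<dots> = 0"
  proof (intro sum.neutral ballI)
    fix j assume j: "j \<in> {1..N}"
    have "expectation (\<lambda>\<omega>. (DX N j \<omega> - DIX n N j \<omega>) * ?A \<omega>)
      = (\<Sum>k\<in>{1..N}. expectation (\<lambda>\<omega>. (DX N j \<omega> - DIX n N j \<omega>) * DIX n N k \<omega>) * c k)"
      by (intro expectation_mult_sum R lin_DIX j)
    also have "\<dots> = 0" using DIX_residual_orthogonal[OF j] by (simp add: mult.commute)
    finally show "expectation (\<lambda>\<omega>. ?A \<omega> * (DX N j \<omega> - DIX n N j \<omega>)) * c j = 0" by (simp add: mult.commute)
  qed
  finally have orth: "expectation (\<lambda>\<omega>. ?A \<omega> * (?B \<omega> - ?A \<omega>)) = 0" .
  have "(\<Sum>j\<in>{1..N}. c j * (DIX n N j (fst \<omega>) + (DX N j (snd \<omega>) - DIX n N j (snd \<omega>)))) = ?A (fst \<omega>) + (?B (snd \<omega>) - ?A (snd \<omega>))" for \<omega>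
    by (simp add: sum.distrib sum_subtractf algebra_simps)
  then have "(CLINT \<omega>|P \<Otimes>\<^sub>M P. iexp (\<Sum>j\<in>{1..N}. c j * (DIX n N j (fst \<omega>) + (DX N j (snd \<omega>) - DIX n N j (snd \<omega>)))))
    = (CLINT \<omega>|P \<Otimes>\<^sub>M P. iexp (?A (fst \<omega>) + (?B (snd \<omega>) - ?A (snd \<omega>))))" by (simp only:)
  also have "\<dots> = exp (- expectation (\<lambda>\<omega>. (?B \<omega>)\<^sup>2) / 2)"
    by (rule lin_char_pair[OF A B orth])
  also have "expectation (\<lambda>\<omega>. (?B \<omega>)\<^sup>2) = (\<Sum>j\<in>{1..N}. (c j)\<^sup>2 * (sd N j)\<^sup>2)"
    using expectation_sum_DX_sq[of c N] by (simp add: mult.commute)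
  finally show "(CLINT \<omega>|P \<Otimes>\<^sub>M P. iexp (\<Sum>j\<in>{1..N}. c j * (DIX n N j (fst \<omega>) + (DX N j (snd \<omega>) - DIX n N j (snd \<omega>)))))
    = exp (- (\<Sum>j\<in>{1..N}. (c j)\<^sup>2 * (sd N j)\<^sup>2) / 2)" .
qed (auto intro: sd_pos)

end

subsection \<open>Interpolation and Riemann sum errors\<close>

lemma hoelder_on_bounded:
  assumes f: "hoelder_on {0..1} \<beta> f" and \<beta>: "0 < \<beta>"
  shows "\<exists>B\<ge>0. \<forall>x\<in>{0..1}. \<bar>f x\<bar> \<le> B"
proof -
  obtain H where H: "\<And>x y. x \<in> {0..1} \<Longrightarrow> y \<in> {0..1} \<Longrightarrow> \<bar>f x - f y\<bar> \<le> H * \<bar>x - y\<bar> powr \<beta>"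
    using f unfolding hoelder_on_def by blast
  have "\<bar>f x\<bar> \<le> \<bar>f 0\<bar> + \<bar>H\<bar>" if x: "x \<in> {0..1}" for x
  proof -
    have "H * \<bar>x - 0\<bar> powr \<beta> \<le> \<bar>H\<bar> * 1"
      using x \<beta> by (intro mult_mono) (auto intro!: powr_le1)
    with H[OF x, of 0] show ?thesis by simp
  qed
  then show ?thesis by (intro exI[of _ "\<bar>f 0\<bar> + \<bar>H\<bar>"]) auto
qed

lemma hoelder_on_mult:
  assumes f: "hoelder_on {0..1} \<beta> f" and g: "hoelder_on {0..1} \<beta> g" and \<beta>: "0 < \<beta>"
  shows "hoelder_on {0..1} \<beta> (\<lambda>x. f x * g x)"
proof -
  obtain H K where H: "\<And>x y. x \<in> {0..1} \<Longrightarrow> y \<in> {0..1} \<Longrightarrow> \<bar>f x - f y\<bar> \<le> H * \<bar>x - y\<bar> powr \<beta>"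
    and K: "\<And>x y. x \<in> {0..1} \<Longrightarrow> y \<in> {0..1} \<Longrightarrow> \<bar>g x - g y\<bar> \<le> K * \<bar>x - y\<bar> powr \<beta>"
    using f g unfolding hoelder_on_def by blast
  obtain B C where B: "\<And>x. x \<in> {0..1} \<Longrightarrow> \<bar>f x\<bar> \<le> B" and C: "\<And>x. x \<in> {0..1} \<Longrightarrow> \<bar>g x\<bar> \<le> C" and "0 \<le> B" "0 \<le> C"
    using hoelder_on_bounded[OF f \<beta>] hoelder_on_bounded[OF g \<beta>] by blast
  have "\<bar>f x * g x - f y * g y\<bar> \<le> (H * C + B * K) * \<bar>x - y\<bar> powr \<beta>" if xy: "x \<in> {0..1}" "y \<in> {0..1}" for x y
  proof -
    have "f x * g x - f y * g y = (f x - f y) * g x + f y * (g x - g y)" by (simp add: algebra_simps)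
    then have "\<bar>f x * g x - f y * g y\<bar> \<le> \<bar>f x - f y\<bar> * \<bar>g x\<bar> + \<bar>f y\<bar> * \<bar>g x - g y\<bar>"
      by (metis abs_triangle_ineq abs_mult)
    also have "\<dots> \<le> (H * \<bar>x - y\<bar> powr \<beta>) * C + B * (K * \<bar>x - y\<bar> powr \<beta>)"
      using H[OF xy] K[OF xy] B[OF xy(2)] C[OF xy(1)] \<open>0 \<le> B\<close> \<open>0 \<le> C\<close>
      by (intro add_mono mult_mono) (auto intro: order_trans[OF abs_ge_zero])
    finally show ?thesis by (simp add: algebra_simps)
  qed
  then show ?thesis unfolding hoelder_on_def by blast
qed

lemma hoelder_on_inverse:
  assumes f: "hoelder_on {0..1} \<beta> f" and c: "0 < c" "\<And>x. x \<in> {0..1} \<Longrightarrow> c \<le> f x"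
  shows "hoelder_on {0..1} \<beta> (\<lambda>x. 1 / f x)"
proof -
  obtain H where H: "\<And>x y. x \<in> {0..1} \<Longrightarrow> y \<in> {0..1} \<Longrightarrow> \<bar>f x - f y\<bar> \<le> H * \<bar>x - y\<bar> powr \<beta>"
    using f unfolding hoelder_on_def by blast
  have "\<bar>1 / f x - 1 / f y\<bar> \<le> (H / (c * c)) * \<bar>x - y\<bar> powr \<beta>" if xy: "x \<in> {0..1}" "y \<in> {0..1}" for x y
  proof -
    have p: "c \<le> f x" "c \<le> f y" using c xy by auto
    then have cc: "c * c \<le> f x * f y" using c(1) by (intro mult_mono) auto
    have "\<bar>1 / f x - 1 / f y\<bar> = \<bar>f x - f y\<bar> / (f x * f y)"
      using p c(1) by (simp add: abs_minus_commute divide_simps abs_mult)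
    also have "\<dots> \<le> (H * \<bar>x - y\<bar> powr \<beta>) / (c * c)"
      using cc c(1) H[OF xy] by (intro frac_le) auto
    finally show ?thesis by simp
  qed
  then show ?thesis unfolding hoelder_on_def by blast
qed

lemma abs_diff_le_powr:
  fixes x y :: real
  assumes "x \<in> {0..1}" "y \<in> {0..1}" "0 < \<beta>" "\<beta> \<le> 1"
  shows "\<bar>x - y\<bar> \<le> \<bar>x - y\<bar> powr \<beta>"
proof -
  have "\<bar>x - y\<bar> \<le> 1" using assms by (auto simp: abs_le_iff)
  then have "\<bar>x - y\<bar> powr 1 \<le> \<bar>x - y\<bar> powr \<beta>" using assms by (intro powr_mono') auto
  then show ?thesis by simp
qed

lemma hoelder_on_exponent_le:
  assumes f: "hoelder_on {0..1} \<gamma> f" and "\<beta> \<le> \<gamma>"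
  shows "hoelder_on {0..1} \<beta> f"
proof -
  obtain H where H: "\<And>x y. x \<in> {0..1} \<Longrightarrow> y \<in> {0..1} \<Longrightarrow> \<bar>f x - f y\<bar> \<le> H * \<bar>x - y\<bar> powr \<gamma>"
    using f unfolding hoelder_on_def by blast
  have "\<bar>f x - f y\<bar> \<le> \<bar>H\<bar> * \<bar>x - y\<bar> powr \<beta>" if xy: "x \<in> {0..1}" "y \<in> {0..1}" for x y
  proof -
    have "\<bar>x - y\<bar> \<le> 1" using xy by (auto simp: abs_le_iff)
    then have "H * \<bar>x - y\<bar> powr \<gamma> \<le> \<bar>H\<bar> * \<bar>x - y\<bar> powr \<beta>"
      using assms(2) by (intro mult_mono powr_mono') auto
    with H[OF xy] show ?thesis by linarith
  qed
  then show ?thesis unfolding hoelder_on_def by blast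
qed

lemma lipschitz_from_derivative:
  fixes f f' :: "real \<Rightarrow> real"
  assumes "\<And>t. t \<in> {0..1} \<Longrightarrow> (f has_real_derivative f' t) (at t within {0..1})"
    and "\<And>t. t \<in> {0..1} \<Longrightarrow> \<bar>f' t\<bar> \<le> B" and "x \<in> {0..1}" "y \<in> {0..1}"
  shows "\<bar>f x - f y\<bar> \<le> B * \<bar>x - y\<bar>"
  using field_differentiable_bound[of "{0..1}" f f' B y x] assms by (simp add: abs_minus_commute)

lemma hoelder_on_from_derivative:
  assumes f: "\<And>t. t \<in> {0..1} \<Longrightarrow> (f has_real_derivative f' t) (at t within {0..1})"
    and f': "hoelder_on {0..1} \<beta> f'" and \<beta>: "0 < \<beta>" "\<beta> \<le> 1"
  shows "hoelder_on {0..1} \<beta> f"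
proof -
  obtain B where B: "0 \<le> B" "\<And>x. x \<in> {0..1} \<Longrightarrow> \<bar>f' x\<bar> \<le> B"
    using hoelder_on_bounded[OF f' \<beta>(1)] by blast
  have "\<bar>f x - f y\<bar> \<le> B * \<bar>x - y\<bar> powr \<beta>" if xy: "x \<in> {0..1}" "y \<in> {0..1}" for x y
    using order_trans[OF lipschitz_from_derivative[OF f B(2) xy] mult_left_mono[OF abs_diff_le_powr[OF xy \<beta>] B(1)]]
    by simp
  then show ?thesis unfolding hoelder_on_def by blast
qed

text \<open>With the clock as second function, increments of \<open>W\<close> are compared directly
  with increments of \<open>q\<close>; with the identity in its place this is the ordinary mean
  value theorem. One-sided derivatives at the ends of the unit interval suffice.\<close>

lemma cauchy_mvt:
  fixes W q :: "real \<Rightarrow> real"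
  assumes W: "\<And>x. x \<in> {0..1} \<Longrightarrow> (W has_real_derivative W' x) (at x within {0..1})"
    and q: "\<And>x. x \<in> {0..1} \<Longrightarrow> (q has_real_derivative q' x) (at x within {0..1})"
    and q': "\<And>x. x \<in> {0..1} \<Longrightarrow> q' x \<noteq> 0"
    and st: "0 \<le> s" "s < t" "t \<le> 1"
  shows "\<exists>x\<in>{s..t}. W t - W s = W' x / q' x * (q t - q s)"
proof -
  define k where "k x = W x * (q t - q s) - q x * (W t - W s)" for x
  have k: "(k has_derivative (\<lambda>h. (W' x * (q t - q s) - q' x * (W t - W s)) * h)) (at x within {s..t})" if "s \<le> x" "x \<le> t" for x
  proof -
    have x: "x \<in> {0..1}" using that st by auto
    have "(k has_real_derivative (W' x * (q t - q s) - q' x * (W t - W s))) (at x within {0..1})"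
      unfolding k_def by (intro DERIV_diff DERIV_cmult_right W q x)
    then show ?thesis
      unfolding has_field_derivative_def using st by (intro has_derivative_subset[where t="{s..t}"]) auto
  qed
  obtain x where x: "x \<in> {s<..<t}" "k t - k s = (W' x * (q t - q s) - q' x * (W t - W s)) * (t - s)"
    using mvt_simple[OF st(2) k] by blast
  have "k t - k s = 0" by (simp add: k_def algebra_simps)
  with x st have "W' x * (q t - q s) = q' x * (W t - W s)" by simp
  moreover have "q' x \<noteq> 0" using q' x st by auto
  ultimately have "W t - W s = W' x / q' x * (q t - q s)" by (simp add: field_simps)
  then show ?thesis using x by (intro bexI[of _ x]) auto
qed

section \<open>Errors uniform over primitives of Hoelder functions\<close>

text \<open>One constant \<open>K\<close> bounds both the size and the Hoelder quotient of
  \<open>g\<close>, so every error bound below is linear in \<open>K\<close>.\<close>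

definition hoelder_primitive :: "real \<Rightarrow> real \<Rightarrow> (real \<Rightarrow> real) \<Rightarrow> (real \<Rightarrow> real) \<Rightarrow> bool" where
  "hoelder_primitive \<beta> K g G \<longleftrightarrow>
     (\<forall>x\<in>{0..1}. \<bar>g x\<bar> \<le> K) \<and>
     (\<forall>x\<in>{0..1}. \<forall>y\<in>{0..1}. \<bar>g x - g y\<bar> \<le> K * \<bar>x - y\<bar> powr \<beta>) \<and>
     (\<forall>x\<in>{0..1}. (G has_real_derivative g x) (at x within {0..1})) \<and> G 0 = 0"

locale smooth_time_change = time_change q for q :: "real \<Rightarrow> real" +
  fixes v q' v' :: "real \<Rightarrow> real" and \<beta> c v0 :: real
  assumes q_deriv: "\<And>t. t \<in> {0..1} \<Longrightarrow> (q has_real_derivative q' t) (at t within {0..1})"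
    and v_deriv: "\<And>t. t \<in> {0..1} \<Longrightarrow> (v has_real_derivative v' t) (at t within {0..1})"
    and c: "0 < c" "\<And>t. t \<in> {0..1} \<Longrightarrow> c \<le> q' t"
    and v0: "0 < v0" "\<And>t. t \<in> {0..1} \<Longrightarrow> v0 \<le> v t"
    and \<beta>: "0 < \<beta>" "\<beta> \<le> 1"
    and q'_hoelder: "hoelder_on {0..1} \<beta> q'" and v'_hoelder: "hoelder_on {0..1} \<beta> v'"
begin

lemma v_nz: "t \<in> {0..1} \<Longrightarrow> v t \<noteq> 0" using v0 by force

lemma q'_nz: "t \<in> {0..1} \<Longrightarrow> q' t \<noteq> 0" using c by force

lemma v_hoelder: "hoelder_on {0..1} \<beta> v"
  using hoelder_on_from_derivative[OF v_deriv v'_hoelder \<beta>] .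

lemma inverse_v_hoelder: "hoelder_on {0..1} \<beta> (\<lambda>t. 1 / v t)"
  using hoelder_on_inverse[OF v_hoelder v0] .

text \<open>A Hoelder bound would be too weak for \<open>riemann_error\<close>: there the increment
  of \<open>1 / v\<close> multiplies an error of order \<open>n powr - \<beta>\<close> and must
  itself be of order \<open>1 / n\<close>.\<close>

lemma inverse_v_lipschitz:
  "\<exists>B\<ge>0. \<forall>x\<in>{0..1}. \<forall>y\<in>{0..1}. \<bar>1 / v x - 1 / v y\<bar> \<le> B * \<bar>x - y\<bar>"
proof -
  obtain B where B: "0 \<le> B" "\<And>x. x \<in> {0..1} \<Longrightarrow> \<bar>v' x\<bar> \<le> B"
    using hoelder_on_bounded[OF v'_hoelder \<beta>(1)] by blast
  have "\<bar>1 / v x - 1 / v y\<bar> \<le> (B / (v0 * v0)) * \<bar>x - y\<bar>" if xy: "x \<in> {0..1}" "y \<in> {0..1}" for x y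
  proof -
    have p: "v0 \<le> v x" "v0 \<le> v y" using v0 xy by auto
    then have cc: "v0 * v0 \<le> v x * v y" using v0(1) by (intro mult_mono) auto
    have "\<bar>1 / v x - 1 / v y\<bar> = \<bar>v x - v y\<bar> / (v x * v y)"
      using p v0(1) by (simp add: abs_minus_commute divide_simps abs_mult)
    also have "\<dots> \<le> (B * \<bar>x - y\<bar>) / (v0 * v0)"
      using cc v0(1) lipschitz_from_derivative[OF v_deriv B(2) xy] by (intro frac_le) auto
    finally show ?thesis by simp
  qed
  then show ?thesis using B v0 by (intro exI[of _ "B / (v0 * v0)"]) auto
qed

lemma dq_ge:
  assumes i: "i \<in> {1..n}"
  shows "c / real n \<le> dq n i"
proof -
  have gr: "grid n i \<in> {0..1}" using i by (intro grid_in) auto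
  have gl: "grid n (i - 1) < grid n i" using i by (intro grid_less) auto
  have id: "((\<lambda>x. x) has_real_derivative 1) (at x within {0..1})" for x :: real by (rule DERIV_ident)
  obtain x where x: "x \<in> {grid n (i - 1)..grid n i}" "q (grid n i) - q (grid n (i - 1)) = q' x / 1 * (grid n i - grid n (i - 1))"
    using cauchy_mvt[OF q_deriv id _ grid_nonneg gl] gr by auto
  have "x \<in> {0..1}" using x gr order_trans[OF grid_nonneg[of n "i - 1"]] by auto
  moreover have "grid n i - grid n (i - 1) = 1 / real n"
    using i by (simp add: grid_def of_nat_diff diff_divide_distrib)
  ultimately show ?thesis using x(2) c(2)[of x] by (simp add: dq_def divide_right_mono)
qed

lemma hoelder_primitive_bounds:
  assumes "hoelder_primitive \<beta> K g G" and x: "x \<in> {0..1}"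
  shows "\<bar>G x\<bar> \<le> K" and "0 \<le> K" and "y \<in> {0..1} \<Longrightarrow> \<bar>G x - G y\<bar> \<le> K * \<bar>x - y\<bar> powr \<beta>"
proof -
  note G = assms(1)[unfolded hoelder_primitive_def]
  have "\<bar>g x\<bar> \<le> K" using G x by blast
  then show K: "0 \<le> K" by linarith
  have lip: "\<bar>G x - G y\<bar> \<le> K * \<bar>x - y\<bar>" if "y \<in> {0..1}" for y
    using G x that by (intro lipschitz_from_derivative[of G g]) auto
  have "K * \<bar>x\<bar> \<le> K" using K x by (simp add: mult_left_le)
  then show "\<bar>G x\<bar> \<le> K" using lip[of 0] G by simp
  show "\<bar>G x - G y\<bar> \<le> K * \<bar>x - y\<bar> powr \<beta>" if y: "y \<in> {0..1}"
    using order_trans[OF lip[OF y] mult_left_mono[OF abs_diff_le_powr[OF x y \<beta>] K]] .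
qed

text \<open>The derivative of \<open>G / v\<close> with respect to the clock \<open>q\<close>.\<close>

definition slope :: "(real \<Rightarrow> real) \<Rightarrow> (real \<Rightarrow> real) \<Rightarrow> real \<Rightarrow> real" where
  "slope g G x = (g x * v x - G x * v' x) / (v x * v x) / q' x"

text \<open>The constant must not depend on \<open>g\<close>. The slope equals
  \<open>g * a - G * b\<close> with coefficients \<open>a\<close> and \<open>b\<close> built from
  \<open>v\<close>, \<open>v'\<close> and \<open>q'\<close> alone; it is linear in the pair, and all
  four functions have the exponent \<beta>.\<close>

lemma slope_hoelder:
  "\<exists>H\<ge>0. \<forall>K g G. hoelder_primitive \<beta> K g G \<longrightarrow>
    (\<forall>x\<in>{0..1}. \<forall>y\<in>{0..1}. \<bar>slope g G x - slope g G y\<bar> \<le> H * K * \<bar>x - y\<bar> powr \<beta>)"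
proof -
  define a where "a t = 1 / v t * (1 / q' t)" for t
  define b where "b t = v' t * (1 / v t) * a t" for t
  have a: "hoelder_on {0..1} \<beta> a"
    unfolding a_def by (intro hoelder_on_mult inverse_v_hoelder hoelder_on_inverse[OF q'_hoelder c] \<beta>)
  have b: "hoelder_on {0..1} \<beta> b"
    unfolding b_def by (intro hoelder_on_mult v'_hoelder inverse_v_hoelder a \<beta>)
  obtain Ha Hb where Ha: "\<And>x y. x \<in> {0..1} \<Longrightarrow> y \<in> {0..1} \<Longrightarrow> \<bar>a x - a y\<bar> \<le> Ha * \<bar>x - y\<bar> powr \<beta>"
    and Hb: "\<And>x y. x \<in> {0..1} \<Longrightarrow> y \<in> {0..1} \<Longrightarrow> \<bar>b x - b y\<bar> \<le> Hb * \<bar>x - y\<bar> powr \<beta>"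
    using a b unfolding hoelder_on_def by blast
  have "0 \<le> Ha" "0 \<le> Hb" using Ha[of 0 1] Hb[of 0 1] by auto
  obtain A B where A: "0 \<le> A" "\<And>x. x \<in> {0..1} \<Longrightarrow> \<bar>a x\<bar> \<le> A" and B: "0 \<le> B" "\<And>x. x \<in> {0..1} \<Longrightarrow> \<bar>b x\<bar> \<le> B"
    using hoelder_on_bounded[OF a \<beta>(1)] hoelder_on_bounded[OF b \<beta>(1)] by blast
  have bound: "\<bar>slope g G x - slope g G y\<bar> \<le> (A + Ha + B + Hb) * K * \<bar>x - y\<bar> powr \<beta>"
    if G: "hoelder_primitive \<beta> K g G" and x: "x \<in> {0..1}" and y: "y \<in> {0..1}" for K g G x y
  proof -
    have sl: "slope g G t = g t * a t - G t * b t" if "t \<in> {0..1}" for t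
      using v_nz[OF that] q'_nz[OF that] by (simp add: slope_def a_def b_def field_simps)
    let ?p = "\<bar>x - y\<bar> powr \<beta>"
    have K: "0 \<le> K" by (rule hoelder_primitive_bounds(2)[OF G x])
    have g: "\<bar>g x - g y\<bar> \<le> K * ?p" "\<bar>g y\<bar> \<le> K" using G x y unfolding hoelder_primitive_def by blast+
    have "slope g G x - slope g G y = (g x - g y) * a x + g y * (a x - a y) - ((G x - G y) * b x + G y * (b x - b y))"
      unfolding sl[OF x] sl[OF y] by (simp add: algebra_simps)
    then have "\<bar>slope g G x - slope g G y\<bar> \<le> \<bar>(g x - g y) * a x\<bar> + \<bar>g y * (a x - a y)\<bar> + (\<bar>(G x - G y) * b x\<bar> + \<bar>G y * (b x - b y)\<bar>)"
      by linarith
    also have "\<dots> \<le> (K * ?p) * A + K * (Ha * ?p) + ((K * ?p) * B + K * (Hb * ?p))"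
    proof -
      have Kp: "0 \<le> K * ?p" using K by simp
      have "\<bar>(g x - g y) * a x\<bar> \<le> (K * ?p) * A"
        unfolding abs_mult by (rule mult_mono[OF g(1) A(2)[OF x] Kp abs_ge_zero])
      moreover have "\<bar>g y * (a x - a y)\<bar> \<le> K * (Ha * ?p)"
        unfolding abs_mult by (rule mult_mono[OF g(2) Ha[OF x y] K abs_ge_zero])
      moreover have "\<bar>(G x - G y) * b x\<bar> \<le> (K * ?p) * B"
        unfolding abs_mult by (rule mult_mono[OF hoelder_primitive_bounds(3)[OF G x y] B(2)[OF x] Kp abs_ge_zero])
      moreover have "\<bar>G y * (b x - b y)\<bar> \<le> K * (Hb * ?p)"
        unfolding abs_mult by (rule mult_mono[OF hoelder_primitive_bounds(1)[OF G y] Hb[OF x y] K abs_ge_zero])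
      ultimately show ?thesis by linarith
    qed
    also have "\<dots> = (A + Ha + B + Hb) * K * ?p" by (simp add: algebra_simps)
    finally show ?thesis .
  qed
  then show ?thesis using \<open>0 \<le> Ha\<close> \<open>0 \<le> Hb\<close> A(1) B(1)
    by (intro exI[of _ "A + Ha + B + Hb"]) auto
qed

lemma quotient_deriv:
  assumes "hoelder_primitive \<beta> K g G" "x \<in> {0..1}"
  shows "((\<lambda>t. G t / v t) has_real_derivative (g x * v x - G x * v' x) / (v x * v x)) (at x within {0..1})"
  using assms unfolding hoelder_primitive_def by (intro DERIV_divide v_deriv v_nz) auto

text \<open>A predicate on the constant, so that one value, uniform in \<open>g\<close>, in both
  grids and in the cell, can be fixed once and enter the rate.\<close>

definition interp_bound :: "real \<Rightarrow> bool" where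
  "interp_bound H \<longleftrightarrow> 0 \<le> H \<and> (\<forall>K g G n m j. hoelder_primitive \<beta> K g G \<and> 1 \<le> n \<and> 1 \<le> m \<and> j \<in> {1..n * m} \<longrightarrow>
    \<bar>(G (grid (n * m) j) / v (grid (n * m) j) - G (grid (n * m) (j - 1)) / v (grid (n * m) (j - 1)))
     - (interp n (\<lambda>i. G (grid n i) / v (grid n i) - G (grid n (i - 1)) / v (grid n (i - 1))) (grid (n * m) j)
       - interp n (\<lambda>i. G (grid n i) / v (grid n i) - G (grid n (i - 1)) / v (grid n (i - 1))) (grid (n * m) (j - 1)))\<bar>
    \<le> H * K * real n powr - \<beta> * dq (n * m) j)"

text \<open>Slopes are taken with respect to \<open>q\<close>. On a coarse cell the interpolant has
  constant slope, namely that of \<open>G / v\<close> at some point \<open>y\<close> of the cell,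
  while the fine increment has the slope at some point \<open>x\<close> of the same cell. The points
  are at most \<open>1 / n\<close> apart, whatever the refinement \<open>m\<close>.\<close>

lemma interp_error: "\<exists>H. interp_bound H"
proof -
  obtain H where H: "0 \<le> H" "\<And>K g G x y. hoelder_primitive \<beta> K g G \<Longrightarrow> x \<in> {0..1} \<Longrightarrow> y \<in> {0..1} \<Longrightarrow>
      \<bar>slope g G x - slope g G y\<bar> \<le> H * K * \<bar>x - y\<bar> powr \<beta>"
    using slope_hoelder by blast
  have "\<bar>(G (grid (n * m) j) / v (grid (n * m) j) - G (grid (n * m) (j - 1)) / v (grid (n * m) (j - 1)))
     - (interp n (\<lambda>i. G (grid n i) / v (grid n i) - G (grid n (i - 1)) / v (grid n (i - 1))) (grid (n * m) j)
       - interp n (\<lambda>i. G (grid n i) / v (grid n i) - G (grid n (i - 1)) / v (grid n (i - 1))) (grid (n * m) (j - 1)))\<bar>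
      \<le> H * K * real n powr - \<beta> * dq (n * m) j"
    if G: "hoelder_primitive \<beta> K g G" and n: "1 \<le> n" and m: "1 \<le> m" and j: "j \<in> {1..n * m}" for K g G n m j
  proof -
    define W where "W t = G t / v t" for t
    have mvt: "\<exists>x\<in>{s..t}. W t - W s = slope g G x * (q t - q s)" if "0 \<le> s" "s < t" "t \<le> 1" for s t
      unfolding slope_def W_def
      by (rule cauchy_mvt[OF quotient_deriv[OF G] q_deriv q'_nz that])
    show ?thesis
      unfolding W_def[symmetric]
    proof (rule refined_grid[OF n m j])
      fix k assume k: "k \<in> {1..n}" "grid n (k - 1) \<le> grid (n * m) (j - 1)" "grid (n * m) j \<le> grid n k"
      let ?s = "grid (n * m) (j - 1)" and ?t = "grid (n * m) j" and ?S = "grid n (k - 1)" and ?T = "grid n k"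
      have st: "?s < ?t" using j n m by (intro grid_less) auto
      have st0: "?S < ?T" using k n by (intro grid_less) auto
      have t01: "?t \<le> 1" "?T \<le> 1" using grid_in[of j "n * m"] grid_in[of k n] j k by auto
      obtain x where x: "x \<in> {?s..?t}" "W ?t - W ?s = slope g G x * (q ?t - q ?s)"
        using mvt[OF grid_nonneg st t01(1)] by blast
      obtain y where y: "y \<in> {?S..?T}" "W ?T - W ?S = slope g G y * (q ?T - q ?S)"
        using mvt[OF grid_nonneg st0 t01(2)] by blast
      have xy: "x \<in> {0..1}" "y \<in> {0..1}"
        using x y t01 order_trans[OF grid_nonneg[of "n * m" "j - 1"], of x] order_trans[OF grid_nonneg[of n "k - 1"], of y] by auto
      have "?T - ?S = 1 / real n" using k by (simp add: grid_def of_nat_diff diff_divide_distrib)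
      then have "\<bar>x - y\<bar> \<le> 1 / real n" using x(1) y(1) k(2,3) by auto
      then have "\<bar>x - y\<bar> powr \<beta> \<le> (1 / real n) powr \<beta>" using \<beta> by (intro powr_mono2) auto
      also have "\<dots> = real n powr - \<beta>" using n by (simp add: powr_minus powr_divide divide_simps)
      finally have p: "\<bar>x - y\<bar> powr \<beta> \<le> real n powr - \<beta>" .
      have "interp n (\<lambda>i. W (grid n i) - W (grid n (i - 1))) ?t - interp n (\<lambda>i. W (grid n i) - W (grid n (i - 1))) ?s
        = (W ?T - W ?S) / dq n k * (q ?t - q ?s)"
        using k st by (intro interp_increment) auto
      also have "(W ?T - W ?S) / dq n k = slope g G y"
        using y(2) dq_pos[OF k(1)] by (simp add: dq_def)
      finally have "(W ?t - W ?s) - (interp n (\<lambda>i. W (grid n i) - W (grid n (i - 1))) ?t - interp n (\<lambda>i. W (grid n i) - W (grid n (i - 1))) ?s)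
        = (slope g G x - slope g G y) * dq (n * m) j"
        using x(2) by (simp add: dq_def left_diff_distrib)
      then have "\<bar>(W ?t - W ?s) - (interp n (\<lambda>i. W (grid n i) - W (grid n (i - 1))) ?t - interp n (\<lambda>i. W (grid n i) - W (grid n (i - 1))) ?s)\<bar>
        = \<bar>slope g G x - slope g G y\<bar> * dq (n * m) j"
        using dq_pos[OF j] by (simp add: abs_mult)
      also have "\<dots> \<le> (H * K * real n powr - \<beta>) * dq (n * m) j"
        using dq_pos[OF j] H(1) hoelder_primitive_bounds(2)[OF G xy(1)]
        by (intro mult_right_mono order_trans[OF H(2)[OF G xy]] mult_left_mono p) auto
      finally show "\<bar>(W ?t - W ?s)
       - (interp n (\<lambda>i. W (grid n i) - W (grid n (i - 1))) ?t - interp n (\<lambda>i. W (grid n i) - W (grid n (i - 1))) ?s)\<bar>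
        \<le> H * K * real n powr - \<beta> * dq (n * m) j" .
    qed
  qed
  then show ?thesis unfolding interp_bound_def using H(1) by blast
qed

definition riemann_bound :: "real \<Rightarrow> bool" where
  "riemann_bound H \<longleftrightarrow> 0 \<le> H \<and> (\<forall>K g G n i. hoelder_primitive \<beta> K g G \<and> i \<in> {1..n} \<longrightarrow>
    \<bar>(G (grid n i) - (\<Sum>j\<in>{1..i}. g (grid n j)) / real n) / v (grid n i)
     - (G (grid n (i - 1)) - (\<Sum>j\<in>{1..i - 1}. g (grid n j)) / real n) / v (grid n (i - 1))\<bar>
    \<le> H * K * real n powr - \<beta> * dq n i)"

text \<open>Each cell adds an error of order \<open>n powr - \<beta> / n\<close> to the Riemann sum
  at right endpoints, so the accumulated error \<open>E k\<close> is of order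
  \<open>n powr - \<beta>\<close>. In the increment of \<open>E / v\<close>, either \<open>E\<close>
  changes by the error of one cell or \<open>1 / v\<close> changes by a Lipschitz amount; both gain
  a factor \<open>1 / n\<close>.\<close>

lemma riemann_error: "\<exists>H. riemann_bound H"
proof -
  obtain B where B: "0 \<le> B" "\<And>x y. x \<in> {0..1} \<Longrightarrow> y \<in> {0..1} \<Longrightarrow> \<bar>1 / v x - 1 / v y\<bar> \<le> B * \<bar>x - y\<bar>"
    using inverse_v_lipschitz by blast
  show ?thesis
    unfolding riemann_bound_def
  \<comment> \<open>\<open>1 / v0\<close> belongs to the increment of \<open>E\<close>,
    \<open>B\<close> to the increment of \<open>1 / v\<close>, and the division by \<open>c\<close>
    turns \<open>1 / n\<close> into the clock increment by \<open>dq_ge\<close>.\<close>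
  proof (intro exI[of _ "(1 / v0 + B) / c"] conjI allI impI)
    show "0 \<le> (1 / v0 + B) / c" using B(1) v0 c by auto
    fix K :: real and g G :: "real \<Rightarrow> real" and n i :: nat
    assume "hoelder_primitive \<beta> K g G \<and> i \<in> {1..n}"
    then have G: "hoelder_primitive \<beta> K g G" and i: "i \<in> {1..n}" and n: "n \<ge> 1" by auto
    have K: "0 \<le> K" by (rule hoelder_primitive_bounds(2)[OF G, of 0]) simp
    define E where "E k = G (grid n k) - (\<Sum>j\<in>{1..k}. g (grid n j)) / real n" for k
    let ?p = "real n powr - \<beta>"
    have step: "\<bar>E k - E (k - 1)\<bar> \<le> K * ?p / real n" if k: "k \<in> {1..n}" for k
    proof -
      let ?s = "grid n (k - 1)" and ?t = "grid n k"
      have st: "?s < ?t" using k by (intro grid_less) auto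
      have t: "?t \<in> {0..1}" using k by (intro grid_in) auto
      have id: "((\<lambda>x. x) has_real_derivative 1) (at x within {0..1})" for x :: real by (rule DERIV_ident)
      obtain x where x: "x \<in> {?s..?t}" "G ?t - G ?s = g x / 1 * (?t - ?s)"
        using cauchy_mvt[of G g "\<lambda>x. x" "\<lambda>_. 1", OF _ id _ grid_nonneg st] G t unfolding hoelder_primitive_def by auto
      have x01: "x \<in> {0..1}" using x t order_trans[OF grid_nonneg[of n "k - 1"], of x] by auto
      have ts: "?t - ?s = 1 / real n" using k by (simp add: grid_def of_nat_diff diff_divide_distrib)
      have "(\<Sum>j\<in>{1..k}. g (grid n j)) = (\<Sum>j\<in>{1..k - 1}. g (grid n j)) + g ?t" using k by (cases k) auto
      then have "E k - E (k - 1) = (G ?t - G ?s) - g ?t / real n" by (simp add: E_def add_divide_distrib)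
      also have "\<dots> = (g x - g ?t) / real n" using x(2) ts by (simp add: diff_divide_distrib)
      finally have "\<bar>E k - E (k - 1)\<bar> = \<bar>g x - g ?t\<bar> / real n" by simp
      also have "\<bar>g x - g ?t\<bar> \<le> K * \<bar>x - ?t\<bar> powr \<beta>" using G x01 t unfolding hoelder_primitive_def by blast
      also have "\<bar>x - ?t\<bar> powr \<beta> \<le> (1 / real n) powr \<beta>" using \<beta> x(1) ts by (intro powr_mono2) auto
      also have "(1 / real n) powr \<beta> = ?p" using n by (simp add: powr_minus powr_divide divide_simps)
      finally show ?thesis using K by (simp add: divide_right_mono mult_left_mono)
    qed
    have E0: "E 0 = 0" using G by (simp add: E_def hoelder_primitive_def)
    have Ek: "\<bar>E k\<bar> \<le> K * ?p" if "k \<le> n" for k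
    proof -
      have "E k = (\<Sum>j\<in>{1..k}. E j - E (j - 1))" using sum_increments[of E k] E0 by simp
      then have "\<bar>E k\<bar> \<le> (\<Sum>j\<in>{1..k}. \<bar>E j - E (j - 1)\<bar>)" by (metis sum_abs)
      also have "\<dots> \<le> (\<Sum>j\<in>{1..k}. K * ?p / real n)" using that by (intro sum_mono step) auto
      also have "\<dots> = (K * ?p) * (real k / real n)" by simp
      also have "\<dots> \<le> K * ?p" using K that n by (intro mult_left_le) (auto simp: divide_simps)
      finally show ?thesis .
    qed
    let ?s = "grid n (i - 1)" and ?t = "grid n i"
    have t: "?t \<in> {0..1}" "?s \<in> {0..1}" using i grid_in[of i n] grid_in[of "i - 1" n] by auto
    have ts: "\<bar>?t - ?s\<bar> = 1 / real n" using i by (simp add: grid_def of_nat_diff diff_divide_distrib)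
    have "E i / v ?t - E (i - 1) / v ?s = (E i - E (i - 1)) * (1 / v ?t) + E (i - 1) * (1 / v ?t - 1 / v ?s)"
      by (simp add: algebra_simps)
    then have "\<bar>E i / v ?t - E (i - 1) / v ?s\<bar> \<le> \<bar>E i - E (i - 1)\<bar> * \<bar>1 / v ?t\<bar> + \<bar>E (i - 1)\<bar> * \<bar>1 / v ?t - 1 / v ?s\<bar>"
      by (metis abs_triangle_ineq abs_mult)
    also have "\<dots> \<le> (K * ?p / real n) * (1 / v0) + (K * ?p) * (B * (1 / real n))"
    proof (intro add_mono mult_mono)
      show "\<bar>1 / v ?t\<bar> \<le> 1 / v0" using v0(1) v0(2)[OF t(1)] by (simp add: frac_le)
      show "\<bar>1 / v ?t - 1 / v ?s\<bar> \<le> B * (1 / real n)" using B(2)[OF t] ts by simp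
    qed (use step[OF i] Ek[of "i - 1"] i K in auto)
    also have "\<dots> = (1 / v0 + B) / c * K * ?p * (c / real n)"
      using c n by (simp add: field_simps)
    also have "\<dots> \<le> (1 / v0 + B) / c * K * ?p * dq n i"
      using B(1) v0 c K by (intro mult_left_mono dq_ge[OF i]) auto
    finally show "\<bar>(G ?t - (\<Sum>j\<in>{1..i}. g (grid n j)) / real n) / v ?t
     - (G ?s - (\<Sum>j\<in>{1..i - 1}. g (grid n j)) / real n) / v ?s\<bar>
      \<le> (1 / v0 + B) / c * K * ?p * dq n i"
      unfolding E_def .
  qed
qed

end

section \<open>The Hoelder class and the drifts of the experiments\<close>

lemma hoelder_class_continuous:
  assumes f: "f \<in> hoelder_class \<alpha> L M" and \<alpha>: "0 < \<alpha>"
  shows "continuous_on {0..1} f"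
proof -
  have le: "\<bar>f x - f y\<bar> \<le> L * \<bar>x - y\<bar> powr \<alpha>" if "0 \<le> x" "x < y" "y \<le> 1" for x y
  proof -
    have "\<bar>f x - f y\<bar> / \<bar>x - y\<bar> powr \<alpha> \<le> L" using f that unfolding hoelder_class_def by blast
    moreover have "0 < \<bar>x - y\<bar> powr \<alpha>" using that by simp
    ultimately show ?thesis by (simp add: divide_le_eq)
  qed
  have "((\<lambda>y. f y) \<longlongrightarrow> f x) (at x within {0..1})" if x: "x \<in> {0..1}" for x
  proof (rule Lim_transform_bound[where f="\<lambda>y. f y - f x" and g="\<lambda>y. L * \<bar>y - x\<bar> powr \<alpha>", THEN LIM_zero_cancel])
    have "\<bar>f y - f x\<bar> \<le> L * \<bar>y - x\<bar> powr \<alpha>" if "y \<in> {0..1}" "y \<noteq> x" for y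
      using le[of x y] le[of y x] x that by (cases "x < y") (auto simp: abs_minus_commute)
    then show "\<forall>\<^sub>F y in at x within {0..1}. norm (f y - f x) \<le> norm (L * \<bar>y - x\<bar> powr \<alpha>)"
      unfolding eventually_at_filter by (intro always_eventually) (auto intro: order_trans[OF _ abs_ge_self])
    have "((\<lambda>y. \<bar>y - x\<bar>) \<longlongrightarrow> \<bar>x - x\<bar>) (at x within {0..1})" by (intro tendsto_intros)
    then have "((\<lambda>y. \<bar>y - x\<bar> powr \<alpha>) \<longlongrightarrow> 0 powr \<alpha>) (at x within {0..1})"
      using \<alpha> by (intro tendsto_powr') auto
    then show "((\<lambda>y. L * \<bar>y - x\<bar> powr \<alpha>) \<longlongrightarrow> 0) (at x within {0..1})"
      using tendsto_mult_right_zero[of "\<lambda>y. \<bar>y - x\<bar> powr \<alpha>" _ L] by simp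
  qed
  then show ?thesis by (simp add: continuous_on_def)
qed

text \<open>Once \<open>f 0\<close> is subtracted, the Hoelder constant bounds the size as well,
  since no point of the interval is further than 1 from 0. For the same reason the exponent may be
  lowered from \<alpha> to \<beta>.\<close>

lemma hoelder_class_primitive:
  assumes f: "f \<in> hoelder_class \<alpha> L M" and \<alpha>: "0 < \<alpha>" and \<beta>: "0 < \<beta>" "\<beta> \<le> \<alpha>" and L: "0 \<le> L"
  shows "hoelder_primitive \<beta> L (\<lambda>t. f t - f 0) (\<lambda>t. integral {0..t} f - f 0 * t)"
proof -
  have le0: "\<bar>f x - f y\<bar> \<le> L * \<bar>x - y\<bar> powr \<beta>" if "0 \<le> x" "x < y" "y \<le> 1" for x y
  proof -
    have "\<bar>f x - f y\<bar> / \<bar>x - y\<bar> powr \<alpha> \<le> L" using f that unfolding hoelder_class_def by blast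
    moreover have "0 < \<bar>x - y\<bar> powr \<alpha>" using that by simp
    ultimately have "\<bar>f x - f y\<bar> \<le> L * \<bar>x - y\<bar> powr \<alpha>" by (simp add: divide_le_eq)
    also have "\<dots> \<le> L * \<bar>x - y\<bar> powr \<beta>"
      using that \<beta> L by (intro mult_left_mono powr_mono') auto
    finally show ?thesis .
  qed
  have le: "\<bar>f x - f y\<bar> \<le> L * \<bar>x - y\<bar> powr \<beta>" if "x \<in> {0..1}" "y \<in> {0..1}" for x y
  proof (cases x y rule: linorder_cases)
    case equal
    then show ?thesis using L by simp
  qed (use le0[of x y] le0[of y x] that in \<open>auto simp: abs_minus_commute\<close>)
  have "\<bar>f x - f 0\<bar> \<le> L" if x: "x \<in> {0..1}" for x
  proof -
    have "L * \<bar>x - 0\<bar> powr \<beta> \<le> L * 1" using x \<beta> L by (intro mult_left_mono powr_le1) auto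
    with le[of x 0] x show ?thesis by simp
  qed
  moreover have "((\<lambda>t. integral {0..t} f - f 0 * t) has_real_derivative f x - f 0 * 1) (at x within {0..1})"
    if x: "x \<in> {0..1}" for x
    by (intro DERIV_diff DERIV_cmult DERIV_ident integral_has_real_derivative[OF hoelder_class_continuous[OF f \<alpha>] x])
  ultimately show ?thesis unfolding hoelder_primitive_def using le by simp
qed

context smooth_time_change
begin

definition interp_const :: real where
  "interp_const = (SOME H. interp_bound H)"

lemmas interp_const = someI_ex[OF interp_error, folded interp_const_def, unfolded interp_bound_def]

definition riemann_const :: real where
  "riemann_const = (SOME H. riemann_bound H)"

lemmas riemann_const = someI_ex[OF riemann_error, folded riemann_const_def, unfolded riemann_bound_def]

text \<open>The part of the path \<open>t / v t\<close> that the grid does not see. The kernel from the discrete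
  to the continuous experiment adds a multiple of it, so that constant functions \<open>f\<close> of any size
  are reproduced exactly.\<close>

definition residue :: "nat \<Rightarrow> real \<Rightarrow> real" where
  "residue n t = t / v t - interp n (\<lambda>i. grid n i / v (grid n i) - grid n (i - 1) / v (grid n (i - 1))) t"

definition dres :: "nat \<Rightarrow> nat \<Rightarrow> nat \<Rightarrow> real" where
  "dres n N j = residue n (grid N j) - residue n (grid N (j - 1))"

lemma residue_grid: "k \<le> n \<Longrightarrow> residue n (grid n k) = 0"
  unfolding residue_def using sum_increments[of "\<lambda>i. grid n i / v (grid n i)" k] by (simp add: interp_grid)

lemma residue_0: "residue n 0 = 0"
  using residue_grid[of 0 n] by simp

lemma dres_bound:
  assumes "1 \<le> n" "1 \<le> m" "j \<in> {1..n * m}"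
  shows "\<bar>dres n (n * m) j\<bar> \<le> interp_const * real n powr - \<beta> * dq (n * m) j"
proof -
  have "hoelder_primitive \<beta> 1 (\<lambda>_. 1) (\<lambda>t. t)"
    unfolding hoelder_primitive_def by auto
  with interp_const assms have "\<bar>(grid (n * m) j / v (grid (n * m) j) - grid (n * m) (j - 1) / v (grid (n * m) (j - 1)))
     - (interp n (\<lambda>i. grid n i / v (grid n i) - grid n (i - 1) / v (grid n (i - 1))) (grid (n * m) j)
       - interp n (\<lambda>i. grid n i / v (grid n i) - grid n (i - 1) / v (grid n (i - 1))) (grid (n * m) (j - 1)))\<bar>
    \<le> interp_const * 1 * real n powr - \<beta> * dq (n * m) j" by blast
  then show ?thesis by (simp add: dres_def residue_def algebra_simps)
qed

text \<open>The drifts of the two experiments after the noise has been turned into a Brownian motion with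
  clock \<open>q\<close>; the factor \<open>sqrt n\<close> normalises the noise.\<close>

definition drift :: "nat \<Rightarrow> nat \<Rightarrow> (real \<Rightarrow> real) \<Rightarrow> nat \<Rightarrow> real" where
  "drift n N f j = sqrt (real n) * (integral {0..grid N j} f / v (grid N j) - integral {0..grid N (j - 1)} f / v (grid N (j - 1)))"

definition rsum :: "nat \<Rightarrow> (real \<Rightarrow> real) \<Rightarrow> nat \<Rightarrow> real" where
  "rsum n f i = (\<Sum>j\<in>{1..i}. f (grid n j)) / real n"

definition drift_sum :: "nat \<Rightarrow> (real \<Rightarrow> real) \<Rightarrow> nat \<Rightarrow> real" where
  "drift_sum n f i = sqrt (real n) * (rsum n f i / v (grid n i) - rsum n f (i - 1) / v (grid n (i - 1)))"

text \<open>The deterministic part of what the kernel produces: interpolated Riemann sums, and the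
  expected last partial sum times the correction. The noise of that partial sum is kept
  apart.\<close>

definition drift_kernel :: "nat \<Rightarrow> nat \<Rightarrow> (real \<Rightarrow> real) \<Rightarrow> nat \<Rightarrow> real" where
  "drift_kernel n N f j = interp n (drift_sum n f) (grid N j) - interp n (drift_sum n f) (grid N (j - 1))
     + sqrt (real n) * rsum n f n * dres n N j"

lemma rsum_shift: "1 \<le> n \<Longrightarrow> rsum n f i = f 0 * grid n i + rsum n (\<lambda>t. f t - f 0) i"
  unfolding rsum_def grid_def by (simp add: sum_subtractf diff_divide_distrib)

lemma drift_sum_bound:
  assumes f: "f \<in> hoelder_class \<alpha> L M" and \<alpha>: "0 < \<alpha>" "\<beta> \<le> \<alpha>" and L: "0 \<le> L" and i: "i \<in> {1..n}"
  shows "\<bar>drift n n f i - drift_sum n f i\<bar> \<le> sqrt (real n) * (riemann_const * L * real n powr - \<beta>) * dq n i"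
proof -
  let ?g = "\<lambda>t. f t - f 0" and ?G = "\<lambda>t. integral {0..t} f - f 0 * t"
  have n: "1 \<le> n" using i by auto
  \<comment> \<open>The constant part drops out because its Riemann sum
    \<open>f 0 * grid n k\<close> is exact at grid points.\<close>
  have *: "integral {0..grid n k} f - rsum n f k = ?G (grid n k) - (\<Sum>j\<in>{1..k}. ?g (grid n j)) / real n" for k
    using rsum_shift[OF n, of f k] by (simp add: rsum_def)
  have "drift n n f i - drift_sum n f i = sqrt (real n) * ((integral {0..grid n i} f - rsum n f i) / v (grid n i)
      - (integral {0..grid n (i - 1)} f - rsum n f (i - 1)) / v (grid n (i - 1)))"
    unfolding drift_def drift_sum_def by (simp add: algebra_simps diff_divide_distrib)
  also have "\<bar>\<dots>\<bar> = sqrt (real n) * \<bar>(integral {0..grid n i} f - rsum n f i) / v (grid n i)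
      - (integral {0..grid n (i - 1)} f - rsum n f (i - 1)) / v (grid n (i - 1))\<bar>"
    by (simp add: abs_mult)
  also have "\<dots> \<le> sqrt (real n) * (riemann_const * L * real n powr - \<beta> * dq n i)"
    unfolding * using riemann_const hoelder_class_primitive[OF f \<alpha>(1) \<beta>(1) \<alpha>(2) L] i
    by (intro mult_left_mono) (blast, simp)
  finally show ?thesis by (simp add: mult.assoc)
qed

text \<open>The multiple of \<open>t / v t\<close> that belongs to \<open>f 0\<close> is reproduced
  exactly: what the interpolant misses of it is the residue, which the correction adds back. For the
  bounded rest \<open>g\<close> there remain the interpolated Riemann error, the interpolation error
  of \<open>G / v\<close>, and the part of the correction due to the mean of \<open>g\<close>, which
  is at most \<open>L\<close>. The last two account for \<open>2 * interp_const\<close>.\<close>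

lemma drift_kernel_bound:
  assumes f: "f \<in> hoelder_class \<alpha> L M" and \<alpha>: "0 < \<alpha>" "\<beta> \<le> \<alpha>" and L: "0 \<le> L"
    and n: "1 \<le> n" and m: "1 \<le> m" and j: "j \<in> {1..n * m}"
  shows "\<bar>drift_kernel n (n * m) f j - drift n (n * m) f j\<bar>
    \<le> sqrt (real n) * ((riemann_const + 2 * interp_const) * L * real n powr - \<beta>) * dq (n * m) j"
proof -
  define g where "g t = f t - f 0" for t
  define G where "G t = integral {0..t} f - f 0 * t" for t
  let ?N = "n * m" and ?p = "real n powr - \<beta>" and ?s = "sqrt (real n)"
  let ?dI = "\<lambda>d. interp n d (grid ?N j) - interp n d (grid ?N (j - 1))"
  have prim: "hoelder_primitive \<beta> L g G"
    unfolding g_def G_def by (rule hoelder_class_primitive[OF f \<alpha>(1) \<beta>(1) \<alpha>(2) L])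
  define \<tau> where "\<tau> i = grid n i / v (grid n i) - grid n (i - 1) / v (grid n (i - 1))" for i
  define r where "r i = rsum n g i / v (grid n i) - rsum n g (i - 1) / v (grid n (i - 1))" for i
  define e where "e i = (G (grid n i) - rsum n g i) / v (grid n i) - (G (grid n (i - 1)) - rsum n g (i - 1)) / v (grid n (i - 1))" for i
  define w where "w i = G (grid n i) / v (grid n i) - G (grid n (i - 1)) / v (grid n (i - 1))" for i
  define dw where "dw = G (grid ?N j) / v (grid ?N j) - G (grid ?N (j - 1)) / v (grid ?N (j - 1))"
  have rs: "rsum n f i = f 0 * grid n i + rsum n g i" for i unfolding g_def by (rule rsum_shift[OF n])
  have "drift_sum n f = (\<lambda>i. ?s * (f 0 * \<tau> i + r i))"
    by (rule ext) (simp add: drift_sum_def rs \<tau>_def r_def add_divide_distrib algebra_simps)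
  then have E1: "?dI (drift_sum n f) = ?s * (f 0 * ?dI \<tau> + ?dI r)"
    by (simp only: interp_cmult interp_add right_diff_distrib distrib_left)
  have E2: "?dI r = ?dI w - ?dI e"
  proof -
    have "r = (\<lambda>i. w i - e i)" by (rule ext) (simp add: r_def w_def e_def diff_divide_distrib)
    then show ?thesis by (simp add: interp_diff)
  qed
  have E3: "dres n ?N j = grid ?N j / v (grid ?N j) - grid ?N (j - 1) / v (grid ?N (j - 1)) - ?dI \<tau>"
    by (simp add: dres_def residue_def \<tau>_def[abs_def])
  have E4: "drift n ?N f j = ?s * (f 0 * (grid ?N j / v (grid ?N j) - grid ?N (j - 1) / v (grid ?N (j - 1))) + dw)"
    unfolding drift_def dw_def G_def by (simp add: diff_divide_distrib algebra_simps)
  have E5: "rsum n f n = f 0 + rsum n g n" using rs[of n] n by simp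
  \<comment> \<open>Here \<open>a\<close> is \<open>f 0\<close>, and \<open>T\<close> and
    \<open>U\<close> are the interpolated and the true increment of \<open>t / v t\<close>: the
    terms \<open>a * T\<close> and \<open>a * (U - T)\<close> together cancel
    \<open>a * U\<close>.\<close>
  have "s * (a * T + (W - E)) + s * (a + R) * (U - T) - s * (a * U + D) = s * (R * (U - T) - E - (D - W))"
    for s a T W E R U D :: real by (simp add: algebra_simps)
  then have "drift_kernel n ?N f j - drift n ?N f j = ?s * (rsum n g n * dres n ?N j - ?dI e - (dw - ?dI w))"
    unfolding drift_kernel_def E1 E2 E3 E4 E5 by (simp only:)
  then have "\<bar>drift_kernel n ?N f j - drift n ?N f j\<bar> = ?s * \<bar>rsum n g n * dres n ?N j - ?dI e - (dw - ?dI w)\<bar>"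
    by (simp add: abs_mult)
  also have "\<dots> \<le> ?s * (L * (interp_const * ?p * dq ?N j) + riemann_const * L * ?p * dq ?N j + interp_const * L * ?p * dq ?N j)"
  proof (rule mult_left_mono)
    have 1: "\<bar>dw - ?dI w\<bar> \<le> interp_const * L * ?p * dq ?N j"
      unfolding dw_def w_def[abs_def] using interp_const prim n m j by blast
    have 2: "\<bar>?dI e\<bar> \<le> riemann_const * L * ?p * dq ?N j"
    proof (rule refined_grid[OF n m j])
      fix k assume k: "k \<in> {1..n}" "grid n (k - 1) \<le> grid ?N (j - 1)" "grid ?N j \<le> grid n k"
      have "grid ?N (j - 1) \<le> grid ?N j" by (intro grid_mono) simp
      then have "?dI e = e k / dq n k * (q (grid ?N j) - q (grid ?N (j - 1)))"
        using k by (intro interp_increment) auto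
      then have "?dI e = e k / dq n k * dq ?N j" unfolding dq_def[of ?N j] .
      then have "\<bar>?dI e\<bar> = \<bar>e k\<bar> / dq n k * dq ?N j"
        using dq_pos[OF k(1)] dq_pos[OF j] by (simp add: abs_mult)
      also have "\<bar>e k\<bar> / dq n k \<le> riemann_const * L * ?p"
      proof -
        have "\<bar>e k\<bar> \<le> riemann_const * L * ?p * dq n k"
          unfolding e_def rsum_def using riemann_const prim k(1) by blast
        then show ?thesis using dq_pos[OF k(1)] by (simp add: divide_le_eq)
      qed
      finally show ?thesis using dq_pos[OF j] by (simp add: mult_right_mono)
    qed
    have "\<bar>rsum n g n\<bar> \<le> L"
    proof -
      have "\<bar>\<Sum>i\<in>{1..n}. g (grid n i)\<bar> \<le> (\<Sum>i\<in>{1..n}. \<bar>g (grid n i)\<bar>)" by (rule sum_abs)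
      also have "\<dots> \<le> (\<Sum>i\<in>{1..n}. L)"
      proof (rule sum_mono)
        fix i assume "i \<in> {1..n}"
        then have "grid n i \<in> {0..1}" by (intro grid_in) auto
        then show "\<bar>g (grid n i)\<bar> \<le> L" using prim unfolding hoelder_primitive_def by blast
      qed
      finally show ?thesis using n by (simp add: rsum_def abs_divide divide_le_eq mult.commute)
    qed
    then have 3: "\<bar>rsum n g n * dres n ?N j\<bar> \<le> L * (interp_const * ?p * dq ?N j)"
      unfolding abs_mult using dres_bound[OF n m j] L by (intro mult_mono) auto
    show "\<bar>rsum n g n * dres n ?N j - ?dI e - (dw - ?dI w)\<bar>
      \<le> L * (interp_const * ?p * dq ?N j) + riemann_const * L * ?p * dq ?N j + interp_const * L * ?p * dq ?N j"
      using 1 2 3 by linarith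
  qed simp
  finally show ?thesis by (simp add: algebra_simps)
qed

text \<open>Division by the variance leaves multiples of the clock increments, which telescope; the
  bound is therefore independent of \<open>N\<close> and the same on all cylinders.\<close>

lemma weighted_norm_le:
  assumes N: "0 < N" and \<rho>: "0 \<le> \<rho>" and h: "\<And>j. j \<in> {1..N} \<Longrightarrow> \<bar>h j\<bar> \<le> \<rho> * dq N j"
  shows "sqrt (\<Sum>j\<in>{1..N}. (h j)\<^sup>2 / (sd N j)\<^sup>2) \<le> \<rho> * sqrt (q 1)"
proof -
  have "(\<Sum>j\<in>{1..N}. (h j)\<^sup>2 / (sd N j)\<^sup>2) \<le> (\<Sum>j\<in>{1..N}. \<rho>\<^sup>2 * dq N j)"
  proof (rule sum_mono)
    fix j assume j: "j \<in> {1..N}"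
    have "(h j)\<^sup>2 \<le> (\<rho> * dq N j)\<^sup>2" using h[OF j] by (rule abs_le_square_iff[THEN iffD1, OF order_trans[OF _ abs_ge_self]])
    then have "(h j)\<^sup>2 / dq N j \<le> (\<rho> * dq N j)\<^sup>2 / dq N j" using dq_pos[OF j] by (intro divide_right_mono) auto
    also have "\<dots> = \<rho>\<^sup>2 * dq N j" using dq_pos[OF j] by (simp add: power2_eq_square)
    finally show "(h j)\<^sup>2 / (sd N j)\<^sup>2 \<le> \<rho>\<^sup>2 * dq N j" by (simp add: sd_sq[OF j])
  qed
  also have "\<dots> = \<rho>\<^sup>2 * q 1" by (simp only: sum_distrib_left[symmetric] sum_dq[OF N])
  finally have "sqrt (\<Sum>j\<in>{1..N}. (h j)\<^sup>2 / (sd N j)\<^sup>2) \<le> sqrt (\<rho>\<^sup>2 * q 1)" by (rule real_sqrt_le_mono)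
  then show ?thesis using \<rho> by (simp add: real_sqrt_mult)
qed

end

subsection \<open>From the continuous to the discrete experiment\<close>

lemma tv_dist_le:
  assumes "\<And>A. A \<in> sets Q \<Longrightarrow> \<bar>measure P A - measure Q A\<bar> \<le> r"
  shows "tv_dist P Q \<le> ennreal r"
  unfolding tv_dist_def by (intro SUP_least ennreal_leI assms)

lemma deficiency_le:
  assumes "K \<in> sample_space E \<rightarrow>\<^sub>M prob_algebra (sample_space F)"
    and "\<And>\<theta>. \<theta> \<in> params E \<Longrightarrow> tv_dist (law E \<theta> \<bind> K) (law F \<theta>) \<le> r"
  shows "deficiency E F \<le> r"
  unfolding deficiency_def by (intro INF_lower2[OF assms(1)] SUP_least assms(2))

lemma measure_shift_cong_law:
  fixes \<zeta> :: "'i \<Rightarrow> 'a \<Rightarrow> real" and \<zeta>' :: "'i \<Rightarrow> 'b \<Rightarrow> real"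
  assumes law: "distr Q (\<Pi>\<^sub>M i\<in>I. borel) (\<lambda>\<omega>. \<lambda>i\<in>I. \<zeta> i \<omega>) = distr Q' (\<Pi>\<^sub>M i\<in>I. borel) (\<lambda>\<omega>. \<lambda>i\<in>I. \<zeta>' i \<omega>)"
    and \<zeta>: "\<And>i. i \<in> I \<Longrightarrow> \<zeta> i \<in> borel_measurable Q" "\<And>i. i \<in> I \<Longrightarrow> \<zeta>' i \<in> borel_measurable Q'"
    and B: "B \<in> sets (\<Pi>\<^sub>M i\<in>I. borel)"
  shows "measure Q {\<omega>\<in>space Q. (\<lambda>i\<in>I. \<zeta> i \<omega> + c i) \<in> B} = measure Q' {\<omega>\<in>space Q'. (\<lambda>i\<in>I. \<zeta>' i \<omega> + c i) \<in> B}"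
proof -
  let ?S = "{x\<in>space (\<Pi>\<^sub>M i\<in>I. borel). (\<lambda>i\<in>I. x i + c i) \<in> B}"
  have "(\<lambda>x. \<lambda>i\<in>I. x i + c i) \<in> (\<Pi>\<^sub>M i\<in>I. borel) \<rightarrow>\<^sub>M (\<Pi>\<^sub>M i\<in>I. borel)"
    by measurable
  then have S: "?S \<in> sets (\<Pi>\<^sub>M i\<in>I. borel)" using B by measurable
  have tr: "measure (distr R (\<Pi>\<^sub>M i\<in>I. borel) (\<lambda>\<omega>. \<lambda>i\<in>I. \<xi> i \<omega>)) ?S = measure R {\<omega>\<in>space R. (\<lambda>i\<in>I. \<xi> i \<omega> + c i) \<in> B}"
    if "\<And>i. i \<in> I \<Longrightarrow> \<xi> i \<in> borel_measurable R" for R :: "'c measure" and \<xi>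
    using S that
    by (subst measure_distr) (auto intro!: arg_cong[where f="measure R"] measurable_restrict simp: space_PiM cong: restrict_cong)
  show ?thesis using tr[of \<zeta> Q, OF \<zeta>(1)] tr[of \<zeta>' Q', OF \<zeta>(2)] law by simp
qed

text \<open>Fubini in the form needed when the second factor is shifted by an amount that depends on
  the first: the sections are compared for each fixed first coordinate, and the bound is then
  averaged.\<close>

lemma (in prob_space) pair_measure_diff_le:
  assumes S: "S1 \<in> sets (M \<Otimes>\<^sub>M M)" "S2 \<in> sets (M \<Otimes>\<^sub>M M)" and h: "integrable M h"
    and le: "\<And>x. x \<in> space M \<Longrightarrow> \<bar>prob (Pair x -` S1) - prob (Pair x -` S2)\<bar> \<le> h x"
  shows "\<bar>measure (M \<Otimes>\<^sub>M M) S1 - measure (M \<Otimes>\<^sub>M M) S2\<bar> \<le> expectation h"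
proof -
  interpret PP: pair_prob_space M M ..
  have sec: "integrable M (\<lambda>x. prob (Pair x -` S)) \<and> measure (M \<Otimes>\<^sub>M M) S = expectation (\<lambda>x. prob (Pair x -` S))"
    if S: "S \<in> sets (M \<Otimes>\<^sub>M M)" for S
  proof -
    have i: "integrable (M \<Otimes>\<^sub>M M) (indicator S :: _ \<Rightarrow> real)"
      using S by (intro integrable_real_indicator) (auto simp: PP.emeasure_eq_measure)
    have sect: "(LINT y|M. indicator S (x, y)) = prob (Pair x -` S)" if "x \<in> space M" for x
    proof -
      have "(LINT y|M. indicator S (x, y)) = (LINT y|M. indicator (Pair x -` S) y)"
        by (intro Bochner_Integration.integral_cong refl) (auto split: split_indicator)
      also have "\<dots> = prob (Pair x -` S)"
        using sets.sets_into_space[OF sets_Pair1[OF S, of x]] by (simp add: Int_absorb2)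
      finally show ?thesis .
    qed
    have "integrable M (\<lambda>x. LINT y|M. indicator S (x, y) :: real)"
      by (rule PP.integrable_fst'[OF i])
    then have "integrable M (\<lambda>x. prob (Pair x -` S))"
      by (rule Bochner_Integration.integrable_cong[THEN iffD1, rotated -1]) (auto simp: sect)
    moreover have "measure (M \<Otimes>\<^sub>M M) S = (LINT x|M. LINT y|M. indicator S (x, y))"
      using sets.sets_into_space[OF S] by (subst PP.integral_fst'[OF i]) (simp add: Int_absorb2)
    moreover have "\<dots> = expectation (\<lambda>x. prob (Pair x -` S))"
      by (intro Bochner_Integration.integral_cong refl sect)
    ultimately show ?thesis by simp
  qed
  have i: "integrable M (\<lambda>x. prob (Pair x -` S1) - prob (Pair x -` S2))"
    using sec[OF S(1)] sec[OF S(2)] by (intro Bochner_Integration.integrable_diff) auto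
  have "\<bar>measure (M \<Otimes>\<^sub>M M) S1 - measure (M \<Otimes>\<^sub>M M) S2\<bar> = \<bar>expectation (\<lambda>x. prob (Pair x -` S1) - prob (Pair x -` S2))\<bar>"
    using sec[OF S(1)] sec[OF S(2)] by (simp add: Bochner_Integration.integral_diff)
  also have "\<dots> \<le> expectation (\<lambda>x. \<bar>prob (Pair x -` S1) - prob (Pair x -` S2)\<bar>)"
    by (rule integral_abs_bound)
  also have "\<dots> \<le> expectation h"
    by (intro integral_mono integrable_abs i h le)
  finally show ?thesis .
qed

locale experiments = gauss_markov P \<Xi> q v + smooth_time_change q v q' v' \<beta> c v0
  for P :: "'w measure" and \<Xi> :: "real \<Rightarrow> 'w \<Rightarrow> real" and q v q' v' :: "real \<Rightarrow> real" and \<beta> c v0 :: real +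
  assumes paths: "\<And>\<omega>. \<omega> \<in> space P \<Longrightarrow> continuous_on {0..1} (\<lambda>t. \<Xi> t \<omega>)"
    and Xi_0: "AE \<omega> in P. \<Xi> 0 \<omega> = 0"
begin

abbreviation "E1 n \<alpha> L M \<equiv> experiment1 P \<Xi> n (hoelder_class \<alpha> L M)"

abbreviation "E2 n \<alpha> L M \<equiv> experiment2 P \<Xi> n (hoelder_class \<alpha> L M)"

lemma Xi_measurable: "t \<in> {0..1} \<Longrightarrow> \<Xi> t \<in> borel_measurable P"
  by (intro lin_measurable lin_Xi)

lemma X_measurable: "t \<in> {0..1} \<Longrightarrow> X t \<in> borel_measurable P"
  by (intro lin_measurable lin_X)

lemma IX_measurable: "IX n t \<in> borel_measurable P"
  by (intro lin_measurable lin_IX)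

lemma DX_measurable: "j \<in> {1..N} \<Longrightarrow> DX N j \<in> borel_measurable P"
  by (intro lin_measurable lin_DX) auto

lemma DIX_measurable: "DIX n N j \<in> borel_measurable P"
  by (intro lin_measurable lin_DIX)

lemma v_continuous: "continuous_on {0..1} v"
  using v_deriv by (intro DERIV_continuous_on) auto

lemma q_continuous: "continuous_on {0..1} q"
  using q_deriv by (intro DERIV_continuous_on) auto

lemma residue_continuous: "continuous_on {0..1} (residue n)"
  unfolding residue_def using v_nz
  by (intro continuous_intros v_continuous continuous_on_interp q_continuous) auto

definition path :: "nat \<Rightarrow> (real \<Rightarrow> real) \<Rightarrow> 'w \<Rightarrow> real \<Rightarrow> real" where
  "path n f \<omega> = (\<lambda>t\<in>{0..1}. integral {0..t} f + 1 / sqrt (real n) * \<Xi> t \<omega>)"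

definition obs :: "nat \<Rightarrow> (real \<Rightarrow> real) \<Rightarrow> 'w \<Rightarrow> nat \<Rightarrow> real" where
  "obs n f \<omega> = (\<lambda>i\<in>{1..n}. f (grid n i) + sqrt (real n) * (\<Xi> (grid n i) \<omega> - \<Xi> (grid n (i - 1)) \<omega>))"

lemma path_measurable:
  assumes "continuous_on {0..1} f"
  shows "path n f \<in> P \<rightarrow>\<^sub>M borel_C01"
proof (rule measurable_borel_C01I)
  have "continuous_on {0..1} (\<lambda>t. integral {0..t} f)"
    using assms by (intro indefinite_integral_continuous_1 integrable_continuous_real)
  then have "continuous_on {0..1} (\<lambda>t. integral {0..t} f + 1 / sqrt (real n) * \<Xi> t \<omega>)" if "\<omega> \<in> space P" for \<omega>
    by (intro continuous_intros paths that)
  then show "path n f \<omega> \<in> space borel_C01" if "\<omega> \<in> space P" for \<omega>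
    using that unfolding space_borel_C01 path_def by (auto cong: continuous_on_cong_simp)
  show "(\<lambda>\<omega>. path n f \<omega> t) \<in> borel_measurable P" if "t \<in> {0..1}" for t
    using that Xi_measurable[OF that] unfolding path_def by simp
qed

lemma obs_measurable: "obs n f \<in> P \<rightarrow>\<^sub>M (\<Pi>\<^sub>M i\<in>{1..n}. borel)"
  unfolding obs_def[abs_def]
proof (rule measurable_restrict)
  fix i assume i: "i \<in> {1..n}"
  then have "grid n i \<in> {0..1}" "grid n (i - 1) \<in> {0..1}" using grid_in[of i n] grid_in[of "i - 1" n] by auto
  from this[THEN Xi_measurable]
  show "(\<lambda>\<omega>. f (grid n i) + sqrt (real n) * (\<Xi> (grid n i) \<omega> - \<Xi> (grid n (i - 1)) \<omega>)) \<in> borel_measurable P"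
    by measurable
qed

lemma DX_shift_tv:
  assumes "0 < N" "0 \<le> \<rho>" "\<And>j. j \<in> {1..N} \<Longrightarrow> \<bar>a j - b j\<bar> \<le> \<rho> * dq N j" "B \<in> sets (\<Pi>\<^sub>M j\<in>{1..N}. borel)"
  shows "\<bar>prob {\<omega>\<in>space P. (\<lambda>j\<in>{1..N}. DX N j \<omega> + a j) \<in> B} - prob {\<omega>\<in>space P. (\<lambda>j\<in>{1..N}. DX N j \<omega> + b j) \<in> B}\<bar>
    \<le> 2 * (\<rho> * sqrt (q 1))"
  using normal_vector_shift_tv[OF finite_atLeastAtMost sd_pos assms(4) DX_measurable law_DX, of a b]
    mult_left_mono[OF weighted_norm_le[OF assms(1,2,3)], of 2] by simp

lemma deficiency_continuous_to_discrete:
  assumes \<alpha>: "0 < \<alpha>" "\<beta> \<le> \<alpha>" and L: "0 \<le> L" and n: "1 \<le> n"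
  shows "deficiency (E2 n \<alpha> L M) (E1 n \<alpha> L M)
    \<le> ennreal (2 * (sqrt (real n) * (riemann_const * L * real n powr - \<beta>) * sqrt (q 1)))"
proof -
  let ?R = "\<Pi>\<^sub>M i\<in>{1..n}. (borel :: real measure)"
  \<comment> \<open>The factor \<open>n\<close> turns the noise level \<open>1 / sqrt n\<close> into
    \<open>sqrt n\<close>, and the integral over a cell into a local average of
    \<open>f\<close>.\<close>
  define T where "T y = (\<lambda>i\<in>{1..n}. real n * (y (grid n i) - y (grid n (i - 1))))" for y :: "real \<Rightarrow> real"
  have T: "T \<in> borel_C01 \<rightarrow>\<^sub>M ?R"
    unfolding T_def[abs_def]
  proof (rule measurable_restrict)
    fix i assume i: "i \<in> {1..n}"
    then have "grid n i \<in> {0..1}" "grid n (i - 1) \<in> {0..1}" using grid_in[of i n] grid_in[of "i - 1" n] by auto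
    from this[THEN measurable_eval_C01]
    show "(\<lambda>y. real n * (y (grid n i) - y (grid n (i - 1)))) \<in> borel_measurable borel_C01" by measurable
  qed
  \<comment> \<open>Maps increments of \<open>X\<close> back to observations. The transformed path
    and the observation are both the image under \<open>\<Psi>\<close> of \<open>DX\<close> plus a
    drift, so they are no further apart than two shifted normal vectors.\<close>
  define \<Psi> where "\<Psi> x = (\<lambda>i\<in>{1..n}. sqrt (real n) * (v (grid n i) * (\<Sum>j\<in>{1..i}. x j) - v (grid n (i - 1)) * (\<Sum>j\<in>{1..i - 1}. x j)))" for x :: "nat \<Rightarrow> real"
  have \<Psi>: "\<Psi> \<in> ?R \<rightarrow>\<^sub>M ?R"
    unfolding \<Psi>_def[abs_def]
    by (intro measurable_restrict borel_measurable_times borel_measurable_diff borel_measurable_const borel_measurable_sum measurable_component_singleton) auto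
  show ?thesis
  proof (rule deficiency_le[where K="\<lambda>y. return ?R (T y)"])
    show "(\<lambda>y. return ?R (T y)) \<in> sample_space (E2 n \<alpha> L M) \<rightarrow>\<^sub>M prob_algebra (sample_space (E1 n \<alpha> L M))"
      unfolding experiment1_def experiment2_def
      using measurable_compose[OF T measurable_return_prob_space] by simp
    fix f assume "f \<in> params (E2 n \<alpha> L M)"
    then have f: "f \<in> hoelder_class \<alpha> L M" by (simp add: experiment2_def)
    note path = path_measurable[OF hoelder_class_continuous[OF f \<alpha>(1)], of n]
    have "law (E2 n \<alpha> L M) f \<bind> (\<lambda>y. return ?R (T y)) = distr P ?R (\<lambda>\<omega>. T (path n f \<omega>))"
    proof -
      have ne: "space (distr P borel_C01 (path n f)) \<noteq> {}"
        using measurable_space[OF path] not_empty by auto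
      have D: "law (E2 n \<alpha> L M) f = distr P borel_C01 (path n f)"
        by (simp add: experiment2_def path_def[abs_def])
      have "distr P borel_C01 (path n f) \<bind> (\<lambda>y. return ?R (T y)) = distr (distr P borel_C01 (path n f)) ?R T"
        using T ne by (intro bind_return_distr') auto
      also have "\<dots> = distr P ?R (\<lambda>\<omega>. T (path n f \<omega>))"
        using T path by (simp add: distr_distr comp_def)
      finally show ?thesis unfolding D .
    qed
    moreover have "law (E1 n \<alpha> L M) f = distr P ?R (obs n f)"
      by (simp add: experiment1_def obs_def[abs_def])
    moreover have "tv_dist (distr P ?R (\<lambda>\<omega>. T (path n f \<omega>))) (distr P ?R (obs n f))
      \<le> ennreal (2 * (sqrt (real n) * (riemann_const * L * real n powr - \<beta>) * sqrt (q 1)))"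
    proof (rule tv_dist_le)
      fix A assume "A \<in> sets (distr P ?R (obs n f))"
      then have A: "A \<in> sets ?R" by simp
      let ?A = "\<Psi> -` A \<inter> space ?R"
      have A': "?A \<in> sets ?R" using \<Psi> A by (rule measurable_sets)
      \<comment> \<open>The telescoping sum leaves \<open>X 0\<close> behind, so this identity, and
        with it \<open>e1\<close> and \<open>e2\<close>, is stated where \<open>\<Xi> 0\<close>
        vanishes, that is, almost surely.\<close>
      have DXs: "(\<Sum>j\<in>{1..k}. DX n j \<omega>) = X (grid n k) \<omega>" if "\<Xi> 0 \<omega> = 0" for k \<omega>
        unfolding DX_def using sum_increments[of "\<lambda>k. X (grid n k) \<omega>" k] that by (simp add: X_def)
      have dr: "(\<Sum>j\<in>{1..k}. drift n n f j) = sqrt (real n) * (integral {0..grid n k} f / v (grid n k))" for k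
        unfolding drift_def sum_distrib_left[symmetric]
        using sum_increments[of "\<lambda>k. integral {0..grid n k} f / v (grid n k)" k] by simp
      have ds: "(\<Sum>j\<in>{1..k}. drift_sum n f j) = sqrt (real n) * (rsum n f k / v (grid n k))" for k
        unfolding drift_sum_def sum_distrib_left[symmetric]
        using sum_increments[of "\<lambda>k. rsum n f k / v (grid n k)" k] by (simp add: rsum_def)
      have vX: "v (grid n k) * (X (grid n k) \<omega> + sqrt (real n) * (a / v (grid n k))) = \<Xi> (grid n k) \<omega> + sqrt (real n) * a"
        if "k \<le> n" for k \<omega> a
        using v_nz[OF grid_in[OF that]] by (simp add: X_def distrib_left)
      have nn: "sqrt (real n) * (sqrt (real n) * x) = real n * x" for x by (simp add: mult.assoc[symmetric])
      have ns: "real n * (1 / sqrt (real n) * x) = sqrt (real n) * x" for x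
      proof -
        have "real n * (1 / sqrt (real n) * x) = real n / sqrt (real n) * x" by simp
        then show ?thesis by (simp only: real_div_sqrt[OF of_nat_0_le_iff])
      qed
      have e1: "T (path n f \<omega>) = \<Psi> (\<lambda>j\<in>{1..n}. DX n j \<omega> + drift n n f j)" if "\<Xi> 0 \<omega> = 0" for \<omega>
        unfolding T_def \<Psi>_def
      proof (rule restrict_ext)
        fix i assume i: "i \<in> {1..n}"
        then have g: "grid n i \<in> {0..1}" "grid n (i - 1) \<in> {0..1}" using grid_in[of i n] grid_in[of "i - 1" n] by auto
        have s: "(\<Sum>j\<in>{1..k}. (\<lambda>j\<in>{1..n}. DX n j \<omega> + drift n n f j) j) = X (grid n k) \<omega> + sqrt (real n) * (integral {0..grid n k} f / v (grid n k))"
          if "k \<le> n" for k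
        proof -
          have "(\<Sum>j\<in>{1..k}. (\<lambda>j\<in>{1..n}. DX n j \<omega> + drift n n f j) j) = (\<Sum>j\<in>{1..k}. DX n j \<omega> + drift n n f j)"
            using that by (intro sum.cong) auto
          then show ?thesis by (simp only: sum.distrib DXs[OF \<open>\<Xi> 0 \<omega> = 0\<close>] dr)
        qed
        have "real n * (path n f \<omega> (grid n i) - path n f \<omega> (grid n (i - 1)))
          = sqrt (real n) * ((\<Xi> (grid n i) \<omega> + sqrt (real n) * integral {0..grid n i} f) - (\<Xi> (grid n (i - 1)) \<omega> + sqrt (real n) * integral {0..grid n (i - 1)} f))"
          using g by (simp only: path_def restrict_apply if_True right_diff_distrib distrib_left nn ns)
        also have "\<dots> = sqrt (real n) * (v (grid n i) * (\<Sum>j\<in>{1..i}. (\<lambda>j\<in>{1..n}. DX n j \<omega> + drift n n f j) j)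
            - v (grid n (i - 1)) * (\<Sum>j\<in>{1..i - 1}. (\<lambda>j\<in>{1..n}. DX n j \<omega> + drift n n f j) j))"
          using i by (simp only: s vX atLeastAtMost_iff diff_le_self order_trans[OF diff_le_self])
        finally show "real n * (path n f \<omega> (grid n i) - path n f \<omega> (grid n (i - 1))) = \<dots>" .
      qed
      have e2: "obs n f \<omega> = \<Psi> (\<lambda>j\<in>{1..n}. DX n j \<omega> + drift_sum n f j)" if "\<Xi> 0 \<omega> = 0" for \<omega>
        unfolding obs_def \<Psi>_def
      proof (rule restrict_ext)
        fix i assume i: "i \<in> {1..n}"
        have s: "(\<Sum>j\<in>{1..k}. (\<lambda>j\<in>{1..n}. DX n j \<omega> + drift_sum n f j) j) = X (grid n k) \<omega> + sqrt (real n) * (rsum n f k / v (grid n k))"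
          if "k \<le> n" for k
        proof -
          have "(\<Sum>j\<in>{1..k}. (\<lambda>j\<in>{1..n}. DX n j \<omega> + drift_sum n f j) j) = (\<Sum>j\<in>{1..k}. DX n j \<omega> + drift_sum n f j)"
            using that by (intro sum.cong) auto
          then show ?thesis by (simp only: sum.distrib DXs[OF \<open>\<Xi> 0 \<omega> = 0\<close>] ds)
        qed
        have "(\<Sum>j\<in>{1..i}. f (grid n j)) = (\<Sum>j\<in>{1..i - 1}. f (grid n j)) + f (grid n i)" using i by (cases i) auto
        then have "f (grid n i) = real n * (rsum n f i - rsum n f (i - 1))" using n by (simp add: rsum_def diff_divide_distrib[symmetric])
        then have "f (grid n i) + sqrt (real n) * (\<Xi> (grid n i) \<omega> - \<Xi> (grid n (i - 1)) \<omega>)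
          = sqrt (real n) * ((\<Xi> (grid n i) \<omega> + sqrt (real n) * rsum n f i) - (\<Xi> (grid n (i - 1)) \<omega> + sqrt (real n) * rsum n f (i - 1)))"
          by (simp add: right_diff_distrib distrib_left nn)
        also have "\<dots> = sqrt (real n) * (v (grid n i) * (\<Sum>j\<in>{1..i}. (\<lambda>j\<in>{1..n}. DX n j \<omega> + drift_sum n f j) j)
            - v (grid n (i - 1)) * (\<Sum>j\<in>{1..i - 1}. (\<lambda>j\<in>{1..n}. DX n j \<omega> + drift_sum n f j) j))"
          using i by (simp only: s vX atLeastAtMost_iff diff_le_self order_trans[OF diff_le_self])
        finally show "f (grid n i) + sqrt (real n) * (\<Xi> (grid n i) \<omega> - \<Xi> (grid n (i - 1)) \<omega>) = \<dots>" .
      qed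
      have DXv: "(\<lambda>\<omega>. \<lambda>j\<in>{1..n}. DX n j \<omega> + a j) \<in> P \<rightarrow>\<^sub>M ?R" for a
        by (intro measurable_restrict borel_measurable_add borel_measurable_const DX_measurable)
      have tr: "measure (distr P ?R U) A = prob {\<omega>\<in>space P. (\<lambda>j\<in>{1..n}. DX n j \<omega> + a j) \<in> ?A}"
        if U: "U \<in> P \<rightarrow>\<^sub>M ?R" and eq: "\<And>\<omega>. \<Xi> 0 \<omega> = 0 \<Longrightarrow> U \<omega> = \<Psi> (\<lambda>j\<in>{1..n}. DX n j \<omega> + a j)" for U a
      proof -
        have "measure (distr P ?R U) A = prob (U -` A \<inter> space P)" using U A by (rule measure_distr)
        also have "\<dots> = prob {\<omega>\<in>space P. (\<lambda>j\<in>{1..n}. DX n j \<omega> + a j) \<in> ?A}"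
        proof (rule finite_measure_eq_AE)
          show "AE \<omega> in P. \<omega> \<in> U -` A \<inter> space P \<longleftrightarrow> \<omega> \<in> {\<omega>\<in>space P. (\<lambda>j\<in>{1..n}. DX n j \<omega> + a j) \<in> ?A}"
            using Xi_0 by eventually_elim (auto simp: eq space_PiM)
          show "U -` A \<inter> space P \<in> events" using U A by (rule measurable_sets)
          show "{\<omega>\<in>space P. (\<lambda>j\<in>{1..n}. DX n j \<omega> + a j) \<in> ?A} \<in> events"
            using measurable_sets[OF DXv A'] by (simp add: vimage_def Int_def conj_commute)
        qed
        finally show ?thesis .
      qed
      have "\<bar>prob {\<omega>\<in>space P. (\<lambda>j\<in>{1..n}. DX n j \<omega> + drift n n f j) \<in> ?A} - prob {\<omega>\<in>space P. (\<lambda>j\<in>{1..n}. DX n j \<omega> + drift_sum n f j) \<in> ?A}\<bar>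
        \<le> 2 * (sqrt (real n) * (riemann_const * L * real n powr - \<beta>) * sqrt (q 1))"
        using n L riemann_const by (intro DX_shift_tv A' drift_sum_bound[OF f \<alpha> L]) auto
      then show "\<bar>measure (distr P ?R (\<lambda>\<omega>. T (path n f \<omega>))) A - measure (distr P ?R (obs n f)) A\<bar>
        \<le> 2 * (sqrt (real n) * (riemann_const * L * real n powr - \<beta>) * sqrt (q 1))"
        using tr[OF measurable_compose[OF path T] e1] tr[OF obs_measurable e2] by simp
    qed
    ultimately show "tv_dist (law (E2 n \<alpha> L M) f \<bind> (\<lambda>y. return ?R (T y))) (law (E1 n \<alpha> L M) f)
      \<le> ennreal (2 * (sqrt (real n) * (riemann_const * L * real n powr - \<beta>) * sqrt (q 1)))" by simp
  qed
qed

end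

subsection \<open>From the discrete to the continuous experiment\<close>

context time_change
begin

lemma interp_cong: "(\<And>i. i \<in> {1..n} \<Longrightarrow> d i = e i) \<Longrightarrow> interp n d t = interp n e t"
  unfolding interp_def by (intro sum.cong) auto

end

context experiments
begin

lemma grid_refine: "1 \<le> m \<Longrightarrow> grid (n * m) (i * m) = grid n i"
  by (simp add: grid_def)

section \<open>The randomising kernel\<close>

definition partial_mean :: "nat \<Rightarrow> (nat \<Rightarrow> real) \<Rightarrow> nat \<Rightarrow> real" where
  "partial_mean n x i = (\<Sum>j\<in>{1..i}. x j) / real n"

definition kernel_mean :: "nat \<Rightarrow> (nat \<Rightarrow> real) \<Rightarrow> real \<Rightarrow> real" where
  "kernel_mean n x t = interp n (\<lambda>i. partial_mean n x i / v (grid n i) - partial_mean n x (i - 1) / v (grid n (i - 1))) t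
     + partial_mean n x n * residue n t"

text \<open>Here \<open>\<omega>\<close> is the internal randomness of the kernel, drawn from a
  second copy of \<open>P\<close>; the root of \<open>n\<close> brings the bridge to the noise level
  of the continuous experiment.\<close>

definition kernel_path :: "nat \<Rightarrow> (nat \<Rightarrow> real) \<Rightarrow> 'w \<Rightarrow> real \<Rightarrow> real" where
  "kernel_path n x \<omega> = (\<lambda>t\<in>{0..1}. v t * (kernel_mean n x t + (X t \<omega> - IX n t \<omega>) / sqrt (real n)))"

lemma partial_mean_measurable: "i \<le> n \<Longrightarrow> (\<lambda>x. partial_mean n x i) \<in> borel_measurable (\<Pi>\<^sub>M i\<in>{1..n}. borel)"
  unfolding partial_mean_def
  by (intro borel_measurable_divide borel_measurable_const borel_measurable_sum measurable_component_singleton) auto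

lemma kernel_mean_measurable: "(\<lambda>x. kernel_mean n x t) \<in> borel_measurable (\<Pi>\<^sub>M i\<in>{1..n}. borel)"
  unfolding kernel_mean_def interp_def
  by (intro borel_measurable_add borel_measurable_times borel_measurable_diff borel_measurable_divide
      borel_measurable_const borel_measurable_sum partial_mean_measurable) auto

lemma kernel_path_measurable:
  "(\<lambda>(x, \<omega>). kernel_path n x \<omega>) \<in> (\<Pi>\<^sub>M i\<in>{1..n}. borel) \<Otimes>\<^sub>M P \<rightarrow>\<^sub>M borel_C01"
proof (rule measurable_borel_C01I)
  let ?R = "\<Pi>\<^sub>M i\<in>{1..n}. (borel :: real measure)"
  fix z assume "z \<in> space (?R \<Otimes>\<^sub>M P)"
  then obtain x \<omega> where z: "z = (x, \<omega>)" "\<omega> \<in> space P" by (auto simp: space_pair_measure)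
  have "continuous_on {0..1} (\<lambda>t. v t * (kernel_mean n x t + (X t \<omega> - IX n t \<omega>) / sqrt (real n)))"
    unfolding kernel_mean_def X_def divide_inverse[of _ "sqrt (real n)"]
    using v_nz by (intro continuous_intros v_continuous continuous_on_interp q_continuous residue_continuous paths z(2)) auto
  then show "(case z of (x, \<omega>) \<Rightarrow> kernel_path n x \<omega>) \<in> space borel_C01"
    unfolding space_borel_C01 z kernel_path_def by (auto cong: continuous_on_cong_simp)
next
  let ?R = "\<Pi>\<^sub>M i\<in>{1..n}. (borel :: real measure)"
  fix t :: real assume t: "t \<in> {0..1}"
  note [measurable] = X_measurable[OF t] IX_measurable kernel_mean_measurable
  have "(\<lambda>z. v t * (kernel_mean n (fst z) t + (X t (snd z) - IX n t (snd z)) / sqrt (real n))) \<in> borel_measurable (?R \<Otimes>\<^sub>M P)"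
    by (intro borel_measurable_times borel_measurable_add borel_measurable_diff borel_measurable_divide borel_measurable_const
        measurable_compose[OF measurable_fst kernel_mean_measurable] measurable_compose[OF measurable_snd X_measurable[OF t]]
        measurable_compose[OF measurable_snd IX_measurable])
  then show "(\<lambda>z. (case z of (x, \<omega>) \<Rightarrow> kernel_path n x \<omega>) t) \<in> borel_measurable (?R \<Otimes>\<^sub>M P)"
    using t by (simp add: kernel_path_def case_prod_beta)
qed

definition path_kernel :: "nat \<Rightarrow> (nat \<Rightarrow> real) \<Rightarrow> (real \<Rightarrow> real) measure" where
  "path_kernel n x = distr P borel_C01 (kernel_path n x)"

lemma path_kernel_measurable: "path_kernel n \<in> (\<Pi>\<^sub>M i\<in>{1..n}. borel) \<rightarrow>\<^sub>M prob_algebra borel_C01"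
  unfolding path_kernel_def[abs_def]
  by (rule measurable_distr_prob_space2[OF _ kernel_path_measurable])
     (auto simp: space_prob_algebra prob_space_axioms)

lemma kernel_path_measurable_pair:
  "(\<lambda>\<omega>. kernel_path n (obs n f (fst \<omega>)) (snd \<omega>)) \<in> P \<Otimes>\<^sub>M P \<rightarrow>\<^sub>M borel_C01"
proof -
  have "(\<lambda>\<omega>. (obs n f (fst \<omega>), snd \<omega>)) \<in> P \<Otimes>\<^sub>M P \<rightarrow>\<^sub>M (\<Pi>\<^sub>M i\<in>{1..n}. borel) \<Otimes>\<^sub>M P"
    by (intro measurable_Pair measurable_compose[OF measurable_fst obs_measurable] measurable_snd)
  from measurable_compose[OF this kernel_path_measurable] show ?thesis by simp
qed

text \<open>Realises the randomised experiment on a product space, with the noise of the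
  observations in the first factor and the randomness of the kernel in the second, so that both can
  be treated as Gaussian variables.\<close>

lemma bind_path_kernel:
  "distr P (\<Pi>\<^sub>M i\<in>{1..n}. borel) (obs n f) \<bind> path_kernel n
    = distr (P \<Otimes>\<^sub>M P) borel_C01 (\<lambda>\<omega>. kernel_path n (obs n f (fst \<omega>)) (snd \<omega>))"
proof (rule measure_eqI)
  let ?R = "\<Pi>\<^sub>M i\<in>{1..n}. (borel :: real measure)"
  let ?D = "distr P ?R (obs n f)"
  have ne: "space ?D \<noteq> {}" using measurable_space[OF obs_measurable, of _ n f] not_empty by auto
  have K: "path_kernel n \<in> ?D \<rightarrow>\<^sub>M subprob_algebra borel_C01"
    using measurable_prob_algebraD[OF path_kernel_measurable[of n]] by simp
  show "sets (?D \<bind> path_kernel n) = sets (distr (P \<Otimes>\<^sub>M P) borel_C01 (\<lambda>\<omega>. kernel_path n (obs n f (fst \<omega>)) (snd \<omega>)))"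
    using sets_bind[OF sets_kernel[OF K] ne] by simp
  fix A assume "A \<in> sets (?D \<bind> path_kernel n)"
  then have A: "A \<in> sets borel_C01" using sets_bind[OF sets_kernel[OF K] ne] by simp
  let ?h = "\<lambda>\<omega>. kernel_path n (obs n f (fst \<omega>)) (snd \<omega>)"
  have S: "?h -` A \<inter> space (P \<Otimes>\<^sub>M P) \<in> sets (P \<Otimes>\<^sub>M P)"
    using kernel_path_measurable_pair A by (rule measurable_sets)
  have "emeasure (?D \<bind> path_kernel n) A = (\<integral>\<^sup>+x. emeasure (path_kernel n x) A \<partial>?D)"
    by (rule emeasure_bind[OF ne K A])
  also have "\<dots> = (\<integral>\<^sup>+\<omega>. emeasure (path_kernel n (obs n f \<omega>)) A \<partial>P)"
    using measurable_emeasure_kernel[OF measurable_prob_algebraD[OF path_kernel_measurable] A]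
    by (intro nn_integral_distr obs_measurable) simp
  also have "\<dots> = (\<integral>\<^sup>+\<omega>. emeasure P (Pair \<omega> -` (?h -` A \<inter> space (P \<Otimes>\<^sub>M P))) \<partial>P)"
  proof (rule nn_integral_cong)
    fix \<omega> assume \<omega>: "\<omega> \<in> space P"
    have x: "obs n f \<omega> \<in> space ?R" using measurable_space[OF obs_measurable \<omega>] .
    have "kernel_path n (obs n f \<omega>) \<in> P \<rightarrow>\<^sub>M borel_C01"
      using measurable_compose[OF measurable_Pair1'[OF x] kernel_path_measurable] by simp
    then have "emeasure (path_kernel n (obs n f \<omega>)) A = emeasure P (kernel_path n (obs n f \<omega>) -` A \<inter> space P)"
      unfolding path_kernel_def using A by (rule emeasure_distr)
    also have "kernel_path n (obs n f \<omega>) -` A \<inter> space P = Pair \<omega> -` (?h -` A \<inter> space (P \<Otimes>\<^sub>M P))"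
      using \<omega> by (auto simp: space_pair_measure)
    finally show "emeasure (path_kernel n (obs n f \<omega>)) A = emeasure P (Pair \<omega> -` (?h -` A \<inter> space (P \<Otimes>\<^sub>M P)))" .
  qed
  also have "\<dots> = emeasure (P \<Otimes>\<^sub>M P) (?h -` A \<inter> space (P \<Otimes>\<^sub>M P))"
    by (rule emeasure_pair_measure_alt[OF S, symmetric])
  also have "\<dots> = emeasure (distr (P \<Otimes>\<^sub>M P) borel_C01 ?h) A"
    by (rule emeasure_distr[OF kernel_path_measurable_pair A, symmetric])
  finally show "emeasure (?D \<bind> path_kernel n) A = emeasure (distr (P \<Otimes>\<^sub>M P) borel_C01 ?h) A" .
qed

text \<open>The scaled increments \<open>pinc\<close> of \<open>y / v\<close> turn paths into vectors that have independent
  coordinates; \<open>unscale\<close> recovers the values of a path \<open>y\<close> with \<open>y 0 = 0\<close>.\<close>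

definition pinc :: "nat \<Rightarrow> nat \<Rightarrow> (real \<Rightarrow> real) \<Rightarrow> nat \<Rightarrow> real" where
  "pinc n N y j = sqrt (real n) * (y (grid N j) / v (grid N j) - y (grid N (j - 1)) / v (grid N (j - 1)))"

definition unscale :: "nat \<Rightarrow> nat \<Rightarrow> (nat \<Rightarrow> real) \<Rightarrow> nat \<Rightarrow> real" where
  "unscale n N x = (\<lambda>j\<in>{1..N}. v (grid N j) / sqrt (real n) * (\<Sum>i\<in>{1..j}. x i))"

lemma unscale_measurable: "unscale n N \<in> (\<Pi>\<^sub>M j\<in>{1..N}. borel) \<rightarrow>\<^sub>M (\<Pi>\<^sub>M j\<in>{1..N}. borel)"
  unfolding unscale_def[abs_def]
  by (intro measurable_restrict borel_measurable_times borel_measurable_const borel_measurable_sum measurable_component_singleton) auto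

lemma cylinder_iff_pinc:
  assumes n: "1 \<le> n" and y: "y \<in> space borel_C01" "y 0 = 0"
  shows "y \<in> cylinder N B \<longleftrightarrow> (\<lambda>j\<in>{1..N}. pinc n N y j) \<in> unscale n N -` B \<inter> space (\<Pi>\<^sub>M j\<in>{1..N}. borel)"
proof -
  have "unscale n N (\<lambda>j\<in>{1..N}. pinc n N y j) = (\<lambda>j\<in>{1..N}. y (real j / real N))"
    unfolding unscale_def
  proof (rule restrict_ext)
    fix j assume j: "j \<in> {1..N}"
    have "(\<Sum>i\<in>{1..j}. (\<lambda>j\<in>{1..N}. pinc n N y j) i) = (\<Sum>i\<in>{1..j}. pinc n N y i)"
      using j by (intro sum.cong) auto
    also have "\<dots> = sqrt (real n) * (y (grid N j) / v (grid N j))"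
      unfolding pinc_def sum_distrib_left[symmetric]
      using sum_increments[of "\<lambda>j. y (grid N j) / v (grid N j)" j] y(2) by simp
    finally have s: "(\<Sum>i\<in>{1..j}. (\<lambda>j\<in>{1..N}. pinc n N y j) i) = sqrt (real n) * (y (grid N j) / v (grid N j))" .
    have "v (grid N j) \<noteq> 0" using j by (intro v_nz grid_in) auto
    then show "v (grid N j) / sqrt (real n) * (\<Sum>i\<in>{1..j}. (\<lambda>j\<in>{1..N}. pinc n N y j) i) = y (real j / real N)"
      unfolding s using n by (simp add: grid_def)
  qed
  then show ?thesis unfolding cylinder_def using y by (auto simp: space_PiM)
qed

lemma pinc_path:
  assumes n: "1 \<le> n" and j: "j \<in> {1..N}"
  shows "pinc n N (path n f \<omega>) j = DX N j \<omega> + drift n N f j"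
proof -
  have g: "grid N j \<in> {0..1}" "grid N (j - 1) \<in> {0..1}" using j grid_in[of j N] grid_in[of "j - 1" N] by auto
  have s: "sqrt (real n) * ((a + 1 / sqrt (real n) * x) / w) = sqrt (real n) * (a / w) + x / w" for a x w
    using n by (simp add: add_divide_distrib distrib_left)
  have "pinc n N (path n f \<omega>) j = sqrt (real n) * ((integral {0..grid N j} f + 1 / sqrt (real n) * \<Xi> (grid N j) \<omega>) / v (grid N j))
     - sqrt (real n) * ((integral {0..grid N (j - 1)} f + 1 / sqrt (real n) * \<Xi> (grid N (j - 1)) \<omega>) / v (grid N (j - 1)))"
    using g by (simp only: pinc_def path_def restrict_apply if_True right_diff_distrib)
  then show ?thesis unfolding s by (simp add: DX_def X_def drift_def right_diff_distrib)
qed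

text \<open>In this scale the noise no longer depends on \<open>n\<close>: interpolation increments
  come from \<open>\<omega>\<close>, bridge increments from \<open>\<omega>'\<close>. The last
  partial sum brings in its own noise \<open>\<Xi> 1 \<omega>\<close>, also without a factor
  \<open>sqrt n\<close>, as a multiple of the correction.\<close>

lemma pinc_kernel_path:
  assumes n: "1 \<le> n" and j: "j \<in> {1..N}" and 0: "\<Xi> 0 \<omega> = 0"
  shows "pinc n N (kernel_path n (obs n f \<omega>) \<omega>') j
    = (DIX n N j \<omega> + (DX N j \<omega>' - DIX n N j \<omega>')) + (drift_kernel n N f j + \<Xi> 1 \<omega> * dres n N j)"
proof -
  let ?s = "sqrt (real n)"
  have nn: "?s * ?s = real n" by simp
  have spos: "?s > 0" using n by simp
  have pm: "partial_mean n (obs n f \<omega>) i = rsum n f i + \<Xi> (grid n i) \<omega> / ?s" if "i \<le> n" for i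
  proof -
    have "(\<Sum>j\<in>{1..i}. obs n f \<omega> j) = (\<Sum>j\<in>{1..i}. f (grid n j) + ?s * (\<Xi> (grid n j) \<omega> - \<Xi> (grid n (j - 1)) \<omega>))"
      using that by (intro sum.cong) (auto simp: obs_def)
    also have "\<dots> = (\<Sum>j\<in>{1..i}. f (grid n j)) + ?s * (\<Xi> (grid n i) \<omega> - \<Xi> 0 \<omega>)"
      using sum_increments[of "\<lambda>j. \<Xi> (grid n j) \<omega>" i] by (simp add: sum.distrib sum_distrib_left[symmetric])
    finally have "partial_mean n (obs n f \<omega>) i = rsum n f i + ?s * \<Xi> (grid n i) \<omega> / (?s * ?s)"
      unfolding nn by (simp add: partial_mean_def rsum_def 0 add_divide_distrib)
    moreover have "s * x / (s * s) = x / s" if "s > 0" for s x :: real using that by simp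
    ultimately show ?thesis using spos by (simp only:)
  qed
  have inc: "partial_mean n (obs n f \<omega>) i / v (grid n i) - partial_mean n (obs n f \<omega>) (i - 1) / v (grid n (i - 1))
     = 1 / ?s * (drift_sum n f i + DX n i \<omega>)" if i: "i \<in> {1..n}" for i
  proof -
    have "i \<le> n" "i - 1 \<le> n" using i by auto
    then have "partial_mean n (obs n f \<omega>) i / v (grid n i) - partial_mean n (obs n f \<omega>) (i - 1) / v (grid n (i - 1))
      = (rsum n f i + \<Xi> (grid n i) \<omega> / ?s) / v (grid n i) - (rsum n f (i - 1) + \<Xi> (grid n (i - 1)) \<omega> / ?s) / v (grid n (i - 1))"
      by (simp only: pm)
    also have "\<dots> = (rsum n f i / v (grid n i) - rsum n f (i - 1) / v (grid n (i - 1))) + (\<Xi> (grid n i) \<omega> / v (grid n i) - \<Xi> (grid n (i - 1)) \<omega> / v (grid n (i - 1))) / ?s"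
      by (simp add: add_divide_distrib diff_divide_distrib mult.commute)
    also have "\<dots> = 1 / ?s * (drift_sum n f i + DX n i \<omega>)"
      using spos by (simp add: drift_sum_def DX_def X_def distrib_left)
    finally show ?thesis .
  qed
  have km: "kernel_mean n (obs n f \<omega>) t = 1 / ?s * (interp n (drift_sum n f) t + IX n t \<omega>) + (rsum n f n + \<Xi> 1 \<omega> / ?s) * residue n t" for t
  proof -
    have "interp n (\<lambda>i. partial_mean n (obs n f \<omega>) i / v (grid n i) - partial_mean n (obs n f \<omega>) (i - 1) / v (grid n (i - 1))) t
      = interp n (\<lambda>i. 1 / ?s * (drift_sum n f i + DX n i \<omega>)) t" by (rule interp_cong) (rule inc)
    also have "\<dots> = 1 / ?s * (interp n (drift_sum n f) t + IX n t \<omega>)" by (simp only: interp_cmult interp_add)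
    finally show ?thesis using pm[of n] n by (simp add: kernel_mean_def)
  qed
  have at: "?s * (kernel_path n (obs n f \<omega>) \<omega>' t / v t) = interp n (drift_sum n f) t + IX n t \<omega> + (?s * rsum n f n + \<Xi> 1 \<omega>) * residue n t + (X t \<omega>' - IX n t \<omega>')"
    if "t \<in> {0..1}" for t
  proof -
    have "?s * (kernel_path n (obs n f \<omega>) \<omega>' t / v t) = ?s * (kernel_mean n (obs n f \<omega>) t + (X t \<omega>' - IX n t \<omega>') / ?s)"
      using that v_nz[OF that] by (simp add: kernel_path_def)
    also have "\<dots> = interp n (drift_sum n f) t + IX n t \<omega> + (?s * rsum n f n + \<Xi> 1 \<omega>) * residue n t + (X t \<omega>' - IX n t \<omega>')"
    proof -
      have "s * (1 / s * (a + b) + (r + x / s) * d + e / s) = a + b + (s * r + x) * d + e" if "s > 0" for s a b r x d e :: real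
        using that by (simp add: field_simps)
      from this[OF spos] show ?thesis unfolding km .
    qed
    finally show ?thesis .
  qed
  have g: "grid N j \<in> {0..1}" "grid N (j - 1) \<in> {0..1}" using j grid_in[of j N] grid_in[of "j - 1" N] by auto
  show ?thesis
    unfolding pinc_def right_diff_distrib at[OF g(1)] at[OF g(2)]
    by (simp add: DIX_def DX_def drift_kernel_def dres_def algebra_simps)
qed

lemma kernel_path_0: "kernel_path n x \<omega> 0 = v 0 * (X 0 \<omega> / sqrt (real n))"
  by (simp add: kernel_path_def kernel_mean_def interp_0 residue_0)

end

section \<open>The noise carried by the correction\<close>

context experiments
begin

text \<open>The bridge has zero increment over each coarse cell, so its fine increments are
  degenerate and admit no direct likelihood ratio. But adding \<open>\<kappa> * dres\<close> to the
  increments of \<open>X\<close> leaves the coarse increments unchanged, because the residue is 0 on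
  the observation grid; the interpolation stays fixed and the bridge moves by exactly that amount.
  The shift is thus the image of one for independent normal variables. The vector \<open>e\<close>
  is the interpolation noise, frozen by conditioning.\<close>

lemma interp_bridge_shift_tv:
  assumes n: "1 \<le> n" and m: "1 \<le> m" and B: "B \<in> sets (\<Pi>\<^sub>M j\<in>{1..n * m}. borel)"
  shows "\<bar>prob {\<omega>'\<in>space P. (\<lambda>j\<in>{1..n * m}. (e j + (DX (n * m) j \<omega>' - DIX n (n * m) j \<omega>')) + (a j + \<kappa> * dres n (n * m) j)) \<in> B}
     - prob {\<omega>'\<in>space P. (\<lambda>j\<in>{1..n * m}. (e j + (DX (n * m) j \<omega>' - DIX n (n * m) j \<omega>')) + a j) \<in> B}\<bar>
    \<le> 2 * (\<bar>\<kappa>\<bar> * (interp_const * real n powr - \<beta>) * sqrt (q 1))"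
proof -
  let ?N = "n * m"
  let ?R = "\<Pi>\<^sub>M j\<in>{1..?N}. (borel :: real measure)"
  \<comment> \<open>\<open>co\<close> recovers the coarse increments from the fine ones, and
    \<open>br\<close> then gives the bridge increments, so the bridge becomes a measurable function
    of a vector with independent coordinates.\<close>
  define co where "co x i = (\<Sum>j\<in>{1..i * m}. x j) - (\<Sum>j\<in>{1..(i - 1) * m}. x j)" for x :: "nat \<Rightarrow> real" and i
  define br where "br x j = x j - (interp n (co x) (grid ?N j) - interp n (co x) (grid ?N (j - 1)))" for x j
  define C where "C = {x\<in>space ?R. (\<lambda>j\<in>{1..?N}. (e j + br x j) + a j) \<in> B}"
  have co_meas: "(\<lambda>x. co x i) \<in> borel_measurable ?R" if "i \<in> {1..n}" for i
  proof -
    have k: "i * m \<le> ?N" "(i - 1) * m \<le> ?N" using that by (auto intro!: mult_right_mono)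
    show ?thesis unfolding co_def
      by (intro borel_measurable_diff borel_measurable_sum measurable_component_singleton)
         (auto intro: order_trans[OF _ k(1)] order_trans[OF _ k(2)])
  qed
  have br_meas: "(\<lambda>x. br x j) \<in> borel_measurable ?R" if "j \<in> {1..?N}" for j
    unfolding br_def interp_def using that
    by (intro borel_measurable_diff borel_measurable_sum borel_measurable_times borel_measurable_const measurable_component_singleton co_meas)
  have "(\<lambda>x. \<lambda>j\<in>{1..?N}. (e j + br x j) + a j) \<in> ?R \<rightarrow>\<^sub>M ?R"
    by (intro measurable_restrict borel_measurable_add borel_measurable_const br_meas)
  from measurable_sets[OF this B] have C: "C \<in> sets ?R"
    unfolding C_def by (simp add: vimage_def Int_def conj_commute)
  have cobr: "(\<lambda>j\<in>{1..?N}. DX ?N j \<omega> + \<mu> * dres n ?N j) \<in> C \<longleftrightarrow>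
      (\<lambda>j\<in>{1..?N}. (e j + (DX ?N j \<omega> - DIX n ?N j \<omega>)) + (a j + \<mu> * dres n ?N j)) \<in> B" for \<omega> \<mu>
  proof -
    let ?x = "\<lambda>j\<in>{1..?N}. DX ?N j \<omega> + \<mu> * dres n ?N j"
    have s: "(\<Sum>j\<in>{1..k}. ?x j) = (X (grid ?N k) \<omega> - X 0 \<omega>) + \<mu> * residue n (grid ?N k)" if "k \<le> ?N" for k
    proof -
      have "(\<Sum>j\<in>{1..k}. ?x j) = (\<Sum>j\<in>{1..k}. DX ?N j \<omega> + \<mu> * dres n ?N j)"
        using that by (intro sum.cong) auto
      also have "\<dots> = (\<Sum>j\<in>{1..k}. X (grid ?N j) \<omega> - X (grid ?N (j - 1)) \<omega>) + \<mu> * (\<Sum>j\<in>{1..k}. residue n (grid ?N j) - residue n (grid ?N (j - 1)))"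
        by (simp only: sum.distrib sum_distrib_left DX_def dres_def)
      also have "\<dots> = (X (grid ?N k) \<omega> - X 0 \<omega>) + \<mu> * residue n (grid ?N k)"
        using sum_increments[of "\<lambda>j. X (grid ?N j) \<omega>" k] sum_increments[of "\<lambda>j. residue n (grid ?N j)" k]
        by (simp add: residue_0)
      finally show ?thesis .
    qed
    \<comment> \<open>The residue vanishes at both ends of a coarse cell, so the shift leaves no
      trace in \<open>co\<close>.\<close>
    have "co ?x i = DX n i \<omega>" if i: "i \<in> {1..n}" for i
    proof -
      have k: "i * m \<le> ?N" "(i - 1) * m \<le> ?N" using i by (auto intro!: mult_right_mono)
      show ?thesis unfolding co_def s[OF k(1)] s[OF k(2)] unfolding grid_refine[OF m] DX_def
        using i residue_grid[of i n] residue_grid[of "i - 1" n, OF order_trans[OF diff_le_self]] by simp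
    qed
    then have "interp n (co ?x) t = IX n t \<omega>" for t by (rule interp_cong)
    then have "br ?x j = (DX ?N j \<omega> - DIX n ?N j \<omega>) + \<mu> * dres n ?N j" if "j \<in> {1..?N}" for j
      using that by (simp add: br_def DIX_def)
    then have "(\<lambda>j\<in>{1..?N}. (e j + br ?x j) + a j) = (\<lambda>j\<in>{1..?N}. (e j + (DX ?N j \<omega> - DIX n ?N j \<omega>)) + (a j + \<mu> * dres n ?N j))"
      by (intro restrict_ext) simp
    moreover have "?x \<in> space ?R" by (simp add: space_PiM)
    ultimately show ?thesis by (simp only: C_def mem_Collect_eq simp_thms)
  qed
  have "\<bar>prob {\<omega>\<in>space P. (\<lambda>j\<in>{1..?N}. DX ?N j \<omega> + \<kappa> * dres n ?N j) \<in> C} - prob {\<omega>\<in>space P. (\<lambda>j\<in>{1..?N}. DX ?N j \<omega> + 0 * dres n ?N j) \<in> C}\<bar>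
    \<le> 2 * (\<bar>\<kappa>\<bar> * (interp_const * real n powr - \<beta>) * sqrt (q 1))"
  proof (rule DX_shift_tv[OF _ _ _ C])
    show "0 < ?N" using n m by simp
    show "0 \<le> \<bar>\<kappa>\<bar> * (interp_const * real n powr - \<beta>)" using interp_const by simp
    fix j assume j: "j \<in> {1..?N}"
    have "\<bar>\<kappa> * dres n ?N j - 0 * dres n ?N j\<bar> = \<bar>\<kappa>\<bar> * \<bar>dres n ?N j\<bar>" by (simp add: abs_mult)
    also have "\<dots> \<le> \<bar>\<kappa>\<bar> * (interp_const * real n powr - \<beta> * dq ?N j)"
      by (intro mult_left_mono dres_bound n m j) simp
    finally show "\<bar>\<kappa> * dres n ?N j - 0 * dres n ?N j\<bar> \<le> \<bar>\<kappa>\<bar> * (interp_const * real n powr - \<beta>) * dq ?N j"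
      by (simp add: mult.assoc)
  qed
  then show ?thesis unfolding cobr by simp
qed

text \<open>The first summand pays for the noise \<open>\<Xi> 1\<close> in the correction, the
  second for the drift error. The root of \<open>q 1\<close> comes from
  \<open>weighted_norm_le\<close>, the factor 2 in front from the total variation bound for
  shifts.\<close>

definition rate_const :: "real \<Rightarrow> real" where
  "rate_const L = 2 * sqrt (q 1) * (interp_const * expectation (\<lambda>\<omega>. \<bar>\<Xi> 1 \<omega>\<bar>) + (riemann_const + 2 * interp_const) * L)"

text \<open>The comparison passes through the event \<open>S2\<close>, in which the random part of
  the correction is dropped. Given the first factor, that part only shifts the bridge; once it is
  gone, the noise has the law of \<open>DX\<close> and only the drifts differ.\<close>

lemma cylinder_tv:
  assumes f: "f \<in> hoelder_class \<alpha> L M" and \<alpha>: "0 < \<alpha>" "\<beta> \<le> \<alpha>" and L: "0 \<le> L"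
    and n: "1 \<le> n" and m: "1 \<le> m" and B: "B \<in> sets (\<Pi>\<^sub>M j\<in>{1..n * m}. borel)"
  shows "\<bar>measure (distr (P \<Otimes>\<^sub>M P) borel_C01 (\<lambda>\<omega>. kernel_path n (obs n f (fst \<omega>)) (snd \<omega>))) (cylinder (n * m) B)
      - measure (distr P borel_C01 (path n f)) (cylinder (n * m) B)\<bar>
    \<le> rate_const L * (sqrt (real n) * real n powr - \<beta>)"
proof -
  interpret PP: pair_prob_space P P ..
  let ?N = "n * m"
  let ?R = "\<Pi>\<^sub>M j\<in>{1..?N}. (borel :: real measure)"
  let ?PP = "P \<Otimes>\<^sub>M P"
  define B' where "B' = unscale n ?N -` B \<inter> space ?R"
  have B': "B' \<in> sets ?R" unfolding B'_def using unscale_measurable B by (rule measurable_sets)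
  have cyl: "cylinder ?N B \<in> sets borel_C01" by (rule cylinder_in_sets[OF B])
  define \<zeta> where "\<zeta> j \<omega> = DIX n ?N j (fst \<omega>) + (DX ?N j (snd \<omega>) - DIX n ?N j (snd \<omega>))" for j \<omega>
  define a where "a = drift_kernel n ?N f"
  define d where "d = dres n ?N"
  have \<zeta>: "\<zeta> j \<in> borel_measurable ?PP" if "j \<in> {1..?N}" for j
    unfolding \<zeta>_def[abs_def]
    by (intro borel_measurable_add borel_measurable_diff measurable_compose[OF measurable_fst DIX_measurable]
        measurable_compose[OF measurable_snd DIX_measurable] measurable_compose[OF measurable_snd DX_measurable] that)
  have Xi1: "\<Xi> 1 \<in> borel_measurable P" by (intro Xi_measurable) simp
  have Xi1f: "(\<lambda>\<omega>. \<Xi> 1 (fst \<omega>)) \<in> borel_measurable ?PP" by (rule measurable_compose[OF measurable_fst Xi1])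
  define S1 where "S1 = {\<omega>\<in>space ?PP. (\<lambda>j\<in>{1..?N}. \<zeta> j \<omega> + (a j + \<Xi> 1 (fst \<omega>) * d j)) \<in> B'}"
  define S2 where "S2 = {\<omega>\<in>space ?PP. (\<lambda>j\<in>{1..?N}. \<zeta> j \<omega> + a j) \<in> B'}"
  have "(\<lambda>\<omega>. \<lambda>j\<in>{1..?N}. \<zeta> j \<omega> + (a j + \<Xi> 1 (fst \<omega>) * d j)) \<in> ?PP \<rightarrow>\<^sub>M ?R"
    by (intro measurable_restrict borel_measurable_add borel_measurable_times borel_measurable_const \<zeta> Xi1f)
  from measurable_sets[OF this B'] have S1: "S1 \<in> sets ?PP" unfolding S1_def by (simp add: vimage_def Int_def conj_commute)
  have "(\<lambda>\<omega>. \<lambda>j\<in>{1..?N}. \<zeta> j \<omega> + a j) \<in> ?PP \<rightarrow>\<^sub>M ?R"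
    by (intro measurable_restrict borel_measurable_add borel_measurable_const \<zeta>)
  from measurable_sets[OF this B'] have S2: "S2 \<in> sets ?PP" unfolding S2_def by (simp add: vimage_def Int_def conj_commute)
  have step1: "\<bar>measure ?PP S1 - measure ?PP S2\<bar>
    \<le> expectation (\<lambda>\<omega>. 2 * (\<bar>\<Xi> 1 \<omega>\<bar> * (interp_const * real n powr - \<beta>) * sqrt (q 1)))"
  proof (rule pair_measure_diff_le[OF S1 S2])
    have "integrable P (\<Xi> 1)" by (intro lin_integrable lin_Xi) simp
    then show "integrable P (\<lambda>\<omega>. 2 * (\<bar>\<Xi> 1 \<omega>\<bar> * (interp_const * real n powr - \<beta>) * sqrt (q 1)))"
      by (intro integrable_mult_right integrable_mult_left integrable_abs)
    fix \<omega> assume \<omega>: "\<omega> \<in> space P"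
    have "Pair \<omega> -` S1 = {\<omega>'\<in>space P. (\<lambda>j\<in>{1..?N}. (DIX n ?N j \<omega> + (DX ?N j \<omega>' - DIX n ?N j \<omega>')) + (a j + \<Xi> 1 \<omega> * dres n ?N j)) \<in> B'}"
      using \<omega> by (auto simp: S1_def \<zeta>_def d_def space_pair_measure)
    moreover have "Pair \<omega> -` S2 = {\<omega>'\<in>space P. (\<lambda>j\<in>{1..?N}. (DIX n ?N j \<omega> + (DX ?N j \<omega>' - DIX n ?N j \<omega>')) + a j) \<in> B'}"
      using \<omega> by (auto simp: S2_def \<zeta>_def space_pair_measure)
    ultimately show "\<bar>prob (Pair \<omega> -` S1) - prob (Pair \<omega> -` S2)\<bar> \<le> 2 * (\<bar>\<Xi> 1 \<omega>\<bar> * (interp_const * real n powr - \<beta>) * sqrt (q 1))"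
      using interp_bridge_shift_tv[OF n m B', of "\<lambda>j. DIX n ?N j \<omega>" a "\<Xi> 1 \<omega>"] by simp
  qed
  have law: "distr ?PP ?R (\<lambda>\<omega>. \<lambda>j\<in>{1..?N}. \<zeta> j \<omega>) = distr P ?R (\<lambda>\<omega>. \<lambda>j\<in>{1..?N}. DX ?N j \<omega>)"
    unfolding law_DX \<zeta>_def by (rule law_DIX_residual)
  have "measure ?PP S2 = prob {\<omega>\<in>space P. (\<lambda>j\<in>{1..?N}. DX ?N j \<omega> + a j) \<in> B'}"
    unfolding S2_def by (rule measure_shift_cong_law[OF law \<zeta> DX_measurable B'])
  then have step2: "\<bar>measure ?PP S2 - prob {\<omega>\<in>space P. (\<lambda>j\<in>{1..?N}. DX ?N j \<omega> + drift n ?N f j) \<in> B'}\<bar>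
     \<le> 2 * ((sqrt (real n) * ((riemann_const + 2 * interp_const) * L * real n powr - \<beta>)) * sqrt (q 1))"
    using DX_shift_tv[of ?N "sqrt (real n) * ((riemann_const + 2 * interp_const) * L * real n powr - \<beta>)" a "drift n ?N f", OF _ _ _ B']
      drift_kernel_bound[OF f \<alpha> L n m] n m L interp_const riemann_const by (simp add: a_def)
  have m1: "measure (distr ?PP borel_C01 (\<lambda>\<omega>. kernel_path n (obs n f (fst \<omega>)) (snd \<omega>))) (cylinder ?N B) = measure ?PP S1"
  proof -
    let ?h = "\<lambda>\<omega>. kernel_path n (obs n f (fst \<omega>)) (snd \<omega>)"
    have "measure (distr ?PP borel_C01 ?h) (cylinder ?N B) = measure ?PP (?h -` cylinder ?N B \<inter> space ?PP)"
      by (rule measure_distr[OF kernel_path_measurable_pair cyl])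
    also have "\<dots> = measure ?PP S1"
    proof (rule PP.finite_measure_eq_AE)
      have X0: "\<Xi> 0 \<in> borel_measurable P" by (intro Xi_measurable) simp
      have X0f: "(\<lambda>\<omega>. \<Xi> 0 (fst \<omega>)) \<in> borel_measurable ?PP" "(\<lambda>\<omega>. \<Xi> 0 (snd \<omega>)) \<in> borel_measurable ?PP"
        by (rule measurable_compose[OF measurable_fst X0], rule measurable_compose[OF measurable_snd X0])
      \<comment> \<open>Both factors must start at 0: the kernel path starts at a multiple of
        \<open>X 0\<close> in the second factor, and the partial sums of the observations involve
        \<open>\<Xi> 0\<close> in the first.\<close>
      have "AE \<omega> in ?PP. \<Xi> 0 (fst \<omega>) = 0 \<and> \<Xi> 0 (snd \<omega>) = 0"
      proof (rule PP.AE_pair_measure)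
        show "{\<omega>\<in>space ?PP. \<Xi> 0 (fst \<omega>) = 0 \<and> \<Xi> 0 (snd \<omega>) = 0} \<in> sets ?PP"
          using X0f by measurable
        show "AE x in P. AE y in P. \<Xi> 0 (fst (x, y)) = 0 \<and> \<Xi> 0 (snd (x, y)) = 0"
          using Xi_0 by eventually_elim (use Xi_0 in simp)
      qed
      moreover have "AE \<omega> in ?PP. \<omega> \<in> space ?PP" by (rule AE_space)
      ultimately show "AE \<omega> in ?PP. \<omega> \<in> ?h -` cylinder ?N B \<inter> space ?PP \<longleftrightarrow> \<omega> \<in> S1"
      proof eventually_elim
        fix \<omega> assume 0: "\<Xi> 0 (fst \<omega>) = 0 \<and> \<Xi> 0 (snd \<omega>) = 0" and \<omega>: "\<omega> \<in> space ?PP"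
        have "?h \<omega> \<in> space borel_C01" using measurable_space[OF kernel_path_measurable_pair \<omega>] .
        moreover have "?h \<omega> 0 = 0" using 0 by (simp add: kernel_path_0 X_def)
        ultimately have "?h \<omega> \<in> cylinder ?N B \<longleftrightarrow> (\<lambda>j\<in>{1..?N}. pinc n ?N (?h \<omega>) j) \<in> B'"
          unfolding B'_def by (rule cylinder_iff_pinc[OF n])
        also have "(\<lambda>j\<in>{1..?N}. pinc n ?N (?h \<omega>) j) = (\<lambda>j\<in>{1..?N}. \<zeta> j \<omega> + (a j + \<Xi> 1 (fst \<omega>) * d j))"
          unfolding \<zeta>_def a_def d_def using 0 by (intro restrict_ext pinc_kernel_path[OF n]) auto
        finally show "\<omega> \<in> ?h -` cylinder ?N B \<inter> space ?PP \<longleftrightarrow> \<omega> \<in> S1" using \<omega> unfolding S1_def by blast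
      qed
      show "?h -` cylinder ?N B \<inter> space ?PP \<in> sets ?PP" using kernel_path_measurable_pair cyl by (rule measurable_sets)
    qed (rule S1)
    finally show ?thesis .
  qed
  note pathm = path_measurable[OF hoelder_class_continuous[OF f \<alpha>(1)], of n]
  have m2: "measure (distr P borel_C01 (path n f)) (cylinder ?N B) = prob {\<omega>\<in>space P. (\<lambda>j\<in>{1..?N}. DX ?N j \<omega> + drift n ?N f j) \<in> B'}"
  proof -
    have "measure (distr P borel_C01 (path n f)) (cylinder ?N B) = prob (path n f -` cylinder ?N B \<inter> space P)"
      by (rule measure_distr[OF pathm cyl])
    also have "\<dots> = prob {\<omega>\<in>space P. (\<lambda>j\<in>{1..?N}. DX ?N j \<omega> + drift n ?N f j) \<in> B'}"
    proof (rule finite_measure_eq_AE)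
      have "AE \<omega> in P. \<omega> \<in> space P" by (rule AE_space)
      with Xi_0 show "AE \<omega> in P. \<omega> \<in> path n f -` cylinder ?N B \<inter> space P \<longleftrightarrow> \<omega> \<in> {\<omega>\<in>space P. (\<lambda>j\<in>{1..?N}. DX ?N j \<omega> + drift n ?N f j) \<in> B'}"
      proof eventually_elim
        fix \<omega> assume 0: "\<Xi> 0 \<omega> = 0" and \<omega>: "\<omega> \<in> space P"
        have "path n f \<omega> \<in> space borel_C01" using measurable_space[OF pathm \<omega>] .
        moreover have "path n f \<omega> 0 = 0" using 0 by (simp add: path_def)
        ultimately have "path n f \<omega> \<in> cylinder ?N B \<longleftrightarrow> (\<lambda>j\<in>{1..?N}. pinc n ?N (path n f \<omega>) j) \<in> B'"
          unfolding B'_def by (rule cylinder_iff_pinc[OF n])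
        also have "(\<lambda>j\<in>{1..?N}. pinc n ?N (path n f \<omega>) j) = (\<lambda>j\<in>{1..?N}. DX ?N j \<omega> + drift n ?N f j)"
          by (intro restrict_ext pinc_path[OF n])
        finally show "\<omega> \<in> path n f -` cylinder ?N B \<inter> space P \<longleftrightarrow> \<omega> \<in> {\<omega>\<in>space P. (\<lambda>j\<in>{1..?N}. DX ?N j \<omega> + drift n ?N f j) \<in> B'}"
          using \<omega> by blast
      qed
      show "path n f -` cylinder ?N B \<inter> space P \<in> events" using pathm cyl by (rule measurable_sets)
      have "(\<lambda>\<omega>. \<lambda>j\<in>{1..?N}. DX ?N j \<omega> + drift n ?N f j) \<in> P \<rightarrow>\<^sub>M ?R"
        by (intro measurable_restrict borel_measurable_add borel_measurable_const DX_measurable)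
      from measurable_sets[OF this B'] show "{\<omega>\<in>space P. (\<lambda>j\<in>{1..?N}. DX ?N j \<omega> + drift n ?N f j) \<in> B'} \<in> events"
        by (simp add: vimage_def Int_def conj_commute)
    qed
    finally show ?thesis .
  qed
  let ?E = "expectation (\<lambda>\<omega>. \<bar>\<Xi> 1 \<omega>\<bar>)" and ?p = "real n powr - \<beta>" and ?s = "sqrt (real n)" and ?Q = "sqrt (q 1)"
  have "expectation (\<lambda>\<omega>. 2 * (\<bar>\<Xi> 1 \<omega>\<bar> * (interp_const * ?p) * ?Q)) = 2 * ?Q * interp_const * ?E * ?p"
    by simp
  also have "\<dots> \<le> 2 * ?Q * interp_const * ?E * (?s * ?p)"
  proof (rule mult_left_mono)
    \<comment> \<open>The first comparison carries no factor \<open>sqrt n\<close>; it is put under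
      the common rate because \<open>sqrt n\<close> is at least 1.\<close>
    have "1 * ?p \<le> ?s * ?p" using n by (intro mult_right_mono) auto
    then show "?p \<le> ?s * ?p" by simp
    show "0 \<le> 2 * ?Q * interp_const * ?E"
      using interp_const q_nonneg[of 1] by (intro mult_nonneg_nonneg integral_nonneg) auto
  qed
  finally have "\<bar>measure ?PP S1 - measure ?PP S2\<bar> \<le> 2 * ?Q * interp_const * ?E * (?s * ?p)"
    using step1 by linarith
  with step2 have "\<bar>measure ?PP S1 - prob {\<omega>\<in>space P. (\<lambda>j\<in>{1..?N}. DX ?N j \<omega> + drift n ?N f j) \<in> B'}\<bar>
    \<le> 2 * ?Q * interp_const * ?E * (?s * ?p) + 2 * ((?s * ((riemann_const + 2 * interp_const) * L * ?p)) * ?Q)"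
    by linarith
  also have "\<dots> = rate_const L * (?s * ?p)" by (simp add: rate_const_def algebra_simps)
  finally show ?thesis unfolding m1 m2 .
qed

lemma deficiency_discrete_to_continuous:
  assumes \<alpha>: "0 < \<alpha>" "\<beta> \<le> \<alpha>" and L: "0 \<le> L" and n: "1 \<le> n"
  shows "deficiency (E1 n \<alpha> L M) (E2 n \<alpha> L M)
    \<le> ennreal (rate_const L * (sqrt (real n) * real n powr - \<beta>))"
proof (rule deficiency_le[where K="path_kernel n"])
  interpret PP: pair_prob_space P P ..
  show "path_kernel n \<in> sample_space (E1 n \<alpha> L M) \<rightarrow>\<^sub>M
      prob_algebra (sample_space (E2 n \<alpha> L M))"
    using path_kernel_measurable[of n] by (simp add: experiment1_def experiment2_def)
  fix f assume "f \<in> params (E1 n \<alpha> L M)"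
  then have f: "f \<in> hoelder_class \<alpha> L M" by (simp add: experiment1_def)
  note pathm = path_measurable[OF hoelder_class_continuous[OF f \<alpha>(1)], of n]
  let ?h = "\<lambda>\<omega>. kernel_path n (obs n f (fst \<omega>)) (snd \<omega>)"
  have l1: "law (E1 n \<alpha> L M) f = distr P (\<Pi>\<^sub>M i\<in>{1..n}. borel) (obs n f)"
    by (simp add: experiment1_def obs_def[abs_def])
  have l2: "law (E2 n \<alpha> L M) f = distr P borel_C01 (path n f)"
    by (simp add: experiment2_def path_def[abs_def])
  show "tv_dist (law (E1 n \<alpha> L M) f \<bind> path_kernel n) (law (E2 n \<alpha> L M) f)
    \<le> ennreal (rate_const L * (sqrt (real n) * real n powr - \<beta>))"
    unfolding l1 l2 bind_path_kernel
  proof (rule tv_dist_le)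
    fix A assume "A \<in> sets (distr P borel_C01 (path n f))"
    then have A: "A \<in> sigma_sets (space borel_C01) (cylinders n)"
      using sets_borel_C01_cylinders[OF n] by simp
    show "\<bar>measure (distr (P \<Otimes>\<^sub>M P) borel_C01 ?h) A - measure (distr P borel_C01 (path n f)) A\<bar>
      \<le> rate_const L * (sqrt (real n) * real n powr - \<beta>)"
    proof (rule tv_bound_from_algebra[OF algebra_cylinders[OF n] _ _ _ _ _ A])
      show "finite_measure (distr (P \<Otimes>\<^sub>M P) borel_C01 ?h)"
        by (rule PP.finite_measure_distr[OF kernel_path_measurable_pair])
      show "finite_measure (distr P borel_C01 (path n f))"
        by (rule finite_measure_distr[OF pathm])
      show "sets (distr (P \<Otimes>\<^sub>M P) borel_C01 ?h) = sigma_sets (space borel_C01) (cylinders n)"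
        "sets (distr P borel_C01 (path n f)) = sigma_sets (space borel_C01) (cylinders n)"
        using sets_borel_C01_cylinders[OF n] by simp_all
      fix U assume "U \<in> cylinders n"
      then obtain m B where "1 \<le> m" "B \<in> sets (\<Pi>\<^sub>M j\<in>{1..n * m}. borel)" "U = cylinder (n * m) B"
        by (auto simp: cylinders_def)
      then show "\<bar>measure (distr (P \<Otimes>\<^sub>M P) borel_C01 ?h) U - measure (distr P borel_C01 (path n f)) U\<bar>
        \<le> rate_const L * (sqrt (real n) * real n powr - \<beta>)"
        using cylinder_tv[OF f \<alpha> L n] by blast
    qed
  qed
qed

lemma le_cam_dist_tendsto:
  assumes \<alpha>: "0 < \<alpha>" "\<beta> \<le> \<alpha>" and L: "0 \<le> L" and half: "1 / 2 < \<beta>"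
  shows "(\<lambda>n. le_cam_dist (E1 n \<alpha> L M) (E2 n \<alpha> L M)) \<longlonglongrightarrow> 0"
proof (rule tendsto_sandwich)
  let ?r = "\<lambda>n. rate_const L * (sqrt (real n) * real n powr - \<beta>)"
  show "\<forall>\<^sub>F n in sequentially. 0 \<le> le_cam_dist (E1 n \<alpha> L M) (E2 n \<alpha> L M)"
    by simp
  show "\<forall>\<^sub>F n in sequentially. le_cam_dist (E1 n \<alpha> L M) (E2 n \<alpha> L M) \<le> ennreal (?r n)"
    using eventually_ge_at_top[of 1]
  proof eventually_elim
    fix n :: nat assume n: "1 \<le> n"
    have "2 * (sqrt (real n) * (riemann_const * L * real n powr - \<beta>) * sqrt (q 1)) = (2 * sqrt (q 1) * (riemann_const * L)) * (sqrt (real n) * real n powr - \<beta>)"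
      by simp
    \<comment> \<open>\<open>rate_const\<close> also dominates the other deficiency: its summands
      are nonnegative and contain \<open>riemann_const * L\<close>.\<close>
    also have "\<dots> \<le> ?r n"
      unfolding rate_const_def using interp_const riemann_const L q_nonneg[of 1]
      by (intro mult_right_mono mult_left_mono) (auto simp: algebra_simps intro!: add_nonneg_nonneg mult_nonneg_nonneg integral_nonneg)
    finally have "2 * (sqrt (real n) * (riemann_const * L * real n powr - \<beta>) * sqrt (q 1)) \<le> ?r n" .
    then show "le_cam_dist (E1 n \<alpha> L M) (E2 n \<alpha> L M) \<le> ennreal (?r n)"
      unfolding le_cam_dist_def
      by (intro max.boundedI deficiency_discrete_to_continuous[OF \<alpha> L n]
          order_trans[OF deficiency_continuous_to_discrete[OF \<alpha> L n]] ennreal_leI)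
  qed
  have "(\<lambda>n. real n powr (1 / 2 - \<beta>)) \<longlonglongrightarrow> 0"
    using half by (intro tendsto_neg_powr filterlim_real_sequentially) auto
  moreover have "sqrt (real n) * real n powr - \<beta> = real n powr (1 / 2 - \<beta>)" for n
    by (simp add: powr_half_sqrt[symmetric] powr_add[symmetric])
  ultimately have "?r \<longlonglongrightarrow> rate_const L * 0" by (intro tendsto_mult tendsto_const) simp
  then have "(\<lambda>n. ennreal (?r n)) \<longlonglongrightarrow> ennreal 0" by (intro tendsto_ennrealI) simp
  then show "(\<lambda>n. ennreal (?r n)) \<longlonglongrightarrow> 0" by simp
qed simp

end

section \<open>From the hypotheses to the setting of the estimates\<close>

theorem theorem4p5:
  fixes P :: "'w measure" and \<Xi> :: "real \<Rightarrow> 'w \<Rightarrow> real"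
    and u v q v' q' :: "real \<Rightarrow> real"
    and \<alpha> L C \<gamma> :: real and M :: ereal
  assumes "prob_space P"
    and "gauss_markov_process P {0..1} \<Xi>"
    and "\<forall>\<omega>\<in>space P. continuous_on {0..1} (\<lambda>t. \<Xi> t \<omega>)"
    and "\<forall>t\<in>{0..1}. (\<integral>\<omega>. \<Xi> t \<omega> \<partial>P) = 0"
    and "AE \<omega> in P. \<Xi> 0 \<omega> = 0"
    and "\<forall>t\<in>{0<..<1}. covariance P (\<Xi> t) (\<Xi> t) > 0"
    and "\<forall>s t. 0 \<le> s \<and> s \<le> t \<and> t \<le> 1 \<longrightarrow> covariance P (\<Xi> s) (\<Xi> t) = u s * v t"
    and "\<forall>t\<in>{0..1}. q t = u t / v t"
    and "1/2 < \<alpha>" "\<alpha> \<le> 1" "0 < L" "0 < M"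
    and "\<forall>t\<in>{0..1}. (q has_real_derivative q' t) (at t within {0..1})"
    and "continuous_on {0..1} q'"
    and "0 < (INF t\<in>{0..1}. q' t)"
    and "(SUP t\<in>{0..1}. q' t) \<le> C"
    and "0 < (INF t\<in>{0..1}. v t)"
    and "\<forall>t\<in>{0..1}. (v has_real_derivative v' t) (at t within {0..1})"
    and "1/2 < \<gamma>" "hoelder_on {0..1} \<gamma> v'" "hoelder_on {0..1} \<gamma> q'"
  shows "(M < \<infinity> \<longrightarrow>
           (\<lambda>n. le_cam_dist (experiment1 P \<Xi> n (hoelder_class \<alpha> L M))
                            (experiment2 P \<Xi> n (hoelder_class \<alpha> L M))) \<longlonglongrightarrow> 0) \<and>
         ((\<exists>c. \<forall>t\<in>{0..1}. v t * q' t = c) \<longrightarrow> M = \<infinity> \<longrightarrow>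
           (\<lambda>n. le_cam_dist (experiment1 P \<Xi> n (hoelder_class \<alpha> L M))
                            (experiment2 P \<Xi> n (hoelder_class \<alpha> L M))) \<longlonglongrightarrow> 0)"
proof -
  \<comment> \<open>A single exponent for \<open>f\<close>, \<open>v'\<close> and \<open>q'\<close>;
    the minimum with \<alpha> also ensures \<beta> \<le> 1, as \<gamma> may exceed 1.\<close>
  define \<beta> where "\<beta> = min \<alpha> \<gamma>"
  have exponent: "1 / 2 < \<beta>" "\<beta> \<le> \<alpha>" "\<beta> \<le> \<gamma>" "\<beta> \<le> 1" "0 < \<beta>"
    using assms(9,10,19) by (auto simp: \<beta>_def)
  define c where "c = (INF t\<in>{0..1}. q' t)"
  define v0 where "v0 = (INF t\<in>{0..1}. v t)"
  have vc: "continuous_on {0..1} v"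
    using assms(18) by (intro DERIV_continuous_on) auto
  \<comment> \<open>Continuity on the compact interval bounds the function below; only then is the
    infimum a lower bound for its values. The same is done for \<open>v\<close>.\<close>
  have c: "0 < c" "c \<le> q' t" if "t \<in> {0..1}" for t
    using assms(15) that
    by (auto simp: c_def intro!: cINF_lower bounded_imp_bdd_below compact_imp_bounded compact_continuous_image assms(14))
  have v0: "0 < v0" "v0 \<le> v t" if "t \<in> {0..1}" for t
    using assms(17) that
    by (auto simp: v0_def intro!: cINF_lower bounded_imp_bdd_below compact_imp_bounded compact_continuous_image vc)
  have cov: "(\<integral>\<omega>. \<Xi> s \<omega> * \<Xi> t \<omega> \<partial>P) = q s * v s * v t" if st: "0 \<le> s" "s \<le> t" "t \<le> 1" for s t
  proof -
    have "covariance P (\<Xi> s) (\<Xi> t) = (\<integral>\<omega>. \<Xi> s \<omega> * \<Xi> t \<omega> \<partial>P)"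
      using assms(4) st by (simp add: covariance_def)
    moreover have "u s = q s * v s" using assms(8) v0[of s] st by auto
    ultimately show ?thesis using assms(7) st by simp
  qed
  have q0: "q 0 = 0"
  proof -
    have "q 0 * v 0 * v 0 = (\<integral>\<omega>. \<Xi> 0 \<omega> * \<Xi> 0 \<omega> \<partial>P)" using cov[of 0 0] by simp
    also have "\<dots> = 0" using assms(5) by (intro integral_eq_zero_AE) auto
    finally show ?thesis using v0[of 0] by simp
  qed
  have q_less: "q s < q t" if st: "0 \<le> s" "s < t" "t \<le> 1" for s t
  proof -
    have id: "((\<lambda>x. x) has_real_derivative 1) (at x within {0..1})" for x :: real by (rule DERIV_ident)
    obtain x where x: "x \<in> {s..t}" "q t - q s = q' x / 1 * (t - s)"
      using cauchy_mvt[OF _ id _ st, of q q'] assms(13) by auto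
    have "0 < q' x" using c[of x] x(1) st by auto
    then have "0 < q' x * (t - s)" using st by simp
    then show ?thesis using x(2) by simp
  qed
  have gp: "gaussian_process P {0..1} \<Xi>" using assms(2) by (simp add: gauss_markov_process_def)
  interpret prob_space P by fact
  interpret experiments P \<Xi> q v q' v' \<beta> c v0
  proof
    show "hoelder_on {0..1} \<beta> q'" "hoelder_on {0..1} \<beta> v'"
      using hoelder_on_exponent_le[OF assms(21) exponent(3)] hoelder_on_exponent_le[OF assms(20) exponent(3)] by auto
    show "0 < v t" if "t \<in> {0..1}" for t using v0[OF that] by linarith
    show "0 < c" "0 < v0" using c[of 0] v0[of 0] by auto
  qed (use gp assms(3-5,13,18) c v0 cov q0 q_less exponent in auto)
  have "(\<lambda>n. le_cam_dist (experiment1 P \<Xi> n (hoelder_class \<alpha> L M))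
                          (experiment2 P \<Xi> n (hoelder_class \<alpha> L M))) \<longlonglongrightarrow> 0"
    by (rule le_cam_dist_tendsto) (use exponent assms(9,11) in auto)
  then show ?thesis by blast
qed

end
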